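(* Let $N\ge3$. Assume $f\in C^2([0,\infty))$ is nondecreasing and convex, $f>0$ in $(0,\infty)$, and the limit $q_0=\lim_{u\to0^+}q(u)$ exists in $\overline{\mathbb{R}}$; let $p_0$ be the conjugate exponent of $q_0$. Assume $u\in C^2(\mathbb{R}^N)$ is a bounded, nonnegative solution of $-\Delta u=f(u)$ in $\mathbb{R}^N$ which is stable outside a compact set. Assume that $p_0$ is in the supercritical range, i.e. $$\frac{N+2}{N-2}<p_0<+\infty\ \text{ if } 3\le N\le10,\qquad \frac{N+2}{N-2}<p_0<p_c(N)\ \text{ if } N\ge11,$$ that there exist constants $\varepsilon,c_1,c_2>0$ such that $$f(u)\ge c_1u^{p_0}\quad\text{and}\quad f'(u)\le c_2u^{p_0-1}\qquad\text{for all } u\in(0,\varepsilon),$$ and that $$(p_0+1)F(s)\le sf(s)\qquad\text{for all } s\ge0,$$ where $F(s)=\int_0^sf(t)\,dt$. Then $u\equiv0$.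
   Context: For $u>0$, $q(u)=\dfrac{f'(u)^2}{f(u)f''(u)}$ if $f(u)f''(u)\ne0$, and $q(u)=+\infty$ otherwise. The conjugate exponent $p_0\in\overline{\mathbb{R}}$ of $q_0$ is defined by $1/p_0+1/q_0=1$, i.e. $p_0=q_0/(q_0-1)$ if $q_0\notin\{1,+\infty\}$, $p_0=+\infty$ if $q_0=1$, $p_0=1$ if $q_0=+\infty$. For $N\ge 11$, $p_c(N)=\dfrac{(N-2)^2-4N+8\sqrt{N-1}}{(N-2)(N-10)}$. A solution $u$ of $-\Delta u=f(u)$ in $\mathbb{R}^N$ is stable outside a compact set if there is a compact set $K\subset\mathbb{R}^N$ such that $\int_{\mathbb{R}^N} f'(u)\varphi^2\,dx\le\int_{\mathbb{R}^N}|\nabla\varphi|^2\,dx$ for all $\varphi\in C^1_c(\mathbb{R}^N\setminus K)$. *)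

theory Defs
  imports "HOL-Analysis.Analysis"
begin

text \<open>
  Functions on the half-line are total functions of which only the values on \<open>{0..}\<close> matter.
  The derivative is taken within \<open>{0..}\<close>: one-sided at 0, the ordinary one elsewhere.
\<close>

definition half_deriv :: "(real \<Rightarrow> real) \<Rightarrow> real \<Rightarrow> real" where
  "half_deriv f s = vector_derivative f (at s within {0..})"

definition C2_half :: "(real \<Rightarrow> real) \<Rightarrow> bool" where
  "C2_half f \<longleftrightarrow> f differentiable_on {0..} \<and> half_deriv f differentiable_on {0..} \<and>
     continuous_on {0..} (half_deriv (half_deriv f))"

definition q_fun :: "(real \<Rightarrow> real) \<Rightarrow> real \<Rightarrow> ereal" where
  "q_fun f s =
     (if f s * half_deriv (half_deriv f) s \<noteq> 0
      then ereal ((half_deriv f s)\<^sup>2 / (f s * half_deriv (half_deriv f) s))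
      else \<infinity>)"

text \<open>
  The solution \<open>p\<close> of \<open>1/p + 1/q = 1\<close>. The value at \<open>-\<infinity>\<close> is immaterial here: \<open>q_fun f\<close> is
  nonnegative on \<open>{0<..}\<close> for convex positive \<open>f\<close>, hence so are its limits.
\<close>

definition conjugate_exponent :: "ereal \<Rightarrow> ereal" where
  "conjugate_exponent q =
     (if q = 1 then \<infinity> else if \<bar>q\<bar> = \<infinity> then 1 else q / (q - 1))"

definition p_crit :: "nat \<Rightarrow> real" where
  "p_crit N = ((real N - 2)\<^sup>2 - 4 * real N + 8 * sqrt (real N - 1)) /
              ((real N - 2) * (real N - 10))"

definition supercritical :: "nat \<Rightarrow> ereal \<Rightarrow> bool" where
  "supercritical N p \<longleftrightarrow>
     ereal ((real N + 2) / (real N - 2)) < p \<and>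
     (N \<le> 10 \<longrightarrow> p < \<infinity>) \<and>
     (N \<ge> 11 \<longrightarrow> p < ereal (p_crit N))"

definition partial :: "'a::euclidean_space \<Rightarrow> ('a \<Rightarrow> real) \<Rightarrow> 'a \<Rightarrow> real" where
  "partial b u x = frechet_derivative u (at x) b"

definition C1 :: "('a::euclidean_space \<Rightarrow> real) \<Rightarrow> bool" where
  "C1 u \<longleftrightarrow> u differentiable_on UNIV \<and> (\<forall>b\<in>Basis. continuous_on UNIV (partial b u))"

definition C2 :: "('a::euclidean_space \<Rightarrow> real) \<Rightarrow> bool" where
  "C2 u \<longleftrightarrow> C1 u \<and> (\<forall>b\<in>Basis. C1 (partial b u))"

definition grad :: "('a::euclidean_space \<Rightarrow> real) \<Rightarrow> 'a \<Rightarrow> 'a" where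
  "grad u x = (\<Sum>b\<in>Basis. partial b u x *\<^sub>R b)"

definition laplacian :: "('a::euclidean_space \<Rightarrow> real) \<Rightarrow> 'a \<Rightarrow> real" where
  "laplacian u x = (\<Sum>b\<in>Basis. partial b (partial b u) x)"

text \<open>
  Compactly supported functions on an open set \<open>S\<close> are identified with their extensions by
  zero to the whole space.
\<close>

definition C1_compact_support :: "'a::euclidean_space set \<Rightarrow> ('a \<Rightarrow> real) \<Rightarrow> bool" where
  "C1_compact_support S \<phi> \<longleftrightarrow>
     C1 \<phi> \<and> compact (closure {x. \<phi> x \<noteq> 0}) \<and> closure {x. \<phi> x \<noteq> 0} \<subseteq> S"

definition stable_outside_compact ::
    "(real \<Rightarrow> real) \<Rightarrow> ('a::euclidean_space \<Rightarrow> real) \<Rightarrow> bool" where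
  "stable_outside_compact f u \<longleftrightarrow>
     (\<exists>K. compact K \<and>
       (\<forall>\<phi>. C1_compact_support (- K) \<phi> \<longrightarrow>
          (\<integral>x. half_deriv f (u x) * (\<phi> x)\<^sup>2 \<partial>lborel) \<le> (\<integral>x. (norm (grad \<phi> x))\<^sup>2 \<partial>lborel)))"

end

theory Submission
  imports Defs
begin

text \<open>
  Write \<open>N\<close> for the dimension and \<open>p\<close> for \<open>p0\<close>. Near 0 both \<open>f\<close> and \<open>s f'\<close> are comparable with
  \<open>s\<^sup>p\<close>, and the limit of \<open>q\<close> gives \<open>s\<^sup>2 f'' / f \<longlongrightarrow> p (p - 1)\<close>. Testing stability with \<open>\<psi>(u) \<zeta>\<close>, where
  \<open>\<psi>\<close> behaves like \<open>s\<^sup>\<beta>\<close> at 0 and is a multiple of \<open>f\<close> for larger \<open>s\<close>, and the equation with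
  \<open>\<integral> \<psi>'\<^sup>2\<close>, gives an estimate of \<open>u\<^bsup>2\<beta>+p-1\<^esup>\<close> outside a compact set whenever \<open>(\<beta> - p)\<^sup>2 < p (p - 1)\<close>.
  The bounds on \<open>p\<close> say exactly that the scaling-invariant exponent \<open>Q = N (p - 1) / 2\<close> is attained
  for an admissible \<open>\<beta> > 1\<close>, so \<open>u\<^sup>Q\<close> is integrable at infinity.

  Smallness of the tail of \<open>\<integral> u\<^sup>Q\<close> and the mean value inequality give \<open>u = o(|x|\<^bsup>-2/(p-1)\<^esup>)\<close>. Hence
  \<open>f(u) \<le> \<epsilon> |x|\<^bsup>-2\<^esup> u\<close> far out, and comparison with sums of powers of \<open>|x|\<close> improves this to
  \<open>u = O(|x|\<^bsup>-a\<^esup>)\<close> with \<open>a > (N - 2) / 2\<close>. This makes the boundary terms in the Pohozaev identity vanish,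
  and \<open>(p + 1) F(s) \<le> s f(s)\<close> with \<open>p\<close> supercritical forces \<open>u f(u) = 0\<close>.
\<close>

section \<open>Integration by parts for compactly supported fields\<close>

text \<open>The limit of \<open>q\<close> controls f'' only as its argument tends to 0, while
  stability is tested on the whole range [0, M] of u. Away from 0 only f'' \<ge> 0 is known, and a
  weight proportional to f needs no more than that; hence the glued weight. Prescribing 2 \<beta> +
  p - 1 = N (p - 1) / 2 fixes \<beta> = (N - 2) (p - 1) / 4. At this exponent the error of a cutoff
  at radius r is r^-N times the volume of a ball of radius of order r: bounded, but not small.
  Smallness therefore comes from tails, and pointwise decay from a rescaling argument. The decay
  o(|x|^(-2/(p-1))) does not suffice for the Pohozaev identity: its boundary terms are O(r^(N-2-2a))
  if u = O(|x|^-a), and 2/(p-1) < (N-2)/2 for supercritical p. This is why a comparison with powers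
  is inserted. Gradients are never estimated pointwise; a Caccioppoli inequality bounds them in the
  mean. All cutoffs depend on |x|^2 and all integrals are over the whole space, so every integration
  by parts rests on one fact: the divergence of a compactly supported field has integral 0.\<close>

lemma continuous_compact_support_integrable:
  fixes g :: "'a::euclidean_space \<Rightarrow> real"
  assumes "continuous_on UNIV g" and "\<And>x. norm x \<ge> R \<Longrightarrow> g x = 0"
  shows "integrable lborel g"
proof -
  have "integrable lborel (\<lambda>x. indicator (cball 0 R) x *\<^sub>R g x)"
    by (rule borel_integrable_compact) (use assms(1) continuous_on_subset in auto)
  also have "(\<lambda>x. indicator (cball 0 R) x *\<^sub>R g x) = g"
    using assms(2) by (auto simp: fun_eq_iff indicator_def not_le less_imp_le)
  finally show ?thesis .
qed

lemma integrable_indicator_bounded: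
  fixes S :: "'a::euclidean_space set"
  assumes "bounded S" "S \<in> sets borel"
  shows "integrable lborel (indicator S :: 'a \<Rightarrow> real)"
  using assms emeasure_bounded_finite[OF assms(1)] by (intro integrable_real_indicator) auto

lemma integral_translation:
  fixes g :: "'a::euclidean_space \<Rightarrow> real"
  assumes "continuous_on UNIV g"
  shows "(\<integral>x. g (c + x) \<partial>lborel) = (\<integral>x. g x \<partial>lborel)"
proof -
  have "g \<in> borel_measurable borel"
    using assms by (rule borel_measurable_continuous_onI)
  then have "(\<integral>x. g x \<partial>distr lborel borel ((+) c)) = (\<integral>x. g (c + x) \<partial>lborel)"
    by (intro integral_distr) auto
  then show ?thesis by (simp add: lborel_distr_plus)
qed

lemma has_real_derivative_along_line:
  fixes g :: "'a::euclidean_space \<Rightarrow> real"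
  assumes "(g has_derivative D) (at (x + t *\<^sub>R b))"
  shows "((\<lambda>t. g (x + t *\<^sub>R b)) has_real_derivative D b) (at t)"
proof -
  have "((\<lambda>t. g (x + t *\<^sub>R b)) has_derivative (\<lambda>s. D (s *\<^sub>R b))) (at t)"
    by (rule has_derivative_compose[of "\<lambda>t. x + t *\<^sub>R b" _ t UNIV g D]) (auto intro!: derivative_eq_intros assms)
  moreover have "(\<lambda>s. D (s *\<^sub>R b)) = (*) (D b)"
    using linear_scale[OF has_derivative_linear[OF assms]] by (auto simp: fun_eq_iff)
  ultimately show ?thesis by (simp add: has_field_derivative_def)
qed

text \<open>A difference quotient of \<open>g\<close> has integral 0 by translation invariance, and
  the quotients converge dominatedly to the directional derivative. All increments are at most 1, so
  the quotients vanish outside radius R + 1 and, by the mean value theorem, are bounded by the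
  derivative on radius R + 2.\<close>

lemma integral_directional_derivative_eq_0:
  fixes g :: "'a::euclidean_space \<Rightarrow> real"
  assumes der: "\<And>x. (g has_derivative Dg x) (at x)"
    and cont: "continuous_on UNIV (\<lambda>x. Dg x b)" and nb: "norm b = 1"
    and supp: "\<And>x. norm x \<ge> R \<Longrightarrow> g x = 0"
  shows "(\<integral>x. Dg x b \<partial>lborel) = 0"
proof -
  have gc: "continuous_on UNIV g"
    using der by (meson continuous_at_imp_continuous_on has_derivative_continuous)
  define s where "s n x = (g (inverse (real (Suc n)) *\<^sub>R b + x) - g x) * real (Suc n)" for n x
  have gi: "integrable lborel g"
    using gc supp by (rule continuous_compact_support_integrable)
  have gti: "integrable lborel (\<lambda>x. g (c + x))" for c
  proof (rule continuous_compact_support_integrable)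
    show "continuous_on UNIV (\<lambda>x. g (c + x))"
      by (rule continuous_on_compose2[OF gc]) (auto intro!: continuous_intros)
    show "g (c + x) = 0" if "norm x \<ge> R + norm c" for x
      using that norm_triangle_ineq4[of "c + x" c] by (intro supp) (simp add: algebra_simps)
  qed
  have s0: "(\<integral>x. s n x \<partial>lborel) = 0" for n
    unfolding s_def using gi gti by (simp add: integral_translation[OF gc])
  have "bounded ((\<lambda>x. Dg x b) ` cball 0 (R + 2))"
    using cont by (intro compact_imp_bounded compact_continuous_image)
      (auto intro: continuous_on_subset)
  then obtain B where "\<forall>x\<in>cball 0 (R + 2). \<bar>Dg x b\<bar> \<le> B"
    by (auto simp: bounded_iff)
  then have B: "\<And>x. norm x \<le> R + 2 \<Longrightarrow> \<bar>Dg x b\<bar> \<le> B" by simp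
  have lim: "(\<lambda>n. s n x) \<longlonglongrightarrow> Dg x b" for x
  proof -
    have "((\<lambda>t. g (x + t *\<^sub>R b)) has_real_derivative Dg x b) (at 0)"
      using has_real_derivative_along_line[of g "Dg x" x 0 b] der by simp
    then have "((\<lambda>t. (g (x + t *\<^sub>R b) - g x) / t) \<longlongrightarrow> Dg x b) (at 0)"
      by (simp add: has_field_derivative_iff)
    moreover have "filterlim (\<lambda>n. inverse (real (Suc n))) (at 0) sequentially"
      unfolding filterlim_at using LIMSEQ_inverse_real_of_nat by (auto simp del: of_nat_Suc)
    ultimately have "(\<lambda>n. (g (x + inverse (real (Suc n)) *\<^sub>R b) - g x) / inverse (real (Suc n)))
        \<longlonglongrightarrow> Dg x b"
      by (rule filterlim_compose)
    then show ?thesis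
      by (simp add: s_def add.commute divide_inverse)
  qed
  have bd: "norm (s n x) \<le> indicator (cball 0 (R + 1)) x *\<^sub>R B" for n x
  proof -
    define h where "h = inverse (real (Suc n))"
    have h: "0 < h" "h \<le> 1" by (auto simp: h_def inverse_le_1_iff)
    have "\<exists>z. z > 0 \<and> z < h \<and> g (x + h *\<^sub>R b) - g (x + 0 *\<^sub>R b) = (h - 0) * Dg (x + z *\<^sub>R b) b"
      using h(1) by (rule MVT2) (use has_real_derivative_along_line[OF der] in auto)
    then obtain z where z: "0 < z" "z < h" "g (x + h *\<^sub>R b) - g x = h * Dg (x + z *\<^sub>R b) b"
      by auto
    have hs: "s n x = (g (x + h *\<^sub>R b) - g x) / h"
      by (simp add: s_def h_def add.commute divide_inverse)
    show ?thesis
    proof (cases "norm x \<le> R + 1")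
      case True
      have "norm (x + z *\<^sub>R b) \<le> R + 2"
        using norm_triangle_ineq[of x "z *\<^sub>R b"] z h nb True by simp
      with B have "\<bar>Dg (x + z *\<^sub>R b) b\<bar> \<le> B" by blast
      then show ?thesis using z(3) h True by (simp add: hs)
    next
      case False
      have "norm x - norm (h *\<^sub>R b) \<le> norm (x + h *\<^sub>R b)" by (rule norm_diff_ineq)
      then have "g (x + h *\<^sub>R b) = 0" "g x = 0"
        using False h nb by (auto intro!: supp)
      then show ?thesis using False by (simp add: hs)
    qed
  qed
  have "(\<lambda>n. \<integral>x. s n x \<partial>lborel) \<longlonglongrightarrow> (\<integral>x. Dg x b \<partial>lborel)"
  proof (rule integral_dominated_convergence)
    show "integrable lborel (\<lambda>x::'a. indicator (cball 0 (R + 1)) x *\<^sub>R B)"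
      by (rule borel_integrable_compact) auto
    show "(\<lambda>x. Dg x b) \<in> borel_measurable lborel"
      using borel_measurable_continuous_onI[OF cont] by simp
    show "s n \<in> borel_measurable lborel" for n
      using gi gti unfolding s_def by (auto dest!: borel_measurable_integrable)
  qed (use lim bd in auto)
  then show ?thesis by (simp add: s0 LIMSEQ_const_iff)
qed

text \<open>Each component \<open>\<phi> x * (X x \<bullet> b)\<close> is differentiated in its own
  direction b; the sum is the divergence of \<open>\<phi> X\<close>. Putting the support condition
  on the product lets either factor carry the cutoff.\<close>

lemma integral_divergence_eq_0:
  fixes \<phi> :: "'a::euclidean_space \<Rightarrow> real" and X :: "'a \<Rightarrow> 'a"
  assumes dphi: "\<And>x. (\<phi> has_derivative D\<phi> x) (at x)"
    and dX: "\<And>x. (X has_derivative DX x) (at x)"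
    and cphi: "\<And>b. b \<in> Basis \<Longrightarrow> continuous_on UNIV (\<lambda>x. D\<phi> x b)"
    and cX: "\<And>b. b \<in> Basis \<Longrightarrow> continuous_on UNIV (\<lambda>x. DX x b)"
    and supp: "\<And>x. norm x \<ge> R \<Longrightarrow> \<phi> x = 0 \<or> X x = 0"
  shows "integrable lborel (\<lambda>x. D\<phi> x (X x) + \<phi> x * (\<Sum>b\<in>Basis. DX x b \<bullet> b))"
    and "(\<integral>x. D\<phi> x (X x) + \<phi> x * (\<Sum>b\<in>Basis. DX x b \<bullet> b) \<partial>lborel) = 0"
proof -
  have contphi: "continuous_on UNIV \<phi>"
    using dphi by (meson continuous_at_imp_continuous_on has_derivative_continuous)
  have contX: "continuous_on UNIV X"
    using dX by (meson continuous_at_imp_continuous_on has_derivative_continuous)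
  define e where "e b x = D\<phi> x b * (X x \<bullet> b) + \<phi> x * (DX x b \<bullet> b)" for b x
  have der: "((\<lambda>x. \<phi> x * (X x \<bullet> b)) has_derivative
      (\<lambda>h. D\<phi> x h * (X x \<bullet> b) + \<phi> x * (DX x h \<bullet> b))) (at x)" for b x
    by (rule derivative_eq_intros dphi dX refl)+ (simp add: algebra_simps)
  have ce: "continuous_on UNIV (e b)" if "b \<in> Basis" for b
    unfolding e_def by (intro continuous_intros cphi cX contphi contX that)
  have i0: "(\<integral>x. e b x \<partial>lborel) = 0" if "b \<in> Basis" for b
    using integral_directional_derivative_eq_0[OF der ce[OF that, unfolded e_def], of R] that supp
    by (force simp: e_def)
  \<comment> \<open>The derivative is known to vanish only where the product vanishes on a whole
    neighbourhood, hence the enlarged radius; \<open>\<bar>R\<bar>\<close> covers negative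
    R.\<close>
  have e0: "e b x = 0" if "norm x \<ge> \<bar>R\<bar> + 1" "b \<in> Basis" for b x
  proof -
    have ev: "eventually (\<lambda>y. \<phi> y * (X y \<bullet> b) = 0) (nhds x)"
    proof -
      have "eventually (\<lambda>y. y \<in> - cball 0 \<bar>R\<bar>) (nhds x)"
        by (rule eventually_nhds_in_open) (use that in auto)
      then show ?thesis
        by eventually_elim (use supp in force)
    qed
    have "((\<lambda>x. 0::real) has_derivative
      (\<lambda>h. D\<phi> x h * (X x \<bullet> b) + \<phi> x * (DX x h \<bullet> b))) (at x)"
      by (rule has_derivative_transform_eventually[OF der])
        (use ev in \<open>auto simp: eventually_at_filter elim: eventually_mono dest: eventually_nhds_x_imp_x\<close>)
    from has_derivative_unique[OF this has_derivative_const]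
    have "(\<lambda>h. D\<phi> x h * (X x \<bullet> b) + \<phi> x * (DX x h \<bullet> b)) = (\<lambda>h. 0)" .
    then show ?thesis unfolding e_def by meson
  qed
  have ie: "integrable lborel (e b)" if "b \<in> Basis" for b
    by (rule continuous_compact_support_integrable[OF ce[OF that]]) (use e0 that in auto)
  have eq: "(\<lambda>x. D\<phi> x (X x) + \<phi> x * (\<Sum>b\<in>Basis. DX x b \<bullet> b)) = (\<lambda>x. \<Sum>b\<in>Basis. e b x)"
  proof
    fix x
    have "D\<phi> x (X x) = D\<phi> x (\<Sum>b\<in>Basis. (X x \<bullet> b) *\<^sub>R b)"
      by (simp add: euclidean_representation)
    also have "\<dots> = (\<Sum>b\<in>Basis. (X x \<bullet> b) * D\<phi> x b)"
      using has_derivative_linear[OF dphi[of x]] by (simp add: linear_sum linear_scale)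
    finally show "D\<phi> x (X x) + \<phi> x * (\<Sum>b\<in>Basis. DX x b \<bullet> b) = (\<Sum>b\<in>Basis. e b x)"
      by (simp add: e_def sum.distrib sum_distrib_left mult.commute)
  qed
  show "integrable lborel (\<lambda>x. D\<phi> x (X x) + \<phi> x * (\<Sum>b\<in>Basis. DX x b \<bullet> b))"
    unfolding eq by (intro Bochner_Integration.integrable_sum ie)
  show "(\<integral>x. D\<phi> x (X x) + \<phi> x * (\<Sum>b\<in>Basis. DX x b \<bullet> b) \<partial>lborel) = 0"
    unfolding eq by (subst Bochner_Integration.integral_sum) (auto intro: ie simp: i0)
qed

section \<open>Second derivatives: symmetry of the Hessian, local maxima\<close>

lemma second_difference_mean_value:
  fixes v :: "'a::euclidean_space \<Rightarrow> real"
  assumes dv: "\<And>x. (v has_derivative (\<lambda>h. G x \<bullet> h)) (at x)"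
    and dG: "\<And>x. (G has_derivative DG x) (at x)" and h: "h > 0"
  shows "\<exists>s t. 0 < s \<and> s < h \<and> 0 < t \<and> t < h \<and>
    v (x + h *\<^sub>R a + h *\<^sub>R b) - v (x + h *\<^sub>R a) - v (x + h *\<^sub>R b) + v x
      = h * h * (DG (x + s *\<^sub>R a + t *\<^sub>R b) b \<bullet> a)"
proof -
  define \<phi> where "\<phi> s = v ((x + h *\<^sub>R b) + s *\<^sub>R a) - v (x + s *\<^sub>R a)" for s
  have "\<exists>s. 0 < s \<and> s < h \<and> \<phi> h - \<phi> 0 =
      (h - 0) * (G ((x + h *\<^sub>R b) + s *\<^sub>R a) \<bullet> a - G (x + s *\<^sub>R a) \<bullet> a)"
    unfolding \<phi>_def
    by (rule MVT2[OF h]) (intro derivative_intros has_real_derivative_along_line[OF dv])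
  then obtain s where s: "0 < s" "s < h"
    "\<phi> h - \<phi> 0 = h * (G ((x + h *\<^sub>R b) + s *\<^sub>R a) \<bullet> a - G (x + s *\<^sub>R a) \<bullet> a)"
    by auto
  have dGa: "((\<lambda>y. G y \<bullet> a) has_derivative (\<lambda>k. DG y k \<bullet> a)) (at y)" for y
    by (auto intro!: derivative_eq_intros dG)
  have "\<exists>t. 0 < t \<and> t < h \<and> G ((x + s *\<^sub>R a) + h *\<^sub>R b) \<bullet> a - G ((x + s *\<^sub>R a) + 0 *\<^sub>R b) \<bullet> a =
      (h - 0) * (DG ((x + s *\<^sub>R a) + t *\<^sub>R b) b \<bullet> a)"
    by (rule MVT2[OF h]) (intro has_real_derivative_along_line[OF dGa])
  then obtain t where t: "0 < t" "t < h"
    "G ((x + s *\<^sub>R a) + h *\<^sub>R b) \<bullet> a - G (x + s *\<^sub>R a) \<bullet> a = h * (DG ((x + s *\<^sub>R a) + t *\<^sub>R b) b \<bullet> a)"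
    by auto
  have "(x + h *\<^sub>R b) + s *\<^sub>R a = (x + s *\<^sub>R a) + h *\<^sub>R b" "x + h *\<^sub>R b + h *\<^sub>R a = x + h *\<^sub>R a + h *\<^sub>R b"
    by (simp_all add: algebra_simps)
  then show ?thesis
    using s t by (intro exI[of _ s] exI[of _ t]) (simp add: \<phi>_def algebra_simps)
qed

text \<open>The second difference quotient is symmetric in a and b, while the two orders of applying
  the mean value theorem turn it into either mixed derivative at a nearby point; by continuity both
  have the same limit. The Pohozaev identity needs this to exchange
  \<open>DG x (G x) \<bullet> x\<close> and \<open>DG x x \<bullet> G x\<close>.\<close>

lemma second_derivative_symmetric:
  fixes v :: "'a::euclidean_space \<Rightarrow> real"
  assumes dv: "\<And>x. (v has_derivative (\<lambda>h. G x \<bullet> h)) (at x)"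
    and dG: "\<And>x. (G has_derivative DG x) (at x)"
    and ca: "continuous_on UNIV (\<lambda>x. DG x a)" and cb: "continuous_on UNIV (\<lambda>x. DG x b)"
  shows "DG x a \<bullet> b = DG x b \<bullet> a"
proof -
  define h where "h n = inverse (real (Suc n))" for n
  have h: "h n > 0" for n by (simp add: h_def)
  have h0: "h \<longlonglongrightarrow> 0" unfolding h_def by (rule LIMSEQ_inverse_real_of_nat)
  define \<Delta> where "\<Delta> n = (v (x + h n *\<^sub>R a + h n *\<^sub>R b) - v (x + h n *\<^sub>R a) - v (x + h n *\<^sub>R b) + v x)
      / (h n * h n)" for n
  have *: "\<Delta> \<longlonglongrightarrow> DG x d \<bullet> c"
    if "continuous_on UNIV (\<lambda>x. DG x d)"
      and D: "\<And>n. \<Delta> n = (v (x + h n *\<^sub>R c + h n *\<^sub>R d) - v (x + h n *\<^sub>R c) - v (x + h n *\<^sub>R d) + v x)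
        / (h n * h n)" for c d
  proof -
    have "\<exists>s t. 0 < s \<and> s < h n \<and> 0 < t \<and> t < h n \<and> \<Delta> n = DG (x + s *\<^sub>R c + t *\<^sub>R d) d \<bullet> c" for n
      using second_difference_mean_value[OF dv dG h[of n], of x c d] h[of n]
      unfolding D by (force simp: field_simps)
    then obtain s t where st: "\<And>n. 0 < s n \<and> s n < h n \<and> 0 < t n \<and> t n < h n \<and>
        \<Delta> n = DG (x + s n *\<^sub>R c + t n *\<^sub>R d) d \<bullet> c"
      by metis
    have s0: "s \<longlonglongrightarrow> 0"
      by (rule tendsto_sandwich[OF _ _ tendsto_const h0]) (auto intro!: always_eventually less_imp_le simp: st)
    have t0: "t \<longlonglongrightarrow> 0"
      by (rule tendsto_sandwich[OF _ _ tendsto_const h0]) (auto intro!: always_eventually less_imp_le simp: st)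
    have "(\<lambda>n. x + s n *\<^sub>R c + t n *\<^sub>R d) \<longlonglongrightarrow> x + 0 *\<^sub>R c + 0 *\<^sub>R d"
      by (intro tendsto_intros s0 t0)
    then have "(\<lambda>n. DG (x + s n *\<^sub>R c + t n *\<^sub>R d) d) \<longlonglongrightarrow> DG x d"
      using continuous_on_tendsto_compose[OF that(1)] by auto
    then have "(\<lambda>n. DG (x + s n *\<^sub>R c + t n *\<^sub>R d) d \<bullet> c) \<longlonglongrightarrow> DG x d \<bullet> c"
      by (intro tendsto_intros)
    moreover have "\<Delta> = (\<lambda>n. DG (x + s n *\<^sub>R c + t n *\<^sub>R d) d \<bullet> c)" using st by blast
    ultimately show ?thesis by simp
  qed
  have "\<Delta> \<longlonglongrightarrow> DG x b \<bullet> a" by (rule *[OF cb]) (simp add: \<Delta>_def)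
  moreover have "\<Delta> \<longlonglongrightarrow> DG x a \<bullet> b" by (rule *[OF ca]) (simp add: \<Delta>_def algebra_simps)
  ultimately show ?thesis by (rule LIMSEQ_unique[rotated])
qed

text \<open>In each coordinate direction the slope vanishes at x; a positive second derivative would
  make it positive just to the right, and v would increase there.\<close>

lemma laplacian_nonpos_at_local_max:
  fixes v :: "'a::euclidean_space \<Rightarrow> real"
  assumes e: "e > 0" and dv: "\<And>y. y \<in> ball x e \<Longrightarrow> (v has_derivative (\<lambda>h. G y \<bullet> h)) (at y)"
    and dG: "(G has_derivative DG) (at x)"
    and max: "\<And>y. y \<in> ball x e \<Longrightarrow> v y \<le> v x"
  shows "(\<Sum>b\<in>Basis. DG b \<bullet> b) \<le> 0"
proof (rule sum_nonpos)
  fix b :: 'a assume b: "b \<in> Basis"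
  define \<phi> where "\<phi> t = v (x + t *\<^sub>R b)" for t
  define \<phi>' where "\<phi>' t = G (x + t *\<^sub>R b) \<bullet> b" for t
  have inb: "x + t *\<^sub>R b \<in> ball x e" if "\<bar>t\<bar> < e" for t
    using that b by (simp add: dist_norm)
  have d1: "(\<phi> has_real_derivative \<phi>' t) (at t)" if "\<bar>t\<bar> < e" for t
    unfolding \<phi>_def \<phi>'_def by (rule has_real_derivative_along_line[OF dv[OF inb[OF that]]])
  have d2: "(\<phi>' has_real_derivative DG b \<bullet> b) (at 0)"
    unfolding \<phi>'_def
    by (rule has_real_derivative_along_line[where D = "\<lambda>k. DG k \<bullet> b"])
      (auto intro!: derivative_eq_intros dG)
  have z: "\<phi>' 0 = 0"
    by (rule DERIV_local_max[OF d1[of 0] e]) (use e inb max in \<open>auto simp: \<phi>_def\<close>)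
  show "DG b \<bullet> b \<le> 0"
  proof (rule ccontr)
    assume "\<not> DG b \<bullet> b \<le> 0"
    then obtain d where d: "d > 0" "\<And>t. 0 < t \<Longrightarrow> t < d \<Longrightarrow> \<phi>' t > \<phi>' 0"
      using DERIV_pos_inc_right[OF d2] by auto
    define r where "r = min d e / 2"
    have r: "r > 0" "r < d" "r < e" using d e by (auto simp: r_def min_def)
    have "\<exists>t. 0 < t \<and> t < r \<and> \<phi> r - \<phi> 0 = (r - 0) * \<phi>' t"
      by (rule MVT2[OF r(1)]) (use r d1 in auto)
    then obtain t where "0 < t" "t < r" "\<phi> r - \<phi> 0 = r * \<phi>' t" by auto
    then have "\<phi> r > \<phi> 0" using d r z by (smt (verit) mult_pos_pos)
    moreover have "\<phi> r \<le> \<phi> 0" using max[OF inb[of r]] r by (simp add: \<phi>_def)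
    ultimately show False by simp
  qed
qed

section \<open>Gradients and Hessians as Frechet derivatives\<close>

lemma has_derivative_grad:
  assumes "v differentiable (at x)"
  shows "(v has_derivative (\<lambda>h. grad v x \<bullet> h)) (at x)"
proof -
  have d: "(v has_derivative frechet_derivative v (at x)) (at x)"
    using assms by (simp add: frechet_derivative_works)
  have "frechet_derivative v (at x) h = grad v x \<bullet> h" for h
  proof -
    have "frechet_derivative v (at x) h = frechet_derivative v (at x) (\<Sum>b\<in>Basis. (h \<bullet> b) *\<^sub>R b)"
      by (simp add: euclidean_representation)
    also have "\<dots> = (\<Sum>b\<in>Basis. (h \<bullet> b) * frechet_derivative v (at x) b)"
      using has_derivative_linear[OF d] by (simp add: linear_sum linear_scale)
    finally show ?thesis
      by (simp add: grad_def partial_def inner_sum_left inner_sum_right inner_commute mult.commute)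
  qed
  then have "frechet_derivative v (at x) = (\<lambda>h. grad v x \<bullet> h)" by blast
  with d show ?thesis by simp
qed

lemma grad_unique:
  assumes "(v has_derivative (\<lambda>h. G \<bullet> h)) (at x)"
  shows "grad v x = G" and "partial b v x = G \<bullet> b"
proof -
  have "v differentiable (at x)" using assms differentiable_def by blast
  from has_derivative_unique[OF has_derivative_grad[OF this] assms]
  show "grad v x = G" by (metis vector_eq_rdot inner_commute)
  show "partial b v x = G \<bullet> b"
    unfolding partial_def frechet_derivative_at[OF assms, symmetric] ..
qed

lemma C1_I:
  assumes "\<And>x. (v has_derivative (\<lambda>h. G x \<bullet> h)) (at x)" "continuous_on UNIV G"
  shows "C1 v"
proof -
  have "partial b v = (\<lambda>x. G x \<bullet> b)" for b using grad_unique(2)[OF assms(1)] by auto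
  moreover have "v differentiable_on UNIV"
    using assms(1) unfolding differentiable_on_def differentiable_def by auto
  ultimately show ?thesis
    unfolding C1_def by (auto intro!: continuous_intros assms(2))
qed

text \<open>Passes from iterated partial derivatives to the single vector field
  \<open>grad v\<close> with Frechet derivative \<open>DG\<close>, the Hessian, whose trace is the
  Laplacian. The divergence computations all use this form.\<close>

lemma C2_D:
  assumes "C2 v"
  obtains DG where "\<And>x. (v has_derivative (\<lambda>h. grad v x \<bullet> h)) (at x)"
    "\<And>x. (grad v has_derivative DG x) (at x)"
    "\<And>b. continuous_on UNIV (\<lambda>x. DG x b)"
    "\<And>x. laplacian v x = (\<Sum>b\<in>Basis. DG x b \<bullet> b)"
proof -
  define DG where "DG x h = (\<Sum>b\<in>Basis. (grad (partial b v) x \<bullet> h) *\<^sub>R b)" for x h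
  have p: "partial b v differentiable (at x)" if "b \<in> Basis" for b x
    using assms that by (auto simp: C2_def C1_def differentiable_on_def)
  have cg: "continuous_on UNIV (grad (partial b v))" if "b \<in> Basis" for b
    using assms that unfolding C2_def C1_def grad_def[abs_def] by (auto intro!: continuous_intros)
  show ?thesis
  proof
    show "(v has_derivative (\<lambda>h. grad v x \<bullet> h)) (at x)" for x
      by (rule has_derivative_grad) (use assms in \<open>auto simp: C2_def C1_def differentiable_on_def\<close>)
    show "(grad v has_derivative DG x) (at x)" for x
      unfolding DG_def[abs_def] grad_def[of v, abs_def]
      by (intro derivative_intros has_derivative_grad p) auto
    show "continuous_on UNIV (\<lambda>x. DG x b)" for b
      unfolding DG_def[abs_def] by (intro continuous_intros cg) auto
    show "laplacian v x = (\<Sum>b\<in>Basis. DG x b \<bullet> b)" for x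
    proof -
      have "DG x b \<bullet> b = partial b (partial b v) x" if "b \<in> Basis" for b
      proof -
        have "DG x b \<bullet> b = grad (partial b v) x \<bullet> b"
          using that by (simp add: DG_def inner_sum_left inner_Basis if_distrib sum.If_cases cong: if_cong)
        also have "\<dots> = partial b (partial b v) x"
          using grad_unique(2)[OF has_derivative_grad[OF p[OF that]]] by simp
        finally show ?thesis .
      qed
      then show ?thesis by (simp add: laplacian_def)
    qed
  qed
qed

section \<open>Test weights for the stability inequality\<close>

text \<open>Powers of the positive part supply the cutoffs, the bump and the gluing function below;
  each derivative costs one power. At 0 the difference quotient is at most
  \<open>max 0 h ^ (n - 1)\<close>, which tends to 0 as n is at least 2.\<close>

lemma has_real_derivative_pos_part_power:
  assumes "n \<ge> 2"
  shows "((\<lambda>x::real. max 0 x ^ n) has_real_derivative real n * max 0 x ^ (n - 1)) (at x)"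
proof (cases x "0::real" rule: linorder_cases)
  case less
  have "((\<lambda>x::real. 0) has_real_derivative 0) (at x)" by simp
  then have "((\<lambda>x::real. max 0 x ^ n) has_real_derivative 0) (at x)"
    by (rule has_field_derivative_transform_within_open[of _ _ _ "{..<0}"])
      (use less assms in \<open>auto simp: max_def power_0_left\<close>)
  then show ?thesis using less assms by (simp add: max_absorb1 power_0_left)
next
  case greater
  have "((\<lambda>x::real. x ^ n) has_real_derivative real n * x ^ (n - 1)) (at x)"
    by (auto intro!: derivative_eq_intros)
  then have "((\<lambda>x::real. max 0 x ^ n) has_real_derivative real n * x ^ (n - 1)) (at x)"
    by (rule has_field_derivative_transform_within_open[of _ _ _ "{0<..}"])
      (use greater in \<open>auto simp: max_def\<close>)
  then show ?thesis using greater by (simp add: max_def)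
next
  case equal
  have "((\<lambda>h::real. max 0 h ^ n / h) \<longlongrightarrow> 0) (at 0)"
  proof (rule tendsto_rabs_zero_cancel, rule tendsto_sandwich[OF _ _ tendsto_const])
    show "((\<lambda>h::real. max 0 h ^ (n - 1)) \<longlongrightarrow> 0) (at 0)"
      using assms by (auto intro!: tendsto_eq_intros)
    have "\<bar>max 0 h ^ n / h\<bar> \<le> max 0 h ^ (n - 1)" if "h \<noteq> 0" for h :: real
    proof -
      have "max 0 h ^ n = max 0 h * max 0 h ^ (n - 1)" using assms by (cases n) auto
      then show ?thesis using that assms by (auto simp: max_def)
    qed
    then show "eventually (\<lambda>h::real. \<bar>max 0 h ^ n / h\<bar> \<le> max 0 h ^ (n - 1)) (at 0)"
      by (auto simp: eventually_at_filter)
  qed auto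
  then show ?thesis using equal assms by (simp add: has_field_derivative_iff power_0_left)
qed

text \<open>The primitive is 0 for s \<le> 0, so it agrees with the integral from any base point
  below min(0, s); moving the base there makes the derivative two-sided, also at s = 0.\<close>

lemma has_real_derivative_integral_zero_left:
  fixes k :: "real \<Rightarrow> real"
  assumes k: "continuous_on UNIV k" and z: "\<And>s. s \<le> 0 \<Longrightarrow> k s = 0"
  shows "((\<lambda>s. integral {0..s} k) has_real_derivative k s) (at s)"
proof -
  define a where "a = min 0 s - 1"
  have a: "a < 0" "a < s" by (auto simp: a_def)
  have kc: "continuous_on S k" for S using k continuous_on_subset by blast
  have eq: "integral {a..t} k = integral {0..t} k" if "a < t" for t
  proof (cases "t \<ge> 0")
    case True
    have "integral {a..0} k + integral {0..t} k = integral {a..t} k"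
      by (rule Henstock_Kurzweil_Integration.integral_combine)
        (use a True kc in \<open>auto intro: integrable_continuous_interval\<close>)
    moreover have "integral {a..0} k = 0"
      using integral_cong[of "{a..0}" k "\<lambda>_. 0"] z by auto
    ultimately show ?thesis by simp
  next
    case False
    then show ?thesis using integral_cong[of "{a..t}" k "\<lambda>_. 0"] z by auto
  qed
  have "((\<lambda>s. integral {a..s} k) has_real_derivative k s) (at s within {a..s+1})"
    by (rule integral_has_real_derivative) (use a kc in auto)
  moreover have "at s within {a..s+1} = at s"
    by (rule at_within_interior) (use a in auto)
  ultimately have "((\<lambda>s. integral {a..s} k) has_real_derivative k s) (at s)" by simp
  then show ?thesis
    by (rule has_field_derivative_transform_within_open[of _ _ _ "{a<..}"]) (use a eq in auto)
qed

lemma integral_interval_bounds: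
  fixes k :: "real \<Rightarrow> real"
  assumes k: "continuous_on UNIV k" and b: "\<And>t. 0 \<le> t \<Longrightarrow> t \<le> s \<Longrightarrow> 0 \<le> k t \<and> k t \<le> B"
    and s: "s \<ge> 0"
  shows "0 \<le> integral {0..s} k" "integral {0..s} k \<le> B * s"
proof -
  have i: "k integrable_on {0..s}"
    by (rule integrable_continuous_interval) (use k continuous_on_subset in blast)
  show "0 \<le> integral {0..s} k"
    by (rule Henstock_Kurzweil_Integration.integral_nonneg[OF i]) (use b in auto)
  have "integral {0..s} k \<le> integral {0..s} (\<lambda>_. B)"
    by (rule integral_le[OF i]) (use b in auto)
  then show "integral {0..s} k \<le> B * s" using s by (simp add: mult.commute)
qed

text \<open>Stated with min and max because the exponent \<kappa> = \<beta> - p may have either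
  sign.\<close>

lemma powr_comparable:
  fixes a b s m \<kappa> :: real
  assumes "0 < a" "0 < s" "a * s \<le> m" "m \<le> b * s"
  shows "min (a powr \<kappa>) (b powr \<kappa>) * s powr \<kappa> \<le> m powr \<kappa>"
    and "m powr \<kappa> \<le> max (a powr \<kappa>) (b powr \<kappa>) * s powr \<kappa>"
proof -
  have as: "0 < a * s" using assms by simp
  have b: "0 < b" using assms as by (smt (verit) mult_nonpos_nonneg)
  have m: "0 < m" using as assms by linarith
  have e: "(a * s) powr \<kappa> = a powr \<kappa> * s powr \<kappa>" "(b * s) powr \<kappa> = b powr \<kappa> * s powr \<kappa>"
    using assms b by (simp_all add: powr_mult)
  have "min (a powr \<kappa>) (b powr \<kappa>) * s powr \<kappa> \<le> m powr \<kappa> \<and>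
    m powr \<kappa> \<le> max (a powr \<kappa>) (b powr \<kappa>) * s powr \<kappa>"
  proof (cases "\<kappa> \<ge> 0")
    case True
    have "(a * s) powr \<kappa> \<le> m powr \<kappa>" "m powr \<kappa> \<le> (b * s) powr \<kappa>"
      using True as assms m by (auto intro!: powr_mono2)
    then show ?thesis unfolding e
      by (smt (verit) mult_right_mono powr_ge_zero)
  next
    case False
    have "(b * s) powr \<kappa> \<le> m powr \<kappa>" "m powr \<kappa> \<le> (a * s) powr \<kappa>"
      using False as assms m by (auto intro!: powr_mono2')
    then show ?thesis unfolding e
      by (smt (verit) mult_right_mono powr_ge_zero)
  qed
  then show "min (a powr \<kappa>) (b powr \<kappa>) * s powr \<kappa> \<le> m powr \<kappa>"
    "m powr \<kappa> \<le> max (a powr \<kappa>) (b powr \<kappa>) * s powr \<kappa>" by auto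
qed

text \<open>The weights are composed with u, which may take the value 0, and the chain rule asks for
  a two-sided derivative there. With \<beta> > 1 the difference quotient at 0 is
  O(\<open>h powr (\<beta> - 1)\<close>).\<close>

lemma has_real_derivative_extend_zero:
  fixes \<psi> :: "real \<Rightarrow> real"
  assumes z: "\<And>s. s \<le> 0 \<Longrightarrow> \<psi> s = 0" and M: "M > 0" and b: "\<beta> > 1"
    and bd: "\<And>s. 0 < s \<Longrightarrow> s \<le> M \<Longrightarrow> \<bar>\<psi> s\<bar> \<le> C * s powr \<beta>"
  shows "s \<le> 0 \<Longrightarrow> (\<psi> has_real_derivative 0) (at s)"
proof -
  assume s: "s \<le> 0"
  show "(\<psi> has_real_derivative 0) (at s)"
  proof (cases "s < 0")
    case True
    have "((\<lambda>x::real. 0::real) has_real_derivative 0) (at s)" by simp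
    then show ?thesis
      by (rule has_field_derivative_transform_within_open[of _ _ _ "{..<0}"]) (use True z in auto)
  next
    case False
    with s have s0: "s = 0" by simp
    have "((\<lambda>h. \<psi> h / h) \<longlongrightarrow> 0) (at 0)"
    proof (rule tendsto_rabs_zero_cancel, rule tendsto_sandwich[OF _ _ tendsto_const])
      have "((\<lambda>h::real. \<bar>C\<bar> * \<bar>h\<bar> powr (\<beta> - 1)) \<longlongrightarrow> \<bar>C\<bar> * \<bar>0\<bar> powr (\<beta> - 1)) (at 0)"
        by (intro tendsto_intros tendsto_powr') (use b in auto)
      then show "((\<lambda>h::real. \<bar>C\<bar> * \<bar>h\<bar> powr (\<beta> - 1)) \<longlongrightarrow> 0) (at 0)" by simp
      have "\<bar>\<psi> h / h\<bar> \<le> \<bar>C\<bar> * \<bar>h\<bar> powr (\<beta> - 1)" if "h < M" "h \<noteq> 0" for h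
      proof (cases "h > 0")
        case True
        have "\<bar>\<psi> h\<bar> \<le> \<bar>C\<bar> * h powr \<beta>"
          using bd[of h] True that by (smt (verit) mult_right_mono powr_ge_zero)
        then have "\<bar>\<psi> h\<bar> / h \<le> \<bar>C\<bar> * h powr \<beta> / h"
          using True by (intro divide_right_mono) auto
        then show ?thesis using True by (simp add: powr_diff)
      qed (use z in auto)
      then show "eventually (\<lambda>h. \<bar>\<psi> h / h\<bar> \<le> \<bar>C\<bar> * \<bar>h\<bar> powr (\<beta> - 1)) (at 0)"
        unfolding eventually_at using M by (intro exI[of _ M]) auto
    qed auto
    then show ?thesis using s0 z[of 0] by (simp add: has_field_derivative_iff)
  qed
qed

lemma continuous_extend_zero:
  fixes \<psi> :: "real \<Rightarrow> real"
  assumes z: "\<And>s. s \<le> 0 \<Longrightarrow> \<psi> s = 0" and M: "M > 0" and b: "\<beta> > 0"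
    and bd: "\<And>s. 0 < s \<Longrightarrow> s \<le> M \<Longrightarrow> \<bar>\<psi> s\<bar> \<le> C * s powr \<beta>"
    and pos: "\<And>s. s > 0 \<Longrightarrow> isCont \<psi> s"
  shows "continuous_on UNIV \<psi>"
proof (intro continuous_at_imp_continuous_on ballI)
  fix s :: real
  consider "s < 0" | "s = 0" | "s > 0" by linarith
  then show "isCont \<psi> s"
  proof cases
    case 1
    have "isCont (\<lambda>_. 0::real) s" by simp
    moreover have "eventually (\<lambda>t. t < 0) (nhds s)"
      using eventually_nhds_in_open[of "{..<0}" s] 1 by auto
    then have "eventually (\<lambda>t. \<psi> t = 0) (nhds s)"
      by eventually_elim (use z in auto)
    ultimately show ?thesis by (subst isCont_cong)
  next
    case 2
    have "(\<psi> \<longlongrightarrow> 0) (at 0)"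
    proof (rule tendsto_rabs_zero_cancel, rule tendsto_sandwich[OF _ _ tendsto_const])
      have "((\<lambda>h::real. \<bar>C\<bar> * \<bar>h\<bar> powr \<beta>) \<longlongrightarrow> \<bar>C\<bar> * \<bar>0\<bar> powr \<beta>) (at 0)"
        by (intro tendsto_intros tendsto_powr') (use b in auto)
      then show "((\<lambda>h::real. \<bar>C\<bar> * \<bar>h\<bar> powr \<beta>) \<longlongrightarrow> 0) (at 0)" by simp
      have "\<bar>\<psi> h\<bar> \<le> \<bar>C\<bar> * \<bar>h\<bar> powr \<beta>" if "h < M" for h
        using bd[of h] z[of h] that 
        by (cases "h > 0") (auto intro: order_trans mult_right_mono)
      then show "eventually (\<lambda>h. \<bar>\<psi> h\<bar> \<le> \<bar>C\<bar> * \<bar>h\<bar> powr \<beta>) (at 0)"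
        unfolding eventually_at using M by (intro exI[of _ M]) auto
    qed auto
    then show ?thesis using 2 z[of 0] by (simp add: isCont_def)
  qed (use pos in auto)
qed

text \<open>
  Take \<open>\<psi> = f m\<^sup>\<kappa>\<close> with \<open>m\<close> comparable to \<open>s\<close> near 0 and \<open>m = 1\<close> for \<open>s \<ge> \<epsilon>\<close>. The quotient
  \<open>g = f' \<psi>\<^sup>2 / f - K\<close> has \<open>g' = f\<^sup>2 m\<^bsup>2\<kappa>\<^esup> (f'' / f - (\<kappa> m' / m)\<^sup>2)\<close>, which is positive near 0 because
  \<open>\<kappa>\<^sup>2 < p (p - 1)\<close> and \<open>s m' \<le> m\<close>, and nonnegative beyond \<open>\<epsilon>\<close> by convexity of \<open>f\<close> alone.
\<close>
lemma test_weights_exist: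
  fixes f f' f'' :: "real \<Rightarrow> real" and p \<kappa> \<beta> M c1 C1 :: real
  assumes p: "p > 1" and M: "M > 0"
    and d1: "\<And>s. s > 0 \<Longrightarrow> (f has_real_derivative f' s) (at s)"
    and d2: "\<And>s. s > 0 \<Longrightarrow> (f' has_real_derivative f'' s) (at s)"
    and f0: "f 0 = 0" and fpos: "\<And>s. s > 0 \<Longrightarrow> f s > 0"
    and f'pos: "\<And>s. s > 0 \<Longrightarrow> f' s \<ge> 0" and f''pos: "\<And>s. s > 0 \<Longrightarrow> f'' s \<ge> 0"
    and c1: "c1 > 0" and fl: "\<And>s. 0 < s \<Longrightarrow> s \<le> M \<Longrightarrow> c1 * s powr p \<le> f s"
    and fu: "\<And>s. 0 < s \<Longrightarrow> s \<le> M \<Longrightarrow> f s \<le> C1 * s powr p"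
    and f'u: "\<And>s. 0 < s \<Longrightarrow> s \<le> M \<Longrightarrow> f' s \<le> C1 * s powr (p - 1)"
    and lim: "((\<lambda>s. s\<^sup>2 * f'' s / f s) \<longlongrightarrow> p * (p - 1)) (at_right 0)"
    and kap: "\<kappa>\<^sup>2 < p * (p - 1)" and beta: "\<beta> = p + \<kappa>" "\<beta> > 1"
  obtains \<psi> \<psi>' K L c C where
    "\<And>s. (\<psi> has_real_derivative \<psi>' s) (at s)" "continuous_on UNIV \<psi>'"
    "\<And>s. (K has_real_derivative (\<psi>' s)\<^sup>2) (at s)"
    "\<And>s. (L has_real_derivative \<psi> s * \<psi>' s - K s) (at s)"
    "c > 0" "C > 0"
    "\<And>s. 0 \<le> s \<Longrightarrow> s \<le> M \<Longrightarrow> c * s powr (2 * \<beta> + p - 1) \<le> f' s * (\<psi> s)\<^sup>2 - f s * K s"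
    "\<And>s. 0 \<le> s \<Longrightarrow> s \<le> M \<Longrightarrow> (\<psi> s)\<^sup>2 \<le> C * s powr (2 * \<beta>)"
    "\<And>s. 0 \<le> s \<Longrightarrow> s \<le> M \<Longrightarrow> \<bar>L s\<bar> \<le> C * s powr (2 * \<beta>)"
proof -
  \<comment> \<open>Half the gap between \<open>\<kappa>\<^sup>2\<close> and p (p - 1): near 0 the
    quotient s^2 f'' / f then exceeds \<open>\<kappa>\<^sup>2\<close> by the fixed margin
    \<delta>.\<close>
  define \<delta> where "\<delta> = (p * (p - 1) - \<kappa>\<^sup>2) / 2"
  have \<delta>: "\<delta> > 0" "\<kappa>\<^sup>2 + \<delta> < p * (p - 1)" using kap by (auto simp: \<delta>_def field_simps)
  have "eventually (\<lambda>s. s\<^sup>2 * f'' s / f s > \<kappa>\<^sup>2 + \<delta>) (at_right 0)"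
    using order_tendstoD(1)[OF lim \<delta>(2)] .
  then obtain \<epsilon>0 where \<epsilon>0: "\<epsilon>0 > 0" "\<And>s. 0 < s \<Longrightarrow> s < \<epsilon>0 \<Longrightarrow> s\<^sup>2 * f'' s / f s > \<kappa>\<^sup>2 + \<delta>"
    unfolding eventually_at_right_field by auto
  define \<epsilon> where "\<epsilon> = min \<epsilon>0 M / 2"
  have \<epsilon>: "0 < \<epsilon>" "\<epsilon> < M" "\<And>s. 0 < s \<Longrightarrow> s \<le> \<epsilon> \<Longrightarrow> s\<^sup>2 * f'' s / f s > \<kappa>\<^sup>2 + \<delta>"
    using \<epsilon>0 M by (auto simp: \<epsilon>_def min_def split: if_splits)
  \<comment> \<open>Concave with m(0) = 0, hence s m' \<le> m; the square makes it join the constant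
    1 at \<epsilon> with matching slope.\<close>
  define m where "m s = 1 - (max 0 (1 - s / \<epsilon>))^2" for s
  define m' where "m' s = 2 / \<epsilon> * max 0 (1 - s / \<epsilon>)" for s
  have dm: "(m has_real_derivative m' s) (at s)" for s
  proof -
    have "((\<lambda>s. (max 0 (1 - s / \<epsilon>))^2) has_real_derivative
        (real 2 * max 0 (1 - s / \<epsilon>) ^ (2 - 1)) * (- 1 / \<epsilon>)) (at s)"
      by (rule DERIV_chain2[OF has_real_derivative_pos_part_power])
        (use \<epsilon> in \<open>auto intro!: derivative_eq_intros\<close>)
    from DERIV_diff[OF DERIV_const[of 1] this] show ?thesis unfolding m_def m'_def by simp
  qed
  have mlt: "m s = s * (2 * \<epsilon> - s) / \<epsilon>^2" "m' s = 2 * (\<epsilon> - s) / \<epsilon>^2" if "s \<le> \<epsilon>" for s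
    using that \<epsilon> by (auto simp: m_def m'_def max_def field_simps power2_eq_square)
  have mge: "m s = 1" "m' s = 0" if "s \<ge> \<epsilon>" for s
    using that \<epsilon> by (auto simp: m_def m'_def max_def field_simps)
  have m'nn: "m' s \<ge> 0" for s using \<epsilon> by (auto simp: m'_def)
  have mb: "(1 / M) * s \<le> m s" "m s \<le> (2 / \<epsilon>) * s" if "0 < s" "s \<le> M" for s
  proof -
    show "(1 / M) * s \<le> m s"
    proof (cases "s \<le> \<epsilon>")
      case True
      have "(1 / M) * s \<le> s * \<epsilon> / \<epsilon>^2" using \<epsilon> that by (simp add: field_simps power2_eq_square)
      also have "\<dots> \<le> s * (2 * \<epsilon> - s) / \<epsilon>^2"
        using True that \<epsilon> by (intro divide_right_mono mult_left_mono) auto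
      finally show ?thesis using mlt(1)[OF True] by simp
    qed (use that M mge(1)[of s] in auto)
    show "m s \<le> (2 / \<epsilon>) * s"
    proof (cases "s \<le> \<epsilon>")
      case True
      have "s * (2 * \<epsilon> - s) / \<epsilon>^2 \<le> s * (2 * \<epsilon>) / \<epsilon>^2"
        using True that \<epsilon> by (intro divide_right_mono mult_left_mono) auto
      also have "\<dots> = (2 / \<epsilon>) * s" using \<epsilon> by (simp add: power2_eq_square)
      finally show ?thesis using mlt(1)[OF True] by simp
    qed (use that \<epsilon> mge(1)[of s] in \<open>auto simp: field_simps\<close>)
  qed
  have mpos: "m s > 0" if "s > 0" for s
    using mb(1)[of s] mge(1)[of s] that M \<epsilon> by (cases "s \<le> M") (auto intro: less_le_trans[rotated])
  have sm': "s * m' s \<le> m s" if "s > 0" for s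
  proof (cases "s \<le> \<epsilon>")
    case True
    have "s * (2 * (\<epsilon> - s)) / \<epsilon>^2 \<le> s * (2 * \<epsilon> - s) / \<epsilon>^2"
      using that \<epsilon> by (intro divide_right_mono mult_left_mono) auto
    then show ?thesis using mlt[OF True] by simp
  qed (use that mge[of s] in auto)
  define E where "E s = m s powr \<kappa>" for s
  define E' where "E' s = \<kappa> * m s powr (\<kappa> - 1) * m' s" for s
  have dE: "(E has_real_derivative E' s) (at s)" if "s > 0" for s
    unfolding E_def E'_def using DERIV_fun_powr[OF dm mpos[OF that], of \<kappa>] by simp
  have Epos: "E s > 0" if "s > 0" for s using mpos[OF that] by (simp add: E_def)
  have E'b: "s * \<bar>E' s\<bar> \<le> \<bar>\<kappa>\<bar> * E s" if "s > 0" for s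
  proof -
    have "s * \<bar>E' s\<bar> = \<bar>\<kappa>\<bar> * E s * (s * m' s / m s)"
      using mpos[OF that] m'nn[of s] by (simp add: E'_def E_def powr_diff abs_mult)
    also have "\<dots> \<le> \<bar>\<kappa>\<bar> * E s * 1"
      using sm'[OF that] mpos[OF that] Epos[OF that] by (intro mult_left_mono) auto
    finally show ?thesis by simp
  qed
  define a A where "a = min ((1 / M) powr \<kappa>) ((2 / \<epsilon>) powr \<kappa>)"
    and "A = max ((1 / M) powr \<kappa>) ((2 / \<epsilon>) powr \<kappa>)"
  have aA: "a > 0" "A > 0" using M \<epsilon> by (auto simp: a_def A_def less_max_iff_disj)
  have Eb: "a * s powr \<kappa> \<le> E s" "E s \<le> A * s powr \<kappa>" if "0 < s" "s \<le> M" for s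
    unfolding a_def A_def E_def using powr_comparable[of "1 / M" s "m s" "2 / \<epsilon>"] mb that M by auto
  have C1: "C1 > 0"
  proof -
    have "0 < c1 * M powr p" using c1 M by simp
    also have "\<dots> \<le> C1 * M powr p" using fl[of M] fu[of M] M by linarith
    finally show ?thesis by (simp add: zero_less_mult_iff)
  qed
  define \<psi> where "\<psi> s = (if s > 0 then f s * E s else 0)" for s
  define \<psi>' where "\<psi>' s = (if s > 0 then f' s * E s + f s * E' s else 0)" for s
  define B where "B = C1 * A * (1 + \<bar>\<kappa>\<bar>)"
  have B: "B > 0" using C1 aA by (simp add: B_def add_pos_nonneg)
  have pw: "s powr p * s powr \<kappa> = s powr \<beta>" "s powr (p - 1) * s powr \<kappa> = s powr (\<beta> - 1)" for s :: real
    by (simp_all add: powr_add[symmetric] beta algebra_simps)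
  have \<psi>b: "\<bar>\<psi> s\<bar> \<le> C1 * A * s powr \<beta>" if "0 < s" "s \<le> M" for s
  proof -
    have "f s * E s \<le> (C1 * s powr p) * (A * s powr \<kappa>)"
      using C1 Epos[OF that(1)] by (intro mult_mono[OF fu[OF that] Eb(2)[OF that]]) auto
    then show ?thesis
      using that fpos Epos by (simp add: \<psi>_def pw[symmetric] abs_mult less_imp_le mult.assoc mult.left_commute)
  qed
  have \<psi>'b: "\<bar>\<psi>' s\<bar> \<le> B * s powr (\<beta> - 1)" if "0 < s" "s \<le> M" for s
  proof -
    have 1: "f' s * E s \<le> (C1 * s powr (p - 1)) * (A * s powr \<kappa>)"
      using C1 Epos[OF that(1)] by (intro mult_mono[OF f'u[OF that] Eb(2)[OF that]]) auto
    have "f s * \<bar>E' s\<bar> \<le> (C1 * s powr p) * (\<bar>\<kappa>\<bar> * (A * s powr \<kappa>) / s)"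
    proof (rule mult_mono)
      have "\<bar>E' s\<bar> \<le> \<bar>\<kappa>\<bar> * E s / s" using E'b[of s] that by (simp add: field_simps)
      also have "\<dots> \<le> \<bar>\<kappa>\<bar> * (A * s powr \<kappa>) / s"
        using Eb that by (intro divide_right_mono mult_left_mono) auto
      finally show "\<bar>E' s\<bar> \<le> \<bar>\<kappa>\<bar> * (A * s powr \<kappa>) / s" .
    qed (use fu that C1 in auto)
    also have "\<dots> = C1 * A * \<bar>\<kappa>\<bar> * (s powr (p - 1) * s powr \<kappa>)"
      using that by (simp add: powr_diff)
    finally have 2: "f s * \<bar>E' s\<bar> \<le> C1 * A * \<bar>\<kappa>\<bar> * (s powr (p - 1) * s powr \<kappa>)" .
    have "\<bar>\<psi>' s\<bar> \<le> \<bar>f' s * E s\<bar> + \<bar>f s * E' s\<bar>" using that by (simp add: \<psi>'_def)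
    also have "\<dots> = f' s * E s + f s * \<bar>E' s\<bar>"
      using that fpos[of s] Epos[of s] f'pos[of s] by (simp add: abs_mult)
    also have "\<dots> \<le> B * s powr (\<beta> - 1)"
      using 1 2 unfolding pw[symmetric] B_def by (simp add: algebra_simps)
    finally show ?thesis .
  qed
  have d\<psi>: "(\<psi> has_real_derivative \<psi>' s) (at s)" for s
  proof (cases "s > 0")
    case True
    have "((\<lambda>s. f s * E s) has_real_derivative f' s * E s + f s * E' s) (at s)"
      by (rule derivative_eq_intros d1 dE True refl)+ simp
    then have "(\<psi> has_real_derivative f' s * E s + f s * E' s) (at s)"
      by (rule has_field_derivative_transform_within_open[of _ _ _ "{0<..}"])
        (use True in \<open>auto simp: \<psi>_def\<close>)
    then show ?thesis using True by (simp add: \<psi>'_def)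
  next
    case False
    then have "(\<psi> has_real_derivative 0) (at s)"
      using has_real_derivative_extend_zero[of \<psi> M \<beta> "C1 * A" s] \<psi>b beta M by (auto simp: \<psi>_def)
    then show ?thesis using False by (simp add: \<psi>'_def)
  qed
  have c\<psi>': "continuous_on UNIV \<psi>'"
  proof (rule continuous_extend_zero[of \<psi>' M "\<beta> - 1" B])
    fix s :: real assume s: "s > 0"
    have "isCont f' s" "isCont f s" "isCont E s" "isCont m s"
      using DERIV_isCont[OF d2[OF s]] DERIV_isCont[OF d1[OF s]] DERIV_isCont[OF dE[OF s]]
        DERIV_isCont[OF dm[of s]] by auto
    moreover have "isCont m' s"
      unfolding m'_def by (intro continuous_intros) (use \<epsilon> in auto)
    ultimately have "isCont (\<lambda>s. f' s * E s + f s * E' s) s"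
      unfolding E'_def using mpos[OF s] by (intro continuous_intros) auto
    moreover have "eventually (\<lambda>t. t > 0) (nhds s)"
      using eventually_nhds_in_open[of "{0<..}" s] s by auto
    then have "eventually (\<lambda>t. f' t * E t + f t * E' t = \<psi>' t) (nhds s)"
      by eventually_elim (auto simp: \<psi>'_def)
    ultimately show "isCont \<psi>' s"
      using isCont_cong[of "\<lambda>s. f' s * E s + f s * E' s" \<psi>' s] by simp
  qed (use \<psi>'b beta M in \<open>auto simp: \<psi>'_def\<close>)
  have c\<psi>'2: "continuous_on UNIV (\<lambda>s. (\<psi>' s)\<^sup>2)" by (intro continuous_intros c\<psi>')
  define K where "K s = integral {0..s} (\<lambda>s. (\<psi>' s)\<^sup>2)" for s
  have dK: "(K has_real_derivative (\<psi>' s)\<^sup>2) (at s)" for s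
    unfolding K_def
    by (rule has_real_derivative_integral_zero_left[OF c\<psi>'2]) (auto simp: \<psi>'_def)
  have K0: "K s = 0" if "s \<le> 0" for s
    using that by (cases "s = 0") (auto simp: K_def)
  have cK: "continuous_on UNIV K"
    using dK by (meson DERIV_isCont continuous_at_imp_continuous_on)
  have Kb: "0 \<le> K s \<and> K s \<le> B\<^sup>2 * s powr (2 * \<beta> - 1)" if "0 \<le> s" "s \<le> M" for s
  proof -
    have "0 \<le> (\<psi>' t)\<^sup>2 \<and> (\<psi>' t)\<^sup>2 \<le> B\<^sup>2 * s powr (2 * \<beta> - 2)" if t: "0 \<le> t" "t \<le> s" for t
    proof (cases "t = 0")
      case True
      then show ?thesis by (simp add: \<psi>'_def)
    next
      case False
      have "\<bar>\<psi>' t\<bar> \<le> B * s powr (\<beta> - 1)"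
        using \<psi>'b[of t] False t \<open>s \<le> M\<close> B beta
        by (smt (verit) mult_left_mono powr_mono2)
      then have "(\<psi>' t)\<^sup>2 \<le> (B * s powr (\<beta> - 1))\<^sup>2"
        by (metis abs_ge_zero power2_abs power_mono)
      also have "\<dots> = B\<^sup>2 * s powr (2 * \<beta> - 2)"
        using False t by (simp add: power_mult_distrib powr_power algebra_simps)
      finally show ?thesis by simp
    qed
    note i = integral_interval_bounds[OF c\<psi>'2 this \<open>0 \<le> s\<close>]
    have "s powr (2 * \<beta> - 2) * s = s powr (2 * \<beta> - 1)"
      using that(1) by (cases "s = 0") (auto simp: powr_mult_base mult.commute)
    then show ?thesis using i that by (simp add: K_def mult.assoc)
  qed
  define L where "L s = (\<psi> s)\<^sup>2 / 2 - integral {0..s} K" for s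
  have dL: "(L has_real_derivative \<psi> s * \<psi>' s - K s) (at s)" for s
  proof -
    have "((\<lambda>s. integral {0..s} K) has_real_derivative K s) (at s)"
      by (rule has_real_derivative_integral_zero_left[OF cK K0])
    from DERIV_diff[OF DERIV_cdivide[OF DERIV_power[OF d\<psi>, of 2], of 2] this]
    show ?thesis unfolding L_def by (simp add: mult.commute)
  qed
  have \<psi>2: "(\<psi> s)\<^sup>2 \<le> (C1 * A)\<^sup>2 * s powr (2 * \<beta>)" if "0 \<le> s" "s \<le> M" for s
  proof (cases "s = 0")
    case False
    have "(\<psi> s)\<^sup>2 \<le> (C1 * A * s powr \<beta>)\<^sup>2"
      using \<psi>b[of s] False that by (metis abs_ge_zero less_le power2_abs power_mono)
    also have "\<dots> = (C1 * A)\<^sup>2 * s powr (2 * \<beta>)"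
      using False that by (simp add: power_mult_distrib powr_power algebra_simps)
    finally show ?thesis .
  qed (simp add: \<psi>_def)
  have Ib: "0 \<le> integral {0..s} K \<and> integral {0..s} K \<le> B\<^sup>2 * s powr (2 * \<beta>)" if "0 \<le> s" "s \<le> M" for s
  proof -
    have "0 \<le> K t \<and> K t \<le> B\<^sup>2 * s powr (2 * \<beta> - 1)" if t: "0 \<le> t" "t \<le> s" for t
    proof -
      have "t powr (2 * \<beta> - 1) \<le> s powr (2 * \<beta> - 1)" using t beta by (intro powr_mono2) auto
      then show ?thesis using Kb[of t] t \<open>s \<le> M\<close> by (smt (verit) mult_left_mono zero_le_power2)
    qed
    note i = integral_interval_bounds[OF cK this \<open>0 \<le> s\<close>]
    have "s powr (2 * \<beta> - 1) * s = s powr (2 * \<beta>)"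
      using that(1) by (cases "s = 0") (auto simp: powr_mult_base mult.commute)
    then show ?thesis using i that by (simp add: mult.assoc)
  qed
  \<comment> \<open>As \<open>\<psi> = f E\<close>, this is
    \<open>f' \<psi>\<^sup>2 / f - K\<close>, and f g is the quantity to be bounded below. In the
    derivative the terms \<open>f'\<^sup>2 E\<^sup>2\<close> and \<open>2 f f' E E'\<close> cancel
    against those of \<open>\<psi>'\<^sup>2\<close>.\<close>
  define g where "g s = f' s * f s * (E s)\<^sup>2 - K s" for s
  define c' where "c' = \<delta> * c1\<^sup>2 * a\<^sup>2 / (2 * \<beta> - 1)"
  have c': "c' > 0" using \<delta> c1 aA beta by (simp add: c'_def)
  define g' where "g' s = f'' s * f s * (E s)\<^sup>2 - (f s)\<^sup>2 * (E' s)\<^sup>2" for s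
  have dg: "(g has_real_derivative g' s) (at s)" if "s > 0" for s
  proof -
    have "(g has_real_derivative (f'' s * f s + f' s * f' s) * (E s)\<^sup>2 + f' s * f s * (2 * E s * E' s)
        - (\<psi>' s)\<^sup>2) (at s)"
      unfolding g_def
      by (rule derivative_eq_intros d1[OF that] d2[OF that] dE[OF that] dK refl)+ simp
    then show ?thesis
      using that by (simp add: g'_def \<psi>'_def algebra_simps power2_eq_square)
  qed
  \<comment> \<open>The part \<open>\<kappa>\<^sup>2\<close> of the lower bound on s^2 f'' / f pays
    for \<open>(s E')\<^sup>2 \<le> \<kappa>\<^sup>2 E\<^sup>2\<close>; the margin \<delta>
    remains.\<close>
  have g'lo: "g' s \<ge> \<delta> * c1\<^sup>2 * a\<^sup>2 * s powr (2 * \<beta> - 2)" if "0 < s" "s \<le> \<epsilon>" for s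
  proof -
    have sM: "s \<le> M" using that \<epsilon> by simp
    have "(\<kappa>\<^sup>2 + \<delta>) * f s \<le> s\<^sup>2 * f'' s"
      using \<epsilon>(3)[OF that] fpos[OF that(1)] by (simp add: field_simps)
    then have "(\<kappa>\<^sup>2 + \<delta>) * f s * (f s * (E s)\<^sup>2) \<le> s\<^sup>2 * f'' s * (f s * (E s)\<^sup>2)"
      using fpos[OF that(1)] by (intro mult_right_mono) auto
    moreover have "(s * \<bar>E' s\<bar>)\<^sup>2 \<le> (\<bar>\<kappa>\<bar> * E s)\<^sup>2"
      using E'b[OF that(1)] that by (intro power_mono) auto
    then have "(f s)\<^sup>2 * (s\<^sup>2 * (E' s)\<^sup>2) \<le> (f s)\<^sup>2 * (\<kappa>\<^sup>2 * (E s)\<^sup>2)"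
      by (intro mult_left_mono) (auto simp: power_mult_distrib)
    ultimately have 1: "\<delta> * (f s * E s)\<^sup>2 \<le> s\<^sup>2 * g' s"
      by (simp add: g'_def power2_eq_square algebra_simps)
    have "c1 * s powr p * (a * s powr \<kappa>) \<le> f s * E s"
      using fpos[OF that(1)] aA c1
      by (intro mult_mono[OF fl[OF that(1) sM] Eb(1)[OF that(1) sM]]) auto
    then have "c1 * a * s powr \<beta> \<le> f s * E s" by (simp add: pw[symmetric] algebra_simps)
    then have "(c1 * a * s powr \<beta>)\<^sup>2 \<le> (f s * E s)\<^sup>2"
      using c1 aA by (intro power_mono) auto
    then have 2: "\<delta> * (c1 * a * s powr \<beta>)\<^sup>2 \<le> s\<^sup>2 * g' s"
      using 1 \<delta> by (smt (verit) mult_left_mono)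
    have 3: "(c1 * a * s powr \<beta>)\<^sup>2 = c1\<^sup>2 * a\<^sup>2 * s powr (2 * \<beta> - 2) * s\<^sup>2"
    proof -
      have "s powr (2 * \<beta>) = s powr (2 * \<beta> - 2) * s powr 2"
        using powr_add[of s "2 * \<beta> - 2" 2] by simp
      moreover have "(s powr \<beta>)\<^sup>2 = s powr (2 * \<beta>)"
        using powr_add[of s \<beta> \<beta>] by (simp add: power2_eq_square)
      ultimately show ?thesis using that by (simp add: power_mult_distrib)
    qed
    have "s\<^sup>2 * (\<delta> * c1\<^sup>2 * a\<^sup>2 * s powr (2 * \<beta> - 2)) \<le> s\<^sup>2 * g' s"
      using 2 unfolding 3 by (simp add: algebra_simps)
    then show ?thesis using that by simp
  qed
  have g'nn: "g' s \<ge> 0" if "s > 0" for s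
  proof (cases "s \<le> \<epsilon>")
    case True
    have "0 \<le> \<delta> * c1\<^sup>2 * a\<^sup>2 * s powr (2 * \<beta> - 2)" using \<delta> by simp
    then show ?thesis using g'lo[OF that True] by linarith
  next
    case False
    then show ?thesis using mge[of s] fpos[OF that] f''pos[OF that] by (simp add: g'_def E'_def)
  qed
  have glo: "c' * s powr (2 * \<beta> - 1) \<le> g s" if "0 < s" "s \<le> \<epsilon>" for s
  proof -
    \<comment> \<open>The bound on g' integrates to one on g because D is nondecreasing and tends to
      0 at 0, all its terms being O(\<open>h powr (2 * \<beta> - 1)\<close>). This integration is
      the origin of the denominator 2 \<beta> - 1 in \<open>c'\<close>.\<close>
    define D where "D s = g s - c' * s powr (2 * \<beta> - 1)" for s
    have dD: "(D has_real_derivative g' t - c' * ((2 * \<beta> - 1) * t powr (2 * \<beta> - 2))) (at t)" if "t > 0" for t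
      unfolding D_def
      using DERIV_diff[OF dg[OF that] DERIV_cmult[OF has_real_derivative_powr[OF that, of "2 * \<beta> - 1"], of c']]
      by simp
    have D': "g' t - c' * ((2 * \<beta> - 1) * t powr (2 * \<beta> - 2)) \<ge> 0" if "t > 0" "t \<le> \<epsilon>" for t
      using g'lo[OF that] beta by (simp add: c'_def)
    have mono: "D t \<le> D s" if "0 < t" "t \<le> s" for t
    proof (rule DERIV_nonneg_imp_nondecreasing[OF that(2)])
      fix x assume "t \<le> x" "x \<le> s"
      then show "\<exists>y. (D has_real_derivative y) (at x) \<and> 0 \<le> y"
        using dD[of x] D'[of x] that \<open>s \<le> \<epsilon>\<close> by fastforce
    qed
    have "(D \<longlongrightarrow> 0) (at_right 0)"
    proof (rule tendsto_rabs_zero_cancel, rule tendsto_sandwich[OF _ _ tendsto_const])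
      define C2 where "C2 = C1 * C1 * A\<^sup>2 + B\<^sup>2 + c'"
      have "((\<lambda>h::real. C2 * h powr (2 * \<beta> - 1)) \<longlongrightarrow> C2 * 0 powr (2 * \<beta> - 1)) (at_right 0)"
      proof (intro tendsto_intros tendsto_powr' disjI2 conjI)
        show "\<forall>\<^sub>F x::real in at_right 0. 0 \<le> x" by (auto simp: eventually_at_filter)
      qed (use beta in auto)
      then show "((\<lambda>h::real. C2 * h powr (2 * \<beta> - 1)) \<longlongrightarrow> 0) (at_right 0)" by simp
      have "\<bar>D h\<bar> \<le> C2 * h powr (2 * \<beta> - 1)" if h: "0 < h" "h \<le> M" for h
      proof -
        have "f' h * f h * (E h)\<^sup>2 \<le> (C1 * h powr (p - 1)) * (C1 * h powr p) * (A * h powr \<kappa>)\<^sup>2"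
          using fpos[OF h(1)] f'pos[OF h(1)] Epos[OF h(1)] C1
          by (intro mult_mono power_mono f'u[OF h] fu[OF h] Eb(2)[OF h]) auto
        also have "\<dots> = C1 * C1 * A\<^sup>2 * ((h powr (p - 1) * h powr \<kappa>) * (h powr p * h powr \<kappa>))"
          by (simp add: power2_eq_square algebra_simps)
        also have "\<dots> = C1 * C1 * A\<^sup>2 * h powr (2 * \<beta> - 1)"
          unfolding pw by (simp add: powr_add[symmetric] algebra_simps)
        finally have 1: "f' h * f h * (E h)\<^sup>2 \<le> C1 * C1 * A\<^sup>2 * h powr (2 * \<beta> - 1)" .
        have 2: "0 \<le> f' h * f h * (E h)\<^sup>2" using f'pos fpos h by (simp add: less_imp_le)
        have 3: "0 \<le> c' * h powr (2 * \<beta> - 1)" using c' by simp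
        have 4: "0 \<le> C1 * C1 * A\<^sup>2 * h powr (2 * \<beta> - 1)" using C1 by simp
        show ?thesis using Kb[of h] h 1 2 3 4
          unfolding D_def g_def C2_def by (simp add: algebra_simps abs_le_iff)
      qed
      then show "eventually (\<lambda>h. \<bar>D h\<bar> \<le> C2 * h powr (2 * \<beta> - 1)) (at_right 0)"
        unfolding eventually_at_right_field using M by (intro exI[of _ M]) auto
    qed auto
    then have "0 \<le> D s"
    proof (rule tendsto_upperbound)
      show "eventually (\<lambda>t. D t \<le> D s) (at_right 0)"
        unfolding eventually_at_right_field using that mono by (intro exI[of _ s]) auto
    qed auto
    then show ?thesis by (simp add: D_def)
  qed
  \<comment> \<open>Past \<epsilon> only g \<ge> g(\<epsilon>) is available; the constant is lowered
    until the power at M equals the bound already reached at \<epsilon>.\<close>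
  define c2 where "c2 = c' * (\<epsilon> / M) powr (2 * \<beta> - 1)"
  have c2: "c2 > 0" using c' \<epsilon> M by (simp add: c2_def)
  have c2': "c2 \<le> c'"
  proof -
    have "(\<epsilon> / M) powr (2 * \<beta> - 1) \<le> 1 powr (2 * \<beta> - 1)"
      using \<epsilon> M beta by (intro powr_mono2) auto
    then show ?thesis using c' by (simp add: c2_def)
  qed
  have gall: "c2 * s powr (2 * \<beta> - 1) \<le> g s" if "0 < s" "s \<le> M" for s
  proof (cases "s \<le> \<epsilon>")
    case True
    then show ?thesis using glo[of s] that c2' by (smt (verit) mult_right_mono powr_ge_zero)
  next
    case False
    have "g \<epsilon> \<le> g s"
    proof (rule DERIV_nonneg_imp_nondecreasing[where f = g])
      fix x assume "\<epsilon> \<le> x" "x \<le> s"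
      then show "\<exists>y. (g has_real_derivative y) (at x) \<and> 0 \<le> y"
        using dg[of x] g'nn[of x] \<epsilon> by fastforce
    qed (use False in auto)
    moreover have "c' * \<epsilon> powr (2 * \<beta> - 1) \<le> g \<epsilon>" using glo[of \<epsilon>] \<epsilon> by simp
    moreover have "c2 * s powr (2 * \<beta> - 1) \<le> c' * \<epsilon> powr (2 * \<beta> - 1)"
    proof -
      have "s powr (2 * \<beta> - 1) \<le> M powr (2 * \<beta> - 1)" using that beta by (intro powr_mono2) auto
      then have "c2 * s powr (2 * \<beta> - 1) \<le> c2 * M powr (2 * \<beta> - 1)" using c2 by simp
      also have "\<dots> = c' * \<epsilon> powr (2 * \<beta> - 1)"
        using \<epsilon> M by (simp add: c2_def powr_divide)
      finally show ?thesis .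
    qed
    ultimately show ?thesis by linarith
  qed
  define C where "C = (C1 * A)\<^sup>2 + B\<^sup>2"
  show ?thesis
  proof (rule that[of \<psi> \<psi>' K L "c1 * c2" C])
    show "c1 * c2 > 0" using c1 c2 by simp
    show "C > 0" using B by (simp add: C_def add_nonneg_pos)
    fix s assume s: "0 \<le> s" "s \<le> M"
    show "c1 * c2 * s powr (2 * \<beta> + p - 1) \<le> f' s * (\<psi> s)\<^sup>2 - f s * K s"
    proof (cases "s = 0")
      case False
      then have sp: "s > 0" using s by simp
      have le: "(c1 * s powr p) * (c2 * s powr (2 * \<beta> - 1)) \<le> f s * g s"
        using fpos[OF sp] c2 by (intro mult_mono[OF fl[OF sp s(2)] gall[OF sp s(2)]]) auto
      have "s powr p * s powr (2 * \<beta> - 1) = s powr (2 * \<beta> + p - 1)"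
        by (simp add: powr_add[symmetric] algebra_simps)
      then have eq: "(c1 * s powr p) * (c2 * s powr (2 * \<beta> - 1)) = c1 * c2 * s powr (2 * \<beta> + p - 1)"
        by (metis mult.assoc mult.left_commute)
      show ?thesis
        using sp le unfolding eq by (simp add: g_def \<psi>_def algebra_simps power2_eq_square)
    qed (simp add: \<psi>_def f0)
    show "(\<psi> s)\<^sup>2 \<le> C * s powr (2 * \<beta>)"
      using \<psi>2[OF s] by (simp add: C_def distrib_right add_increasing2)
    have "0 \<le> B\<^sup>2 * s powr (2 * \<beta>)" "0 \<le> (\<psi> s)\<^sup>2" "0 \<le> (C1 * A)\<^sup>2 * s powr (2 * \<beta>)" by auto
    then show "\<bar>L s\<bar> \<le> C * s powr (2 * \<beta>)"
      using \<psi>2[OF s] Ib[OF s] unfolding L_def C_def abs_le_iff distrib_right by linarith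
  qed (use d\<psi> c\<psi>' dK dL in auto)
qed

section \<open>Radial cutoffs\<close>

text \<open>A cubed positive part composed with 1 minus a cubed positive part: the inner one is
  constant past 1, the outer one removes the nonpositive values that arise for t \<le> 0. Cubes keep
  two continuous derivatives, as the Laplacian of a cutoff requires.\<close>

lemma smooth_step_exists:
  obtains H H' H'' :: "real \<Rightarrow> real" where
    "\<And>t. (H has_real_derivative H' t) (at t)" "\<And>t. (H' has_real_derivative H'' t) (at t)"
    "continuous_on UNIV H''" "\<And>t. t \<le> 0 \<Longrightarrow> H t = 0" "\<And>t. t \<ge> 1 \<Longrightarrow> H t = 1"
    "\<And>t. 0 \<le> H t" "\<And>t. H t \<le> 1"
proof
  define P where "P n t = max 0 t ^ n" for n and t :: real
  have dP: "(P (Suc (Suc n)) has_real_derivative real (Suc (Suc n)) * P (Suc n) t) (at t)" for n t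
    using has_real_derivative_pos_part_power[of "Suc (Suc n)" t] by (simp add: P_def[abs_def])
  have d3: "(P 3 has_real_derivative 3 * P 2 t) (at t)" and d2: "(P 2 has_real_derivative 2 * P 1 t) (at t)" for t
    using dP[of 1 t] dP[of 0 t] by (simp_all add: eval_nat_numeral)
  have cP: "continuous_on S (P n)" for S n unfolding P_def by (intro continuous_intros)
  define Q where "Q t = 1 - P 3 (1 - t)" for t
  have dQ: "(Q has_real_derivative 3 * P 2 (1 - t)) (at t)" for t
  proof -
    have "((\<lambda>t. P 3 (1 - t)) has_real_derivative 3 * P 2 (1 - t) * (-1)) (at t)"
      by (rule DERIV_chain2[OF d3]) (auto intro!: derivative_eq_intros)
    from DERIV_diff[OF DERIV_const[of 1] this] show ?thesis unfolding Q_def by simp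
  qed
  define H where "H t = P 3 (Q t)" for t
  define H' where "H' t = 3 * P 2 (Q t) * (3 * P 2 (1 - t))" for t
  define H'' where "H'' t = 6 * P 1 (Q t) * (3 * P 2 (1 - t)) * (3 * P 2 (1 - t))
      - 3 * P 2 (Q t) * (6 * P 1 (1 - t))" for t
  show "(H has_real_derivative H' t) (at t)" for t
    unfolding H_def H'_def by (rule DERIV_chain2[OF d3 dQ])
  show "(H' has_real_derivative H'' t) (at t)" for t
  proof -
    have "((\<lambda>t. P 2 (1 - t)) has_real_derivative 2 * P 1 (1 - t) * (-1)) (at t)"
      by (rule DERIV_chain2[OF d2]) (auto intro!: derivative_eq_intros)
    from DERIV_mult[OF DERIV_cmult[OF DERIV_chain2[OF d2 dQ], of 3] DERIV_cmult[OF this, of 3]]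
    show ?thesis unfolding H'_def H''_def by (simp add: algebra_simps)
  qed
  have cQ: "continuous_on UNIV Q"
    unfolding Q_def by (intro continuous_intros continuous_on_compose2[OF cP]) auto
  show "continuous_on UNIV H''"
    unfolding H''_def
    by (intro continuous_intros continuous_on_compose2[OF cP] cQ) auto
  show "H t = 0" if "t \<le> 0" for t
  proof -
    have "1 ^ 3 \<le> (1 - t) ^ 3" using that by (intro power_mono) auto
    then show ?thesis using that by (simp add: H_def Q_def P_def)
  qed
  show "H t = 1" if "t \<ge> 1" for t
    using that by (simp add: H_def Q_def P_def)
  show "0 \<le> H t" for t by (simp add: H_def P_def)
  show "H t \<le> 1" for t
  proof -
    have "0 \<le> P 3 (1 - t)" by (simp add: P_def)
    then show ?thesis by (auto simp: H_def Q_def P_def intro!: power_le_one)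
  qed
qed

text \<open>Taking |x|^2 instead of |x| as radial variable keeps cutoffs differentiable at the
  origin without a case distinction.\<close>

lemma radial_has_derivative:
  fixes x :: "'a::euclidean_space"
  assumes "(T has_real_derivative T' (x \<bullet> x)) (at (x \<bullet> x))"
  shows "((\<lambda>x. T (x \<bullet> x)) has_derivative (\<lambda>h. ((2 * T' (x \<bullet> x)) *\<^sub>R x) \<bullet> h)) (at x)"
proof -
  have 1: "((\<lambda>x::'a. x \<bullet> x) has_derivative (\<lambda>h. 2 * (x \<bullet> h))) (at x)"
    by (auto intro!: derivative_eq_intros simp: inner_commute)
  have "(T has_derivative (*) (T' (x \<bullet> x))) (at (x \<bullet> x))"
    using assms by (simp add: has_field_derivative_def)
  from has_derivative_compose[OF 1 this] show ?thesis
    by (simp add: algebra_simps)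
qed

lemma radial_gradient_has_derivative:
  fixes x :: "'a::euclidean_space"
  assumes "(T' has_real_derivative T'' (x \<bullet> x)) (at (x \<bullet> x))"
  shows "((\<lambda>x. (2 * T' (x \<bullet> x)) *\<^sub>R x) has_derivative
    (\<lambda>h. (4 * T'' (x \<bullet> x) * (x \<bullet> h)) *\<^sub>R x + (2 * T' (x \<bullet> x)) *\<^sub>R h)) (at x)"
proof -
  have "((\<lambda>x. 2 * T' (x \<bullet> x)) has_derivative (\<lambda>h. 2 * (((2 * T'' (x \<bullet> x)) *\<^sub>R x) \<bullet> h))) (at x)"
    by (rule has_derivative_mult_right[OF radial_has_derivative[where T' = T'', OF assms]])
  from has_derivative_scaleR[OF this has_derivative_ident] show ?thesis
    by (simp add: algebra_simps)
qed

lemma radial_laplacian: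
  fixes x :: "'a::euclidean_space"
  shows "(\<Sum>b\<in>Basis. ((a * (x \<bullet> b)) *\<^sub>R x + c *\<^sub>R b) \<bullet> b) = a * (x \<bullet> x) + c * real DIM('a)"
proof -
  have "(\<Sum>b\<in>Basis. ((a * (x \<bullet> b)) *\<^sub>R x + c *\<^sub>R b) \<bullet> b)
      = (\<Sum>b\<in>Basis. a * ((x \<bullet> b) * (x \<bullet> b)) + c)"
    by (intro sum.cong) (auto simp: inner_add_left inner_Basis)
  also have "\<dots> = a * (\<Sum>b\<in>Basis. (x \<bullet> b) * (x \<bullet> b)) + c * real DIM('a)"
    by (simp add: sum.distrib sum_distrib_left)
  finally show ?thesis by (simp add: euclidean_inner[of x x])
qed

text \<open>
  \<open>cutoff_error\<close> is \<open>|grad \<zeta>|\<^sup>2 + |\<Delta> (\<zeta>\<^sup>2)|\<close> for \<open>\<zeta> x = T (|x|\<^sup>2)\<close>, as a function of \<open>t = |x|\<^sup>2\<close>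
  in dimension \<open>n\<close>.
\<close>
definition cutoff_error :: "real \<Rightarrow> (real \<Rightarrow> real) \<Rightarrow> (real \<Rightarrow> real) \<Rightarrow> (real \<Rightarrow> real) \<Rightarrow> real \<Rightarrow> real" where
  "cutoff_error n T T' T'' t =
     4 * t * (T' t)\<^sup>2 + \<bar>4 * n * (T t * T' t) + 8 * t * ((T' t)\<^sup>2 + T t * T'' t)\<bar>"

text \<open>A high power \<open>H ^ k\<close> of a step works: the error contains two derivatives,
  so it is O(\<open>H ^ (2 * k - 2)\<close>), and as 0 \<le> H \<le> 1 this is at most a multiple of
  \<open>H powr (k * \<theta>) = S powr \<theta>\<close> once k (2 - \<theta>) \<ge> 2. In this form
  the error can be absorbed by Young's inequality.\<close>

lemma power_cutoff_exists:
  fixes \<theta> n :: real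
  assumes \<theta>: "0 < \<theta>" "\<theta> < 2" and n: "n \<ge> 0"
  obtains S S' S'' :: "real \<Rightarrow> real" and C where
    "\<And>t. (S has_real_derivative S' t) (at t)" "\<And>t. (S' has_real_derivative S'' t) (at t)"
    "continuous_on UNIV S''" "\<And>t. t \<le> 1 \<Longrightarrow> S t = 1" "\<And>t. t \<ge> 2 \<Longrightarrow> S t = 0"
    "\<And>t. 0 \<le> S t" "\<And>t. S t \<le> 1" "C > 0"
    "\<And>t. t \<ge> 0 \<Longrightarrow> cutoff_error n S S' S'' t \<le> C * S t powr \<theta>"
proof -
  obtain H H' H'' :: "real \<Rightarrow> real" where H: 
    "\<And>t. (H has_real_derivative H' t) (at t)" "\<And>t. (H' has_real_derivative H'' t) (at t)"
    "continuous_on UNIV H''" "\<And>t. t \<le> 0 \<Longrightarrow> H t = 0" "\<And>t. t \<ge> 1 \<Longrightarrow> H t = 1"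
    "\<And>t. 0 \<le> H t" "\<And>t. H t \<le> 1"
    using smooth_step_exists by blast
  have cH: "continuous_on UNIV H" "continuous_on UNIV H'"
    using H(1,2) by (meson DERIV_isCont continuous_at_imp_continuous_on)+
  have "bounded (H' ` {0..2})" "bounded (H'' ` {0..2})"
    using cH(2) H(3) by (auto intro!: compact_imp_bounded compact_continuous_image intro: continuous_on_subset)
  then obtain B1 B2 where "\<forall>t\<in>{0..2}. \<bar>H' t\<bar> \<le> B1" "\<forall>t\<in>{0..2}. \<bar>H'' t\<bar> \<le> B2"
    unfolding bounded_iff by auto
  then obtain B where B: "\<And>t. 0 \<le> t \<Longrightarrow> t \<le> 2 \<Longrightarrow> \<bar>H' t\<bar> \<le> B \<and> \<bar>H'' t\<bar> \<le> B" "B \<ge> 1"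
  proof (intro that[of "max 1 (max B1 B2)"])
    fix t :: real assume "0 \<le> t" "t \<le> 2"
    then have "\<bar>H' t\<bar> \<le> B1" "\<bar>H'' t\<bar> \<le> B2"
      using \<open>\<forall>t\<in>{0..2}. \<bar>H' t\<bar> \<le> B1\<close> \<open>\<forall>t\<in>{0..2}. \<bar>H'' t\<bar> \<le> B2\<close> by auto
    then show "\<bar>H' t\<bar> \<le> max 1 (max B1 B2) \<and> \<bar>H'' t\<bar> \<le> max 1 (max B1 B2)" by linarith
  qed simp
  obtain k0 :: nat where k0: "real k0 \<ge> 2 / (2 - \<theta>)" using real_arch_simple by blast
  define k where "k = k0 + 3"
  have k: "k \<ge> 3" "real k * \<theta> \<le> 2 * real k - 2"
  proof -
    have "real k \<ge> 2 / (2 - \<theta>)" using k0 by (simp add: k_def)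
    then have "2 \<le> real k * (2 - \<theta>)" using \<theta> by (simp add: field_simps)
    then show "real k * \<theta> \<le> 2 * real k - 2" by (simp add: algebra_simps)
  qed (simp add: k_def)
  define S where "S t = H (2 - t) ^ k" for t
  define S' where "S' t = - (real k * H (2 - t) ^ (k - 1) * H' (2 - t))" for t
  define S'' where "S'' t = real k * (real (k - 1) * H (2 - t) ^ (k - 2) * H' (2 - t)) * H' (2 - t)
      + real k * H (2 - t) ^ (k - 1) * H'' (2 - t)" for t
  have dH: "((\<lambda>t. H (2 - t)) has_real_derivative - H' (2 - t)) (at t)"
     "((\<lambda>t. H' (2 - t)) has_real_derivative - H'' (2 - t)) (at t)" for t
  proof -
    have "((\<lambda>t::real. 2 - t) has_real_derivative - 1) (at t)" by (auto intro!: derivative_eq_intros)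
    from DERIV_chain2[OF H(1) this] DERIV_chain2[OF H(2) this]
    show "((\<lambda>t. H (2 - t)) has_real_derivative - H' (2 - t)) (at t)"
      "((\<lambda>t. H' (2 - t)) has_real_derivative - H'' (2 - t)) (at t)" by simp_all
  qed
  \<comment> \<open>For t \<le> 2 the count 40 = 8 + 2 * 16 collects \<open>S'\<^sup>2\<close> and
    the part of \<open>S S''\<close> with \<open>H'\<^sup>2\<close>; the other two terms come from
    \<open>S S'\<close> and from \<open>H''\<close>.\<close>
  define C where "C = 40 * (real k)\<^sup>2 * B\<^sup>2 + 4 * n * real k * B + 16 * real k * B"
  show ?thesis
  proof (rule that[of S S' S'' C])
    show "(S has_real_derivative S' t) (at t)" for t
      using DERIV_power[OF dH(1), of k t] unfolding S_def S'_def by (simp add: algebra_simps)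
    show "(S' has_real_derivative S'' t) (at t)" for t
      using DERIV_minus[OF DERIV_mult[OF DERIV_cmult[OF DERIV_power[OF dH(1), of "k - 1" t], of "real k"] dH(2)]]
      unfolding S'_def S''_def by (simp add: numeral_2_eq_2 algebra_simps)
    show "continuous_on UNIV S''"
      unfolding S''_def
      by (intro continuous_intros continuous_on_compose2[OF cH(1)] continuous_on_compose2[OF cH(2)]
        continuous_on_compose2[OF H(3)]) auto
    show "S t = 1" if "t \<le> 1" for t using that H(5) by (simp add: S_def)
    show "S t = 0" if "t \<ge> 2" for t using that H(4) k by (simp add: S_def)
    show "0 \<le> S t" "S t \<le> 1" for t using H(6,7) by (auto simp: S_def intro: power_le_one)
    show "C > 0" using B k n unfolding C_def by (intro add_pos_pos add_pos_nonneg) auto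
    fix t :: real assume t: "t \<ge> 0"
    show "cutoff_error n S S' S'' t \<le> C * S t powr \<theta>"
    proof (cases "t < 2 \<and> H (2 - t) \<noteq> 0")
      case False
      then have "H (2 - t) = 0" using H(4)[of "2 - t"] by fastforce
      then show ?thesis using k by (simp add: cutoff_error_def S_def S'_def S''_def power_0_left)
    next
      case True
      define h h' h'' where "h = H (2 - t)" and "h' = H' (2 - t)" and "h'' = H'' (2 - t)"
      have h: "0 < h" "h \<le> 1" using True H(6,7) by (auto simp: h_def less_le)
      have h': "\<bar>h'\<bar> \<le> B" "\<bar>h''\<bar> \<le> B" using B(1)[of "2 - t"] True t by (auto simp: h'_def h''_def)
      have h'2: "h'\<^sup>2 \<le> B\<^sup>2" using h'(1) by (metis abs_ge_zero power2_abs power_mono)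
      define X where "X = h ^ (2 * k - 2)"
      have X0: "X \<ge> 0" using h by (simp add: X_def)
      have e1: "h ^ (k - 1) * h ^ (k - 1) = X"
        unfolding X_def power_add[symmetric] by (rule arg_cong[where f = "(^) h"]) (use k in simp)
      have e2: "h ^ k * h ^ (k - 2) = X"
        unfolding X_def power_add[symmetric] by (rule arg_cong[where f = "(^) h"]) (use k in simp)
      have e3: "h ^ k * h ^ (k - 1) \<le> X"
      proof -
        have "h ^ k * h ^ (k - 1) = h ^ (2 * k - 1)" 
          unfolding power_add[symmetric] by (rule arg_cong[where f = "(^) h"]) (use k in simp)
        also have "\<dots> \<le> X" unfolding X_def by (rule power_decreasing) (use h in auto)
        finally show ?thesis .
      qed
      have S'2: "(S' t)\<^sup>2 \<le> (real k)\<^sup>2 * B\<^sup>2 * X"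
      proof -
        have "(S' t)\<^sup>2 = (real k)\<^sup>2 * h'\<^sup>2 * (h ^ (k - 1) * h ^ (k - 1))"
          by (simp add: S'_def h_def h'_def power2_eq_square algebra_simps)
        also have "\<dots> \<le> (real k)\<^sup>2 * B\<^sup>2 * X"
          unfolding e1 using h'2 X0 by (intro mult_right_mono mult_left_mono) auto
        finally show ?thesis .
      qed
      have SS': "\<bar>S t * S' t\<bar> \<le> real k * B * X"
      proof -
        have "\<bar>S t * S' t\<bar> = real k * \<bar>h'\<bar> * (h ^ k * h ^ (k - 1))"
          using h by (simp add: S_def S'_def h_def[symmetric] h'_def[symmetric] abs_mult)
        also have "\<dots> \<le> real k * B * X"
          using h' e3 X0 h B(2) by (intro mult_mono) auto
        finally show ?thesis .
      qed
      have SS'': "\<bar>S t * S'' t\<bar> \<le> (real k)\<^sup>2 * B\<^sup>2 * X + real k * B * X"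
      proof -
        have eq: "S t * S'' t = real k * real (k - 1) * h'\<^sup>2 * (h ^ k * h ^ (k - 2))
            + real k * h'' * (h ^ k * h ^ (k - 1))"
          by (simp add: S_def S''_def h_def h'_def h''_def power2_eq_square algebra_simps)
        have "\<bar>real k * real (k - 1) * h'\<^sup>2 * (h ^ k * h ^ (k - 2))\<bar> \<le> (real k)\<^sup>2 * B\<^sup>2 * X"
        proof -
          have "real k * real (k - 1) * h'\<^sup>2 * X \<le> real k * real k * B\<^sup>2 * X"
            using h'2 X0 by (intro mult_right_mono mult_mono) auto
          then show ?thesis unfolding e2 using X0 by (simp add: abs_mult power2_eq_square)
        qed
        moreover have "\<bar>real k * h'' * (h ^ k * h ^ (k - 1))\<bar> \<le> real k * B * X"
        proof -
          have "\<bar>real k * h'' * (h ^ k * h ^ (k - 1))\<bar> = real k * \<bar>h''\<bar> * (h ^ k * h ^ (k - 1))"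
            using h by (simp add: abs_mult)
          also have "\<dots> \<le> real k * B * X"
            using h' e3 X0 h B(2) by (intro mult_mono) auto
          finally show ?thesis .
        qed
        ultimately show ?thesis unfolding eq by linarith
      qed
      have t2: "t \<le> 2" using True by simp
      have a1: "4 * t * (S' t)\<^sup>2 \<le> 8 * ((real k)\<^sup>2 * B\<^sup>2 * X)"
        using mult_mono[OF _ S'2, of "4 * t" 8] t t2 by simp
      have a2: "\<bar>4 * n * (S t * S' t)\<bar> \<le> 4 * n * (real k * B * X)"
        using mult_left_mono[OF SS', of "4 * n"] n by (simp add: abs_mult)
      have a3: "\<bar>8 * t * ((S' t)\<^sup>2 + S t * S'' t)\<bar> \<le> 16 * (2 * ((real k)\<^sup>2 * B\<^sup>2 * X) + real k * B * X)"
      proof -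
        have "\<bar>(S' t)\<^sup>2 + S t * S'' t\<bar> \<le> 2 * ((real k)\<^sup>2 * B\<^sup>2 * X) + real k * B * X"
          using S'2 SS'' zero_le_power2[of "S' t"] by linarith
        then have "(8 * t) * \<bar>(S' t)\<^sup>2 + S t * S'' t\<bar> \<le> 16 * (2 * ((real k)\<^sup>2 * B\<^sup>2 * X) + real k * B * X)"
          using t t2 by (intro mult_mono) auto
        then show ?thesis using t by (simp add: abs_mult)
      qed
      have "cutoff_error n S S' S'' t \<le> 8 * ((real k)\<^sup>2 * B\<^sup>2 * X) + 4 * n * (real k * B * X)
          + 16 * (2 * ((real k)\<^sup>2 * B\<^sup>2 * X) + real k * B * X)"
        using a1 a2 a3 abs_triangle_ineq[of "4 * n * (S t * S' t)" "8 * t * ((S' t)\<^sup>2 + S t * S'' t)"]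
        unfolding cutoff_error_def by linarith
      also have "\<dots> = C * X" unfolding C_def by (simp add: algebra_simps)
      finally have CX: "cutoff_error n S S' S'' t \<le> C * X" .
      have "X \<le> S t powr \<theta>"
      proof -
        have "X = h powr real (2 * k - 2)" unfolding X_def using h by (simp add: powr_realpow del: of_nat_diff)
        also have "\<dots> \<le> h powr (real k * \<theta>)"
          using k h by (intro powr_mono') (auto simp: of_nat_diff)
        also have "\<dots> = S t powr \<theta>"
          using h by (simp add: S_def h_def[symmetric] powr_powr[symmetric] powr_realpow)
        finally show ?thesis .
      qed
      then have "C * X \<le> C * S t powr \<theta>" using \<open>C > 0\<close> by simp
      with CX show ?thesis by linarith
    qed
  qed
qed

section \<open>A mean value inequality\<close>

text \<open>Prepares differentiation under the integral sign, which is done on a compact box: the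
  unit ball carries the support and fits into the box with sides [-1, 1].\<close>

lemma integral_cbox_eq_lborel:
  fixes g :: "'a::euclidean_space \<Rightarrow> real"
  assumes c: "continuous_on UNIV g" and z: "\<And>y. norm y \<ge> 1 \<Longrightarrow> g y = 0"
  shows "integral (cbox (- One) One) g = (\<integral>y. g y \<partial>lborel)"
proof -
  have "integral UNIV g = (\<integral>y. g y \<partial>lborel)"
    by (rule integral_lborel) (rule continuous_compact_support_integrable[OF c z])
  moreover have "(\<lambda>y. if y \<in> cbox (- One) One then g y else 0) = g"
  proof
    fix y :: 'a
    show "(if y \<in> cbox (- One) One then g y else 0) = g y"
    proof (cases "norm y \<ge> 1")
      case False
      have "\<bar>y \<bullet> b\<bar> \<le> 1" if "b \<in> Basis" for b
        using Basis_le_norm[OF that, of y] False by simp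
      then show ?thesis by (force simp: mem_box abs_le_iff)
    qed (use z in auto)
  qed
  then have "integral UNIV g = integral (cbox (- One) One) g"
    by (metis integral_restrict_UNIV)
  ultimately show ?thesis by simp
qed

text \<open>The potential of the averaging weight \<open>bump_density\<close>. It vanishes to third
  order at the unit sphere, so integrating by parts against it leaves no boundary term.\<close>

definition bump :: "'a::euclidean_space \<Rightarrow> real" where
  "bump y = max 0 (1 - y \<bullet> y) ^ 3"

text \<open>Chosen so that \<open>grad bump y = - bump_density y * y\<close>.\<close>
definition bump_density :: "'a::euclidean_space \<Rightarrow> real" where
  "bump_density y = 6 * max 0 (1 - y \<bullet> y) ^ 2"

lemma bump_has_derivative:
  "(bump has_derivative (\<lambda>h. (- bump_density y *\<^sub>R y) \<bullet> h)) (at y)"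
proof -
  have "((\<lambda>t. max 0 (1 - t) ^ 3) has_real_derivative (real 3 * max 0 (1 - t) ^ (3 - 1)) * (- 1)) (at t)" for t :: real
    by (rule DERIV_chain2[OF has_real_derivative_pos_part_power])
      (auto intro!: derivative_eq_intros)
  from radial_has_derivative[where T = "\<lambda>t. max 0 (1 - t) ^ 3"
    and T' = "\<lambda>t. real 3 * max 0 (1 - t) ^ (3 - 1) * (- 1)", OF this, of y]
  show ?thesis unfolding bump_def[abs_def] bump_density_def by (simp add: algebra_simps)
qed

lemma bump_cont: "continuous_on S bump" "continuous_on S bump_density"
  unfolding bump_def[abs_def] bump_density_def[abs_def] by (intro continuous_intros)+

lemma bump_zero: "norm y \<ge> 1 \<Longrightarrow> bump y = 0" "norm y \<ge> 1 \<Longrightarrow> bump_density y = 0"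
proof -
  assume "norm y \<ge> 1"
  then have "y \<bullet> y \<ge> 1" by (metis one_le_power power2_norm_eq_inner)
  then show "bump y = 0" "bump_density y = 0" by (simp_all add: bump_def bump_density_def)
qed

lemma bump_nonneg: "bump y \<ge> 0" "bump_density y \<ge> 0" "bump_density y \<le> 6"
  by (auto simp: bump_def bump_density_def intro!: power_le_one)

lemma bump_density_integral_pos: "(\<integral>y. bump_density (y::'a::euclidean_space) \<partial>lborel) > 0"
proof -
  have i: "integrable lborel (bump_density :: 'a \<Rightarrow> real)"
    by (rule continuous_compact_support_integrable[OF bump_cont(2) bump_zero(2)])
  have i2: "integrable lborel (indicator (ball (0::'a) (1/2)) :: 'a \<Rightarrow> real)"
    by (intro integrable_indicator_bounded) auto
  have "0 < measure lborel (ball (0::'a) (1/2))"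
    by (intro content_ball_pos) auto
  also have "\<dots> = (\<integral>y. indicator (ball (0::'a) (1/2)) y \<partial>lborel)" by simp
  also have "\<dots> \<le> (\<integral>y. bump_density (y::'a) \<partial>lborel)"
  proof (rule integral_mono[OF i2 i])
    fix y :: 'a
    show "indicator (ball 0 (1/2)) y \<le> bump_density y"
    proof (cases "norm y < 1/2")
      case True
      then have "(norm y)\<^sup>2 \<le> (1/2)\<^sup>2" by (intro power_mono) auto
      then have "y \<bullet> y \<le> 1 / 4" unfolding power2_norm_eq_inner by (simp add: power2_eq_square)
      then have "(3 / 4)\<^sup>2 \<le> (max 0 (1 - y \<bullet> y))\<^sup>2" by (intro power_mono) auto
      then show ?thesis using True by (simp add: bump_density_def power2_eq_square)
    qed (use bump_nonneg in auto)
  qed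
  finally show ?thesis .
qed

text \<open>A smooth weight takes the place of spherical means. The derivative in the radius s of
  the average of v is the integral of \<open>G \<bullet> y\<close> against
  \<open>bump_density\<close>, that is, of G against minus the gradient of \<open>bump\<close>. By
  parts it becomes s times the integral of the Laplacian against \<open>bump\<close>, which is at
  least - s A times the integral of \<open>bump\<close>; integrating from 0 to r yields the factor
  \<open>r\<^sup>2 / 2\<close>.\<close>

lemma weighted_mean_value_inequality:
  fixes v :: "'a::euclidean_space \<Rightarrow> real"
  assumes dv: "\<And>y. (v has_derivative (\<lambda>h. G y \<bullet> h)) (at y)"
    and dG: "\<And>y. (G has_derivative DG y) (at y)"
    and cG: "\<And>b. continuous_on UNIV (\<lambda>y. DG y b)"
    and r: "r \<ge> 0" and A: "\<And>y. dist x y < r \<Longrightarrow> - A \<le> (\<Sum>b\<in>Basis. DG y b \<bullet> b)"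
  shows "v x * (\<integral>y. bump_density (y::'a) \<partial>lborel)
    \<le> (\<integral>y. v (x + r *\<^sub>R y) * bump_density y \<partial>lborel) + A * r\<^sup>2 / 2 * (\<integral>y. bump (y::'a) \<partial>lborel)"
proof -
  have vc: "continuous_on UNIV v"
    using dv by (meson continuous_at_imp_continuous_on has_derivative_continuous)
  have Gc: "continuous_on UNIV G"
    using dG by (meson continuous_at_imp_continuous_on has_derivative_continuous)
  define \<phi> where "\<phi> s = (\<integral>y. v (x + s *\<^sub>R y) * bump_density y \<partial>lborel)" for s
  define \<phi>' where "\<phi>' s = (\<integral>y. (G (x + s *\<^sub>R y) \<bullet> y) * bump_density y \<partial>lborel)" for s
  have c1: "continuous_on UNIV (\<lambda>y. v (x + s *\<^sub>R y) * bump_density y)" for s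
    by (intro continuous_intros continuous_on_compose2[OF vc] bump_cont) auto
  have c2: "continuous_on UNIV (\<lambda>y. (G (x + s *\<^sub>R y) \<bullet> y) * bump_density y)" for s
    by (intro continuous_intros continuous_on_compose2[OF Gc] bump_cont) auto
  have d\<phi>: "(\<phi> has_real_derivative \<phi>' s) (at s)" for s
  proof -
    have e1: "\<phi> = (\<lambda>s. integral (cbox (- One) One) (\<lambda>y. v (x + s *\<^sub>R y) * bump_density y))"
      unfolding \<phi>_def by (subst integral_cbox_eq_lborel[OF c1]) (auto simp: bump_zero)
    have e2: "\<phi>' s = integral (cbox (- One) One) (\<lambda>y. (G (x + s *\<^sub>R y) \<bullet> y) * bump_density y)"
      unfolding \<phi>'_def by (subst integral_cbox_eq_lborel[OF c2]) (auto simp: bump_zero)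
    show ?thesis unfolding e1 e2
    proof (rule leibniz_rule_field_derivative[where U = UNIV])
      show "((\<lambda>s. v (x + s *\<^sub>R y) * bump_density y) has_real_derivative
          G (x + s *\<^sub>R y) \<bullet> y * bump_density y) (at s)" for s y
        by (rule DERIV_cmult_right) (rule has_real_derivative_along_line[OF dv])
      show "(\<lambda>y. v (x + s *\<^sub>R y) * bump_density y) integrable_on cbox (- One) One" for s
        by (rule integrable_continuous) (use c1 continuous_on_subset in blast)
      show "continuous_on (UNIV \<times> cbox (- One) One) (\<lambda>(s, y). G (x + s *\<^sub>R y) \<bullet> y * bump_density y)"
        unfolding split_beta
        by (intro continuous_intros continuous_on_compose2[OF Gc] continuous_on_compose2[OF bump_cont(2)[of UNIV]]) auto
    qed auto
  qed
  have ibump: "integrable lborel (bump :: 'a \<Rightarrow> real)"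
    by (rule continuous_compact_support_integrable[OF bump_cont(1) bump_zero(1)])
  have lower: "\<phi>' s \<ge> - s * A * (\<integral>y. bump (y::'a) \<partial>lborel)" if s: "0 \<le> s" "s \<le> r" for s
  proof -
    have dX: "((\<lambda>y. G (x + s *\<^sub>R y)) has_derivative (\<lambda>h. s *\<^sub>R DG (x + s *\<^sub>R y) h)) (at y)" for y
    proof -
      have "DG z (s *\<^sub>R h) = s *\<^sub>R DG z h" for z h
        using linear_scale[OF has_derivative_linear[OF dG]] by blast
      moreover have "((\<lambda>y. G (x + s *\<^sub>R y)) has_derivative (\<lambda>h. DG (x + s *\<^sub>R y) (s *\<^sub>R h))) (at y)"
        by (rule has_derivative_compose[where g = G, OF _ dG]) (auto intro!: derivative_eq_intros)
      ultimately show ?thesis by simp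
    qed
    define L where "L y = (\<Sum>b\<in>Basis. (s *\<^sub>R DG (x + s *\<^sub>R y) b) \<bullet> b)" for y
    have cc: "continuous_on UNIV (\<lambda>y. (- bump_density y *\<^sub>R y) \<bullet> b)" for b :: 'a
      by (intro continuous_intros bump_cont)
    have cD: "continuous_on UNIV (\<lambda>y. s *\<^sub>R DG (x + s *\<^sub>R y) b)" for b
      by (intro continuous_intros continuous_on_compose2[OF cG]) auto
    have ibp1: "integrable lborel (\<lambda>y. (- bump_density y *\<^sub>R y) \<bullet> G (x + s *\<^sub>R y) + bump y * L y)"
      unfolding L_def
      by (rule integral_divergence_eq_0(1)[where R = 1, OF bump_has_derivative dX cc cD])
        (auto simp: bump_zero)
    have ibp2: "(\<integral>y. (- bump_density y *\<^sub>R y) \<bullet> G (x + s *\<^sub>R y) + bump y * L y \<partial>lborel) = 0"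
      unfolding L_def
      by (rule integral_divergence_eq_0(2)[where R = 1, OF bump_has_derivative dX cc cD])
        (auto simp: bump_zero)
    have i2: "integrable lborel (\<lambda>y. (G (x + s *\<^sub>R y) \<bullet> y) * bump_density y)"
      by (rule continuous_compact_support_integrable[OF c2, of 1]) (simp add: bump_zero)
    have "integrable lborel (\<lambda>y. bump y * L y)"
      using Bochner_Integration.integrable_add[OF ibp1 i2] by (simp add: inner_commute)
    moreover have "(\<integral>y. bump y * L y \<partial>lborel) = \<phi>' s"
      using Bochner_Integration.integral_add[OF ibp1 i2] ibp2
      by (simp add: \<phi>'_def inner_commute)
    moreover have "(\<integral>y. bump (y::'a) * (- s * A) \<partial>lborel) \<le> (\<integral>y. bump y * L y \<partial>lborel)"
    proof (rule Bochner_Integration.integral_mono)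
      fix y :: 'a
      show "bump y * (- s * A) \<le> bump y * L y"
      proof (cases "norm y < 1 \<and> s > 0")
        case True
        have "s * norm y < s * 1" by (rule mult_strict_left_mono) (use True in auto)
        then have "dist x (x + s *\<^sub>R y) < r"
          using s by (simp add: dist_norm)
        then have "s * (- A) \<le> s * (\<Sum>b\<in>Basis. DG (x + s *\<^sub>R y) b \<bullet> b)"
          using A s by (intro mult_left_mono) auto
        then show ?thesis
          using bump_nonneg(1)[of y] by (intro mult_left_mono) (auto simp: L_def sum_distrib_left)
      next
        case False
        then show ?thesis using s bump_zero(1)[of y] by (cases "s = 0") (auto simp: L_def)
      qed
    qed (use ibump calculation in auto)
    ultimately show ?thesis by (simp add: algebra_simps)
  qed
  define D where "D s = \<phi> s + A * (\<integral>y. bump (y::'a) \<partial>lborel) * s\<^sup>2 / 2" for s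
  have "D 0 \<le> D r"
  proof (rule DERIV_nonneg_imp_nondecreasing[where f = D, OF r])
    fix s assume s: "0 \<le> s" "s \<le> r"
    have "(D has_real_derivative \<phi>' s + A * (\<integral>y. bump (y::'a) \<partial>lborel) * s) (at s)"
      unfolding D_def by (auto intro!: derivative_eq_intros d\<phi>)
    moreover have "\<phi>' s + A * (\<integral>y. bump (y::'a) \<partial>lborel) * s \<ge> 0"
      using lower[OF s] by (simp add: algebra_simps)
    ultimately show "\<exists>y. (D has_real_derivative y) (at s) \<and> 0 \<le> y" by blast
  qed
  then show ?thesis by (simp add: D_def \<phi>_def algebra_simps)
qed

lemma lborel_integral_affine:
  fixes g :: "'a::euclidean_space \<Rightarrow> real"
  assumes "r > 0" and [measurable]: "g \<in> borel_measurable borel"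
  shows "(\<integral>y. g y \<partial>lborel) = r ^ DIM('a) * (\<integral>y. g (x + r *\<^sub>R y) \<partial>lborel)"
proof -
  have "(\<integral>y. g y \<partial>lborel) =
      (\<integral>y. g y \<partial>density (distr lborel borel (\<lambda>y. x + r *\<^sub>R y)) (\<lambda>_. \<bar>r\<bar> ^ DIM('a)))"
    by (subst lborel_affine[of r x]) (use assms in auto)
  also have "\<dots> = r ^ DIM('a) * (\<integral>y. g (x + r *\<^sub>R y) \<partial>lborel)"
    using assms(1) by (subst integral_density) (auto simp: integral_distr)
  finally show ?thesis .
qed

section \<open>Energy estimates from stability\<close>

lemma continuous_on_of_has_derivative:
  assumes "\<And>x. (g has_derivative D x) (at x)"
  shows "continuous_on S g"
  using assms by (meson continuous_at_imp_continuous_on has_derivative_continuous)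

lemma continuous_on_of_DERIV:
  fixes g :: "real \<Rightarrow> real"
  assumes "\<And>t. (g has_real_derivative g' t) (at t)"
  shows "continuous_on S g"
  using assms by (meson DERIV_isCont continuous_at_imp_continuous_on)

lemma DERIV_zero_of_locally_constant:
  fixes g :: "real \<Rightarrow> real"
  assumes "(g has_real_derivative g') (at t)" "open U" "t \<in> U" "\<And>s. s \<in> U \<Longrightarrow> g s = c"
  shows "g' = 0"
proof -
  have "((\<lambda>_. c) has_real_derivative g') (at t)"
    by (rule has_field_derivative_transform_within_open[OF assms(1,2,3)]) (use assms in auto)
  then show ?thesis using DERIV_unique DERIV_const by blast
qed

lemma norm_ge_imp_inner_ge:
  fixes x :: "'a::real_inner"
  assumes "norm x \<ge> max 1 \<bar>r\<bar>" shows "x \<bullet> x \<ge> r"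
proof -
  have "r \<le> norm x * 1" using assms by (auto simp: abs_le_iff)
  also have "\<dots> \<le> norm x * norm x" using assms by (intro mult_left_mono) auto
  finally show ?thesis by (metis power2_eq_square power2_norm_eq_inner)
qed

lemma continuous_on_radial:
  fixes T :: "real \<Rightarrow> real"
  assumes "continuous_on UNIV T"
  shows "continuous_on S (\<lambda>x::'a::real_inner. T (x \<bullet> x))"
  by (rule continuous_on_compose2[OF assms]) (auto intro!: continuous_intros)

text \<open>Compare y with l x. If y \<le> l x the product is at most \<open>l powr (1 - a)\<close>
  times x, otherwise at most \<open>l powr - a\<close> times y; l is chosen so that the first factor
  equals \<delta>.\<close>

lemma young_inequality_with_parameter:
  fixes a \<delta> :: real
  assumes a: "0 < a" "a < 1" and \<delta>: "\<delta> > 0"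
  obtains C where "C > 0"
    "\<And>x y. 0 \<le> x \<Longrightarrow> 0 \<le> y \<Longrightarrow> x powr a * y powr (1 - a) \<le> \<delta> * x + C * y"
proof -
  define l where "l = \<delta> powr (1 / (1 - a))"
  have l: "l > 0" "l powr (1 - a) = \<delta>" using \<delta> a by (auto simp: l_def powr_powr)
  show ?thesis
  proof (rule that[of "l powr - a"])
    show "l powr - a > 0" using l by simp
    fix x y :: real assume xy: "0 \<le> x" "0 \<le> y"
    show "x powr a * y powr (1 - a) \<le> \<delta> * x + l powr - a * y"
    proof (cases "y \<le> l * x")
      case True
      have "x powr a * y powr (1 - a) \<le> x powr a * (l * x) powr (1 - a)"
        using True xy a by (intro mult_left_mono powr_mono2) auto
      also have "\<dots> = \<delta> * (x powr a * x powr (1 - a))"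
        using xy l by (simp add: powr_mult)
      also have "\<dots> = \<delta> * x" using xy by (simp add: powr_add[symmetric])
      finally show ?thesis using xy l by (simp add: add_increasing2)
    next
      case False
      then have "x \<le> y / l" using l by (simp add: field_simps)
      then have "x powr a * y powr (1 - a) \<le> (y / l) powr a * y powr (1 - a)"
        using xy a by (intro mult_right_mono powr_mono2) auto
      also have "\<dots> = l powr - a * (y powr a * y powr (1 - a))"
        using xy l by (simp add: powr_divide powr_minus_divide)
      also have "\<dots> = l powr - a * y" using xy by (simp add: powr_add[symmetric])
      finally show ?thesis using xy \<delta> by (simp add: add_increasing)
    qed
  qed
qed

text \<open>\<open>G\<close> and \<open>DG\<close> play the roles of gradient and Hessian, and
  \<open>equation\<close> is -\<Delta>u = f(u) written as a trace. As u takes values in [0, M],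
  upper power bounds on f are imposed only there.\<close>

locale semilinear_solution =
  fixes u :: "'a::euclidean_space \<Rightarrow> real" and G :: "'a \<Rightarrow> 'a" and DG :: "'a \<Rightarrow> 'a \<Rightarrow> 'a"
    and f :: "real \<Rightarrow> real" and M :: real
  assumes du: "\<And>x. (u has_derivative (\<lambda>h. G x \<bullet> h)) (at x)"
    and dG: "\<And>x. (G has_derivative DG x) (at x)"
    and DG_continuous: "\<And>b. continuous_on UNIV (\<lambda>x. DG x b)"
    and equation: "\<And>x. (\<Sum>b\<in>Basis. DG x b \<bullet> b) = - f (u x)"
    and u_nonneg: "\<And>x. u x \<ge> 0" and u_le: "\<And>x. u x \<le> M" and M_pos: "M > 0"
    and f_cont: "continuous_on {0..} f"
begin

lemma u_continuous: "continuous_on S u" by (rule continuous_on_of_has_derivative[OF du])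
lemma G_continuous: "continuous_on S G" by (rule continuous_on_of_has_derivative[OF dG])

lemma fu_continuous: "continuous_on S (\<lambda>x. f (u x))"
  by (rule continuous_on_compose2[OF f_cont u_continuous]) (use u_nonneg in auto)

lemma u_powr_continuous: "b > 0 \<Longrightarrow> continuous_on S (\<lambda>x. u x powr b)"
  by (rule continuous_on_powr') (use u_continuous u_nonneg in auto)

lemma has_derivative_comp_u:
  assumes "(F has_real_derivative F') (at (u x))"
  shows "((\<lambda>x. F (u x)) has_derivative (\<lambda>h. F' * (G x \<bullet> h))) (at x)"
  using has_derivative_compose[OF du, of F "(*) F'" x] assms by (simp add: has_field_derivative_def)

text \<open>
  The terms with \<open>|grad u|\<^sup>2\<close> and \<open>grad u \<bullet> grad (\<zeta>\<^sup>2)\<close> in the stability inequality for \<open>\<psi>(u) \<zeta>\<close> are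
  eliminated by integrating the divergence of \<open>\<zeta>\<^sup>2 K(u) grad u + L(u) grad (\<zeta>\<^sup>2)\<close>.
\<close>
lemma stability_energy_estimate:
  fixes T T' T'' \<psi> \<psi>' K L :: "real \<Rightarrow> real"
  assumes dT: "\<And>t. (T has_real_derivative T' t) (at t)" "\<And>t. (T' has_real_derivative T'' t) (at t)"
    and cT'': "continuous_on UNIV T''"
    and T0: "\<And>t. t \<ge> R2 \<Longrightarrow> T t = 0" "\<And>t. t \<ge> R2 \<Longrightarrow> T' t = 0" "\<And>t. t \<le> R1 \<Longrightarrow> T t = 0"
    and cf': "continuous_on {0..} f'"
    and stable: "\<And>\<phi>. C1_compact_support {x. x \<bullet> x \<ge> R1} \<phi> \<Longrightarrow>
      (\<integral>x. f' (u x) * (\<phi> x)\<^sup>2 \<partial>lborel) \<le> (\<integral>x. (norm (grad \<phi> x))\<^sup>2 \<partial>lborel)"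
    and d\<psi>: "\<And>s. (\<psi> has_real_derivative \<psi>' s) (at s)" and c\<psi>': "continuous_on UNIV \<psi>'"
    and dK: "\<And>s. (K has_real_derivative (\<psi>' s)\<^sup>2) (at s)"
    and dL: "\<And>s. (L has_real_derivative \<psi> s * \<psi>' s - K s) (at s)"
    and b: "b > 0" and \<psi>b: "\<And>s. 0 \<le> s \<Longrightarrow> s \<le> M \<Longrightarrow> (\<psi> s)\<^sup>2 \<le> C * s powr b"
    and Lb: "\<And>s. 0 \<le> s \<Longrightarrow> s \<le> M \<Longrightarrow> \<bar>L s\<bar> \<le> C * s powr b"
  defines "CE \<equiv> cutoff_error (real DIM('a)) T T' T''"
  shows "(\<integral>x. (f' (u x) * (\<psi> (u x))\<^sup>2 - f (u x) * K (u x)) * (T (x \<bullet> x))\<^sup>2 \<partial>lborel)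
    \<le> (\<integral>x. C * (u x powr b * CE (x \<bullet> x)) \<partial>lborel)"
    and "integrable lborel (\<lambda>x. u x powr b * CE (x \<bullet> x))"
proof -
  define n where "n = real DIM('a)"
  have cT: "continuous_on S T" "continuous_on S T'" "continuous_on S T''" for S
    using continuous_on_of_DERIV[OF dT(1)] continuous_on_of_DERIV[OF dT(2)] cT'' continuous_on_subset by blast+
  have cTx: "continuous_on S (\<lambda>x::'a. T (x \<bullet> x))" "continuous_on S (\<lambda>x::'a. T' (x \<bullet> x))"
    "continuous_on S (\<lambda>x::'a. T'' (x \<bullet> x))" for S
    by (intro continuous_on_radial cT)+
  have c\<psi>x: "continuous_on S (\<lambda>x. \<psi> (u x))" "continuous_on S (\<lambda>x. \<psi>' (u x))"
    "continuous_on S (\<lambda>x. K (u x))" "continuous_on S (\<lambda>x. L (u x))" "continuous_on S (\<lambda>x. f' (u x))" for S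
    using u_nonneg
    by (auto intro!: continuous_on_compose2[OF continuous_on_of_DERIV[OF d\<psi>, of UNIV]]
      continuous_on_compose2[OF c\<psi>'] continuous_on_compose2[OF continuous_on_of_DERIV[OF dK, of UNIV]]
      continuous_on_compose2[OF continuous_on_of_DERIV[OF dL, of UNIV]] continuous_on_compose2[OF cf'] u_continuous)
  define \<rho> where "\<rho> = max 1 \<bar>R2\<bar>"
  have far: "T (x \<bullet> x) = 0" "T' (x \<bullet> x) = 0" if "norm x \<ge> \<rho>" for x :: 'a
    using norm_ge_imp_inner_ge[of R2 x] that T0 by (auto simp: \<rho>_def)
  note radT = radial_has_derivative[where T = T and T' = T', OF dT(1)]
  define \<phi> where "\<phi> x = \<psi> (u x) * T (x \<bullet> x)" for x
  define g where "g x = (\<psi>' (u x) * T (x \<bullet> x)) *\<^sub>R G x + (2 * \<psi> (u x) * T' (x \<bullet> x)) *\<^sub>R x" for x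
  have d\<phi>: "(\<phi> has_derivative (\<lambda>h. g x \<bullet> h)) (at x)" for x
    using has_derivative_mult[OF has_derivative_comp_u[OF d\<psi>] radT, of x]
    unfolding \<phi>_def[abs_def] g_def by (simp add: inner_add_left algebra_simps)
  have cg: "continuous_on UNIV g"
    unfolding g_def by (intro continuous_intros cTx c\<psi>x G_continuous)
  have grad: "grad \<phi> x = g x" for x by (rule grad_unique(1)[OF d\<phi>])
  have "C1_compact_support {x. x \<bullet> x \<ge> R1} \<phi>"
    unfolding C1_compact_support_def
  proof (intro conjI)
    show "C1 \<phi>" by (rule C1_I[OF d\<phi> cg])
    have "{x. \<phi> x \<noteq> 0} \<subseteq> cball 0 \<rho>"
    proof
      fix x assume "x \<in> {x. \<phi> x \<noteq> 0}"
      then have "\<not> norm x \<ge> \<rho>" using far(1) by (auto simp: \<phi>_def)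
      then show "x \<in> cball 0 \<rho>" by simp
    qed
    then have "closure {x. \<phi> x \<noteq> 0} \<subseteq> cball 0 \<rho>"
      by (rule closure_minimal) simp
    then show "compact (closure {x. \<phi> x \<noteq> 0})"
      by (meson bounded_cball bounded_subset closed_closure compact_eq_bounded_closed)
    have "closed {x::'a. R1 \<le> x \<bullet> x}" by (intro closed_Collect_le continuous_intros)
    moreover have "{x. \<phi> x \<noteq> 0} \<subseteq> {x. R1 \<le> x \<bullet> x}"
    proof
      fix x assume "x \<in> {x. \<phi> x \<noteq> 0}"
      then have "T (x \<bullet> x) \<noteq> 0" by (simp add: \<phi>_def)
      then show "x \<in> {x. R1 \<le> x \<bullet> x}" using T0(3)[of "x \<bullet> x"] by force
    qed
    ultimately show "closure {x. \<phi> x \<noteq> 0} \<subseteq> {x. R1 \<le> x \<bullet> x}" by (intro closure_minimal)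
  qed
  from stable[OF this] have st:
    "(\<integral>x. f' (u x) * (\<phi> x)\<^sup>2 \<partial>lborel) \<le> (\<integral>x. (norm (g x))\<^sup>2 \<partial>lborel)"
    by (simp add: grad)
  have dT2: "((\<lambda>t. (T t)\<^sup>2) has_real_derivative 2 * (T t * T' t)) (at t)"
    "((\<lambda>t. 2 * (T t * T' t)) has_real_derivative 2 * ((T' t)\<^sup>2 + T t * T'' t)) (at t)" for t
    by (auto intro!: derivative_eq_intros dT simp: power2_eq_square)
  note radT2 = radial_has_derivative[where T = "\<lambda>t. (T t)\<^sup>2" and T' = "\<lambda>t. 2 * (T t * T' t)", OF dT2(1)]
  note radT2' = radial_gradient_has_derivative[where T' = "\<lambda>t. 2 * (T t * T' t)"
    and T'' = "\<lambda>t. 2 * ((T' t)\<^sup>2 + T t * T'' t)", OF dT2(2)]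
  define E where "E t = 4 * n * (T t * T' t) + 8 * t * ((T' t)\<^sup>2 + T t * T'' t)" for t
  \<comment> \<open>The divergences of \<open>T\<^sup>2 K(u) G\<close> and of \<open>L(u)\<close>
    times the gradient of \<open>T\<^sup>2\<close>. The first cancels the term with
    \<open>\<psi>'\<^sup>2 |G|\<^sup>2\<close>, the sum of both cancels the terms with
    \<open>x \<bullet> G\<close>; this dictates L' = \<psi> \<psi>' - K. What survives is
    \<open>4 |x|\<^sup>2 T'\<^sup>2 \<psi>\<^sup>2 - L E\<close>.\<close>
  define B1 where "B1 x = 4 * (T (x \<bullet> x) * T' (x \<bullet> x)) * K (u x) * (x \<bullet> G x)
      + (T (x \<bullet> x))\<^sup>2 * (\<psi>' (u x))\<^sup>2 * (G x \<bullet> G x) - (T (x \<bullet> x))\<^sup>2 * K (u x) * f (u x)" for x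
  define B2 where "B2 x = (\<psi> (u x) * \<psi>' (u x) - K (u x)) * (4 * (T (x \<bullet> x) * T' (x \<bullet> x))) * (x \<bullet> G x)
      + L (u x) * E (x \<bullet> x)" for x
  have B1: "(\<integral>x. B1 x \<partial>lborel) = 0" "integrable lborel B1"
  proof -
    define D where "D x h = (T (x \<bullet> x))\<^sup>2 * ((\<psi>' (u x))\<^sup>2 * (G x \<bullet> h))
      + ((2 * (2 * (T (x \<bullet> x) * T' (x \<bullet> x)))) *\<^sub>R x \<bullet> h) * K (u x)" for x h
    have dD: "((\<lambda>x. (T (x \<bullet> x))\<^sup>2 * K (u x)) has_derivative D x) (at x)" for x
      unfolding D_def by (rule has_derivative_mult[OF radT2 has_derivative_comp_u[OF dK]])
    have cD: "continuous_on UNIV (\<lambda>x. D x b)" for b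
      unfolding D_def by (intro continuous_intros cTx c\<psi>x G_continuous)
    have "D x (G x) + (T (x \<bullet> x))\<^sup>2 * K (u x) * (\<Sum>b\<in>Basis. DG x b \<bullet> b) = B1 x" for x
      unfolding equation D_def B1_def by (simp add: algebra_simps)
    then show "(\<integral>x. B1 x \<partial>lborel) = 0" "integrable lborel B1"
      using integral_divergence_eq_0[OF dD dG cD DG_continuous, of \<rho>] far by auto
  qed
  have B2: "(\<integral>x. B2 x \<partial>lborel) = 0" "integrable lborel B2"
  proof -
    define U where "U t = 2 * (T t * T' t)" for t
    define U' where "U' t = 2 * ((T' t)\<^sup>2 + T t * T'' t)" for t
    define D where "D x h = (\<psi> (u x) * \<psi>' (u x) - K (u x)) * (G x \<bullet> h)" for x h
    have dD: "((\<lambda>x. L (u x)) has_derivative D x) (at x)" for x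
      unfolding D_def by (rule has_derivative_comp_u[OF dL])
    have cD: "continuous_on UNIV (\<lambda>x. D x b)" for b
      unfolding D_def by (intro continuous_intros cTx c\<psi>x G_continuous)
    have cX: "continuous_on UNIV (\<lambda>x. (4 * U' (x \<bullet> x) * (x \<bullet> b)) *\<^sub>R x + (2 * U (x \<bullet> x)) *\<^sub>R b)" for b :: 'a
      unfolding U_def U'_def by (intro continuous_intros cTx)
    have "D x ((2 * U (x \<bullet> x)) *\<^sub>R x) + L (u x) * (\<Sum>b\<in>Basis.
        ((4 * U' (x \<bullet> x) * (x \<bullet> b)) *\<^sub>R x + (2 * U (x \<bullet> x)) *\<^sub>R b) \<bullet> b) = B2 x" for x
      unfolding radial_laplacian D_def B2_def E_def U_def U'_def n_def
      by (simp add: inner_commute algebra_simps)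
    then show "(\<integral>x. B2 x \<partial>lborel) = 0" "integrable lborel B2"
      using integral_divergence_eq_0[OF dD radT2'[folded U_def U'_def] cD cX, of \<rho>] far
      by (auto simp: U_def)
  qed
  have ng: "(norm (g x))\<^sup>2 = (T (x \<bullet> x))\<^sup>2 * (\<psi>' (u x))\<^sup>2 * (G x \<bullet> G x)
      + 4 * (T (x \<bullet> x) * T' (x \<bullet> x)) * (\<psi> (u x) * \<psi>' (u x)) * (x \<bullet> G x)
      + 4 * (x \<bullet> x) * (T' (x \<bullet> x))\<^sup>2 * (\<psi> (u x))\<^sup>2" for x
    unfolding power2_norm_eq_inner g_def
    by (simp add: inner_add_left inner_add_right power2_eq_square inner_commute algebra_simps)
  have ig: "integrable lborel (\<lambda>x. (norm (g x))\<^sup>2)"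
    by (rule continuous_compact_support_integrable[of _ \<rho>], intro continuous_intros cg)
      (simp add: g_def far)
  have ic: "integrable lborel (\<lambda>x. f' (u x) * (\<phi> x)\<^sup>2)"
    by (rule continuous_compact_support_integrable[of _ \<rho>])
      (auto intro!: continuous_intros c\<psi>x cTx simp: \<phi>_def far)
  have ik: "integrable lborel (\<lambda>x. f (u x) * K (u x) * (T (x \<bullet> x))\<^sup>2)"
    by (rule continuous_compact_support_integrable[of _ \<rho>])
      (auto intro!: continuous_intros c\<psi>x cTx fu_continuous simp: far)
  show iCE: "integrable lborel (\<lambda>x. u x powr b * CE (x \<bullet> x))"
    unfolding CE_def cutoff_error_def
    by (rule continuous_compact_support_integrable[of _ \<rho>])
      (auto intro!: continuous_intros u_powr_continuous b cTx simp: far)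
  have "(\<integral>x. (f' (u x) * (\<psi> (u x))\<^sup>2 - f (u x) * K (u x)) * (T (x \<bullet> x))\<^sup>2 \<partial>lborel)
     = (\<integral>x. f' (u x) * (\<phi> x)\<^sup>2 \<partial>lborel) - (\<integral>x. f (u x) * K (u x) * (T (x \<bullet> x))\<^sup>2 \<partial>lborel)"
    using Bochner_Integration.integral_diff[OF ic ik]
    by (simp add: \<phi>_def power_mult_distrib algebra_simps)
  also have "\<dots> \<le> (\<integral>x. (norm (g x))\<^sup>2 \<partial>lborel) - (\<integral>x. f (u x) * K (u x) * (T (x \<bullet> x))\<^sup>2 \<partial>lborel)
      - (\<integral>x. B1 x \<partial>lborel) - (\<integral>x. B2 x \<partial>lborel)"
    using st B1 B2 by simp
  also have "\<dots> = (\<integral>x. (norm (g x))\<^sup>2 - f (u x) * K (u x) * (T (x \<bullet> x))\<^sup>2 - B1 x - B2 x \<partial>lborel)"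
    using ig ik B1 B2 by simp
  also have "\<dots> \<le> (\<integral>x. C * (u x powr b * CE (x \<bullet> x)) \<partial>lborel)"
  proof (rule Bochner_Integration.integral_mono)
    fix x :: 'a
    have "(norm (g x))\<^sup>2 - f (u x) * K (u x) * (T (x \<bullet> x))\<^sup>2 - B1 x - B2 x
      = 4 * (x \<bullet> x) * (T' (x \<bullet> x))\<^sup>2 * (\<psi> (u x))\<^sup>2 - L (u x) * E (x \<bullet> x)"
      unfolding ng B1_def B2_def by (simp add: algebra_simps)
    also have "\<dots> \<le> 4 * (x \<bullet> x) * (T' (x \<bullet> x))\<^sup>2 * (C * u x powr b) + (C * u x powr b) * \<bar>E (x \<bullet> x)\<bar>"
    proof -
      have 1: "4 * (x \<bullet> x) * (T' (x \<bullet> x))\<^sup>2 * (\<psi> (u x))\<^sup>2 \<le> 4 * (x \<bullet> x) * (T' (x \<bullet> x))\<^sup>2 * (C * u x powr b)"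
        by (intro mult_left_mono \<psi>b u_nonneg u_le) auto
      have "- (L (u x) * E (x \<bullet> x)) \<le> \<bar>L (u x)\<bar> * \<bar>E (x \<bullet> x)\<bar>"
        by (metis abs_ge_minus_self abs_mult)
      also have "\<dots> \<le> (C * u x powr b) * \<bar>E (x \<bullet> x)\<bar>"
        by (intro mult_right_mono Lb u_nonneg u_le) auto
      finally show ?thesis using 1 by linarith
    qed
    also have "\<dots> = C * (u x powr b * CE (x \<bullet> x))"
      unfolding CE_def cutoff_error_def E_def n_def by (simp add: algebra_simps)
    finally show "(norm (g x))\<^sup>2 - f (u x) * K (u x) * (T (x \<bullet> x))\<^sup>2 - B1 x - B2 x
        \<le> C * (u x powr b * CE (x \<bullet> x))" .
  qed (use ig ik B1 B2 iCE in auto)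
  finally show "(\<integral>x. (f' (u x) * (\<psi> (u x))\<^sup>2 - f (u x) * K (u x)) * (T (x \<bullet> x))\<^sup>2 \<partial>lborel)
    \<le> (\<integral>x. C * (u x powr b * CE (x \<bullet> x)) \<partial>lborel)" .
qed

text \<open>With a = b / Q the error of the outer cutoff is at most a constant times
  \<open>u powr b * T powr (2 * a) / r\<^sup>2\<close>, and the numerator is the a-th power of
  \<open>u powr Q * T\<^sup>2\<close>. Young's inequality absorbs half of the energy and leaves a
  multiple of (r^-2)^(1/(1-a)) = r^-N on a ball of volume of order r^N: the relation 1 - b / Q = 2 /
  N is what makes the bound independent of r.\<close>

lemma exterior_energy_bound:
  fixes \<psi> \<psi>' K L :: "real \<Rightarrow> real"
  assumes R1: "R1 > 0" and cf': "continuous_on {0..} f'"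
    and stable: "\<And>\<phi>. C1_compact_support {x. x \<bullet> x \<ge> R1} \<phi> \<Longrightarrow>
      (\<integral>x. f' (u x) * (\<phi> x)\<^sup>2 \<partial>lborel) \<le> (\<integral>x. (norm (grad \<phi> x))\<^sup>2 \<partial>lborel)"
    and d\<psi>: "\<And>s. (\<psi> has_real_derivative \<psi>' s) (at s)" and c\<psi>': "continuous_on UNIV \<psi>'"
    and dK: "\<And>s. (K has_real_derivative (\<psi>' s)\<^sup>2) (at s)"
    and dL: "\<And>s. (L has_real_derivative \<psi> s * \<psi>' s - K s) (at s)"
    and b: "b > 0" and c: "c > 0" "C > 0"
    and lower: "\<And>s. 0 \<le> s \<Longrightarrow> s \<le> M \<Longrightarrow> c * s powr Q \<le> f' s * (\<psi> s)\<^sup>2 - f s * K s"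
    and \<psi>b: "\<And>s. 0 \<le> s \<Longrightarrow> s \<le> M \<Longrightarrow> (\<psi> s)\<^sup>2 \<le> C * s powr b"
    and Lb: "\<And>s. 0 \<le> s \<Longrightarrow> s \<le> M \<Longrightarrow> \<bar>L s\<bar> \<le> C * s powr b"
    and Q: "Q > b" "1 - b / Q = 2 / real DIM('a)"
  shows "\<exists>A. \<forall>r>0. r\<^sup>2 > 2 * R1 \<longrightarrow>
    (\<integral>x. indicator {x. 2 * R1 \<le> x \<bullet> x \<and> norm x \<le> r} x * u x powr Q \<partial>lborel) \<le> A"
proof -
  define N where "N = real DIM('a)"
  have N: "N > 0" by (simp add: N_def)
  define a where "a = b / Q"
  have a: "0 < a" "a < 1" "a * Q = b" "1 - a = 2 / N" using Q b by (auto simp: a_def N_def)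
  obtain S S' S'' :: "real \<Rightarrow> real" and C3 where
    dS: "\<And>t. (S has_real_derivative S' t) (at t)" "\<And>t. (S' has_real_derivative S'' t) (at t)"
    and cS: "continuous_on UNIV S''" and S1: "\<And>t. t \<le> 1 \<Longrightarrow> S t = 1" and S0: "\<And>t. t \<ge> 2 \<Longrightarrow> S t = 0"
    and S01: "\<And>t. 0 \<le> S t" "\<And>t. S t \<le> 1" and C3: "C3 > 0"
    and CES: "\<And>t. t \<ge> 0 \<Longrightarrow> cutoff_error N S S' S'' t \<le> C3 * S t powr (2 * a)"
    by (rule power_cutoff_exists[of "2 * a" N]) (use a N in simp, use a N in simp, use a N in simp, blast)
  obtain H H' H'' :: "real \<Rightarrow> real" where
    dH: "\<And>t. (H has_real_derivative H' t) (at t)" "\<And>t. (H' has_real_derivative H'' t) (at t)"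
    and cH: "continuous_on UNIV H''" and H0: "\<And>t. t \<le> 0 \<Longrightarrow> H t = 0" and H1: "\<And>t. t \<ge> 1 \<Longrightarrow> H t = 1"
    and H01: "\<And>t. 0 \<le> H t" "\<And>t. H t \<le> 1"
    using smooth_step_exists by blast
  have S'0: "S' t = 0" "S'' t = 0" if "t < 1" for t
  proof -
    have *: "S' t = 0" if "t < 1" for t
      by (rule DERIV_zero_of_locally_constant[OF dS(1), of "{..<1}"]) (use that S1 in auto)
    then show "S' t = 0" using that .
    show "S'' t = 0"
      by (rule DERIV_zero_of_locally_constant[OF dS(2), of "{..<1}"]) (use that * in auto)
  qed
  have S'2: "S' t = 0" if "t > 2" for t
    by (rule DERIV_zero_of_locally_constant[OF dS(1), of "{2<..}"]) (use that S0 in auto)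
  have H'0: "H' t = 0" "H'' t = 0" if "t > 1" for t
  proof -
    have *: "H' t = 0" if "t > 1" for t
      by (rule DERIV_zero_of_locally_constant[OF dH(1), of "{1<..}"]) (use that H1 in auto)
    then show "H' t = 0" using that .
    show "H'' t = 0"
      by (rule DERIV_zero_of_locally_constant[OF dH(2), of "{1<..}"]) (use that * in auto)
  qed
  \<comment> \<open>Inner cutoff, independent of r: 0 up to R1, inside which stability is not
    assumed, and 1 from 2 R1 on.\<close>
  define T1 where "T1 t = H (t / R1 - 1)" for t
  define T1' where "T1' t = H' (t / R1 - 1) / R1" for t
  define T1'' where "T1'' t = H'' (t / R1 - 1) / R1\<^sup>2" for t
  have lin: "((\<lambda>t. t / k - d) has_real_derivative 1 / k) (at t)" if "k \<noteq> 0" for k d t :: real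
    using that by (auto intro!: derivative_eq_intros)
  have dT1: "(T1 has_real_derivative T1' t) (at t)" "(T1' has_real_derivative T1'' t) (at t)" for t
    using DERIV_chain2[OF dH(1) lin[where k = R1 and d = 1 and t = t]] DERIV_cdivide[OF DERIV_chain2[OF dH(2) lin[where k = R1 and d = 1 and t = t]], of R1] R1
    by (simp_all add: T1_def[abs_def] T1'_def[abs_def] T1''_def power2_eq_square)
  have T1in: "T1 t = 0" if "t \<le> R1" for t using that R1 H0[of "t / R1 - 1"] by (simp add: T1_def)
  have T1out: "T1 t = 1" "T1' t = 0" "T1'' t = 0" if "t > 2 * R1" for t
    using that R1 H1[of "t / R1 - 1"] H'0[of "t / R1 - 1"]
    by (simp_all add: T1_def T1'_def T1''_def field_simps)
  have T1eq: "T1 t = 1" if "t \<ge> 2 * R1" for t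
    using that R1 H1[of "t / R1 - 1"] by (simp add: T1_def field_simps)
  have cT1'': "continuous_on UNIV T1''"
    unfolding T1''_def using R1 by (intro continuous_intros continuous_on_compose2[OF cH]) auto
  define CE1 where "CE1 = cutoff_error N T1 T1' T1''"
  have "continuous_on UNIV CE1"
    unfolding CE1_def cutoff_error_def
    by (intro continuous_intros continuous_on_of_DERIV[OF dT1(1)] continuous_on_of_DERIV[OF dT1(2)] cT1'')
  then have "bounded (CE1 ` {0..2 * R1})"
    by (auto intro!: compact_imp_bounded compact_continuous_image intro: continuous_on_subset)
  then obtain B where B: "\<forall>t\<in>{0..2 * R1}. \<bar>CE1 t\<bar> \<le> B" unfolding bounded_iff by auto
  have CE1b: "CE1 t \<le> \<bar>B\<bar>" if "0 \<le> t" "t \<le> 2 * R1" for t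
  proof -
    have "\<bar>CE1 t\<bar> \<le> B" using B that by simp
    then show ?thesis by linarith
  qed
  have CE1out: "CE1 t = 0" if "t > 2 * R1" for t
    using T1out[OF that] by (simp add: CE1_def cutoff_error_def)
  \<comment> \<open>Multiplied by C C3, the first coefficient becomes c / 2, half of the coefficient
    of the energy on the left.\<close>
  obtain C4 where C4: "C4 > 0" and young: "\<And>x y. 0 \<le> x \<Longrightarrow> 0 \<le> y \<Longrightarrow>
      x powr a * y powr (1 - a) \<le> c / (2 * C * C3) * x + C4 * y"
    using young_inequality_with_parameter[of a "c / (2 * C * C3)"] a c C3 by auto
  define D1 where "D1 = C * (M powr b * \<bar>B\<bar>)"
  define m1 where "m1 = measure lborel (cball (0::'a) (sqrt (2 * R1)))"
  define D2 where "D2 = C * C3 * C4"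
  define V where "V = unit_ball_vol N * sqrt 2 ^ DIM('a)"
  \<comment> \<open>\<open>D1 * m1\<close> bounds the error of the inner cutoff and
    \<open>D2 * V\<close> that of the outer one; the factor 2 / c is the price of absorbing half of
    the energy.\<close>
  define A where "A = (2 / c) * (D1 * m1 + D2 * V)"
  have "(\<integral>x. indicator {x. 2 * R1 \<le> x \<bullet> x \<and> norm x \<le> r} x * u x powr Q \<partial>lborel) \<le> A"
    if r: "r > 0" "r\<^sup>2 > 2 * R1" for r
  proof -
    define T2 where "T2 t = S (t / r\<^sup>2)" for t
    define T2' where "T2' t = S' (t / r\<^sup>2) / r\<^sup>2" for t
    define T2'' where "T2'' t = S'' (t / r\<^sup>2) / (r\<^sup>2)\<^sup>2" for t
    have dT2: "(T2 has_real_derivative T2' t) (at t)" "(T2' has_real_derivative T2'' t) (at t)" for t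
      using DERIV_chain2[OF dS(1) lin[where k = "r\<^sup>2" and d = 0 and t = t, simplified]]
        DERIV_cdivide[OF DERIV_chain2[OF dS(2) lin[where k = "r\<^sup>2" and d = 0 and t = t, simplified]], of "r\<^sup>2"] r
      by (simp_all add: T2_def[abs_def] T2'_def[abs_def] T2''_def power2_eq_square[of "r\<^sup>2"])
    have T2in: "T2 t = 1" "T2' t = 0" "T2'' t = 0" if "t < r\<^sup>2" for t
      using that r S1[of "t / r\<^sup>2"] S'0[of "t / r\<^sup>2"] by (simp_all add: T2_def T2'_def T2''_def)
    have T2eq: "T2 t = 1" if "t \<le> r\<^sup>2" for t
      using that r S1[of "t / r\<^sup>2"] by (simp add: T2_def)
    have T2out: "T2 t = 0" if "t \<ge> 2 * r\<^sup>2" for t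
      using that r S0[of "t / r\<^sup>2"] by (simp add: T2_def field_simps)
    have T2'out: "T2' t = 0" if "t > 2 * r\<^sup>2" for t
      using that r S'2[of "t / r\<^sup>2"] by (simp add: T2'_def field_simps)
    \<comment> \<open>As \<open>r\<^sup>2 > 2 * R1\<close>, the transition layers are disjoint:
      below \<open>r\<^sup>2\<close> the second factor is 1, from there on the first one is. So the
      error of the product is at each t the error of a single factor.\<close>
    define T where "T t = T1 t * T2 t" for t
    define T' where "T' t = T1' t * T2 t + T2' t * T1 t" for t
    define T'' where "T'' t = (T1'' t * T2 t + T2' t * T1' t) + (T2'' t * T1 t + T1' t * T2' t)" for t
    have dT: "(T has_real_derivative T' t) (at t)" "(T' has_real_derivative T'' t) (at t)" for t
      unfolding T_def T'_def T''_def by (intro DERIV_mult DERIV_add dT1 dT2)+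
    have cT2'': "continuous_on UNIV T2''"
      unfolding T2''_def using r by (intro continuous_intros continuous_on_compose2[OF cS]) auto
    have cT'': "continuous_on UNIV T''"
      unfolding T''_def
      by (intro continuous_intros continuous_on_of_DERIV[OF dT1(1)] continuous_on_of_DERIV[OF dT1(2)] cT1''
        continuous_on_of_DERIV[OF dT2(1)] continuous_on_of_DERIV[OF dT2(2)] cT2'')
    define CE where "CE = cutoff_error N T T' T''"
    have Tfar: "T t = 0" "T' t = 0" if "t \<ge> 2 * r\<^sup>2 + 1" for t
      using T2out[of t] T2'out[of t] that by (simp_all add: T_def T'_def)
    have Tin: "T t = 0" if "t \<le> R1" for t using T1in[OF that] by (simp add: T_def)
    have T01: "0 \<le> T t" for t using H01 S01 by (simp add: T_def T1_def T2_def)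
    note est = stability_energy_estimate[of T T' T'' "2 * r\<^sup>2 + 1" R1 f' \<psi> \<psi>' K L b C,
        OF dT cT'' Tfar Tin cf' stable d\<psi> c\<psi>' dK dL b \<psi>b Lb, folded N_def, folded CE_def]
    have CEin: "CE t = CE1 t" if "t < r\<^sup>2" for t
      using T2in[OF that] by (simp add: CE_def CE1_def cutoff_error_def T_def T'_def T''_def)
    have CEout: "CE t \<le> C3 / r\<^sup>2 * T t powr (2 * a)" if "t \<ge> r\<^sup>2" for t
    proof -
      have t: "t > 2 * R1" using that r by simp
      have "CE t = cutoff_error N T2 T2' T2'' t"
        using T1out[OF t] by (simp add: CE_def cutoff_error_def T_def T'_def T''_def)
      also have "\<dots> = cutoff_error N S S' S'' (t / r\<^sup>2) / r\<^sup>2"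
      proof -
        have e1: "4 * N * (T2 t * T2' t) + 8 * t * ((T2' t)\<^sup>2 + T2 t * T2'' t)
          = (4 * N * (S (t / r\<^sup>2) * S' (t / r\<^sup>2)) +
             8 * (t / r\<^sup>2) * ((S' (t / r\<^sup>2))\<^sup>2 + S (t / r\<^sup>2) * S'' (t / r\<^sup>2))) / r\<^sup>2"
          using r by (simp add: T2_def T2'_def T2''_def field_simps power2_eq_square)
        have e2: "4 * t * (T2' t)\<^sup>2 = 4 * (t / r\<^sup>2) * (S' (t / r\<^sup>2))\<^sup>2 / r\<^sup>2"
          using r by (simp add: T2'_def field_simps power2_eq_square)
        have aux: "X / r\<^sup>2 + \<bar>Y / r\<^sup>2\<bar> = (X + \<bar>Y\<bar>) / r\<^sup>2" for X Y
          by (simp add: add_divide_distrib)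
        show ?thesis unfolding cutoff_error_def e1 e2 aux ..
      qed
      also have "\<dots> \<le> C3 * S (t / r\<^sup>2) powr (2 * a) / r\<^sup>2"
        using CES[of "t / r\<^sup>2"] t R1 r by (intro divide_right_mono) auto
      also have "\<dots> = C3 / r\<^sup>2 * T t powr (2 * a)"
        using T1out(1)[OF t] by (simp add: T_def T2_def)
      finally show ?thesis .
    qed
    define X where "X x = u x powr Q * (T (x \<bullet> x))\<^sup>2" for x
    have X0: "X x \<ge> 0" for x by (simp add: X_def)
    have cpow: "continuous_on UNIV (\<lambda>x. u x powr Q)"
      by (rule u_powr_continuous) (use Q b in simp)
    have cTx: "continuous_on S (\<lambda>x::'a. T (x \<bullet> x))" for S
      by (intro continuous_on_radial continuous_on_of_DERIV[OF dT(1)])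
    define R where "R = max 1 \<bar>2 * r\<^sup>2 + 1\<bar>"
    have farR: "T (x \<bullet> x) = 0" if "norm x \<ge> R" for x :: 'a
      using norm_ge_imp_inner_ge[of "2 * r\<^sup>2 + 1" x] that Tfar by (simp add: R_def)
    have iX: "integrable lborel X"
      unfolding X_def
      by (rule continuous_compact_support_integrable[of _ R])
        (auto intro!: continuous_intros cpow cTx simp: farR)
    have cKu: "continuous_on UNIV (\<lambda>x. (f' (u x) * (\<psi> (u x))\<^sup>2 - f (u x) * K (u x)) * (T (x \<bullet> x))\<^sup>2)"
      by (intro continuous_intros cTx fu_continuous continuous_on_compose2[OF cf' u_continuous]
        continuous_on_compose2[OF continuous_on_of_DERIV[OF d\<psi>, of UNIV] u_continuous]
        continuous_on_compose2[OF continuous_on_of_DERIV[OF dK, of UNIV] u_continuous]) (use u_nonneg in auto)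
    have ind: "integrable lborel (\<lambda>x. indicator (cball (0::'a) s) x :: real)" for s
      by (intro integrable_indicator_bounded) auto
    define I where "I = (\<integral>x. X x \<partial>lborel)"
    have "c * I = (\<integral>x. c * X x \<partial>lborel)" by (simp add: I_def)
    also have "\<dots> \<le> (\<integral>x. (f' (u x) * (\<psi> (u x))\<^sup>2 - f (u x) * K (u x)) * (T (x \<bullet> x))\<^sup>2 \<partial>lborel)"
    proof (rule Bochner_Integration.integral_mono)
      show "integrable lborel (\<lambda>x. (f' (u x) * (\<psi> (u x))\<^sup>2 - f (u x) * K (u x)) * (T (x \<bullet> x))\<^sup>2)"
        by (rule continuous_compact_support_integrable[OF cKu, of R]) (simp add: farR)
      fix x
      show "c * X x \<le> (f' (u x) * (\<psi> (u x))\<^sup>2 - f (u x) * K (u x)) * (T (x \<bullet> x))\<^sup>2"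
        using mult_right_mono[OF lower[OF u_nonneg u_le, of x] zero_le_power2[of "T (x \<bullet> x)"]]
        by (simp add: X_def mult.assoc)
    qed (use iX in auto)
    also have "\<dots> \<le> (\<integral>x. C * (u x powr b * CE (x \<bullet> x)) \<partial>lborel)" by (rule est(1))
    also have "\<dots> \<le> (\<integral>x. D1 * indicator (cball 0 (sqrt (2 * R1))) x + (c / 2 * X x +
        D2 / r ^ DIM('a) * indicator (cball 0 (sqrt 2 * r)) x) \<partial>lborel)"
    proof (rule Bochner_Integration.integral_mono)
      fix x :: 'a
      have D12: "D1 \<ge> 0" "D2 \<ge> 0" using c C3 C4 by (auto simp: D1_def D2_def)
      have xx: "x \<bullet> x \<ge> 0" by simp
      show "C * (u x powr b * CE (x \<bullet> x)) \<le> D1 * indicator (cball 0 (sqrt (2 * R1))) x + (c / 2 * X x +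
        D2 / r ^ DIM('a) * indicator (cball 0 (sqrt 2 * r)) x)"
      proof (cases "x \<bullet> x < r\<^sup>2")
        case True
        have "C * (u x powr b * CE (x \<bullet> x)) \<le> D1 * indicator (cball 0 (sqrt (2 * R1))) x"
        proof (cases "x \<bullet> x \<le> 2 * R1")
          case le: True
          have "u x powr b * CE (x \<bullet> x) \<le> M powr b * \<bar>B\<bar>"
            unfolding CEin[OF True] using CE1b[OF xx le] u_nonneg u_le b
            by (smt (verit) mult_left_mono mult_right_mono powr_ge_zero powr_mono2)
          moreover have "norm x \<le> sqrt (2 * R1)" using le by (simp add: norm_eq_sqrt_inner)
          ultimately show ?thesis using c by (simp add: D1_def)
        next
          case False
          then show ?thesis using CEin[OF True] CE1out D12 by simp
        qed
        moreover have "0 \<le> c / 2 * X x + D2 / r ^ DIM('a) * indicator (cball 0 (sqrt 2 * r)) x"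
          using c X0 D12 r by simp
        ultimately show ?thesis by linarith
      next
        case False
        have "C * (u x powr b * CE (x \<bullet> x)) \<le> c / 2 * X x + D2 / r ^ DIM('a) * indicator (cball 0 (sqrt 2 * r)) x"
        proof (cases "x \<bullet> x \<le> 2 * r\<^sup>2")
          case le: True
          have nx: "norm x \<le> sqrt 2 * r"
            using le r real_sqrt_le_mono[OF le] by (simp add: norm_eq_sqrt_inner real_sqrt_mult)
          \<comment> \<open>Chosen with \<open>y powr (1 - a) = 1 / r\<^sup>2\<close>, which gives
            the error the shape of the left side of Young's inequality.\<close>
          define y where "y = 1 / r ^ DIM('a)"
          have y: "y \<ge> 0" "y powr (1 - a) = 1 / r\<^sup>2"
          proof -
            have "r ^ DIM('a) = r powr N" using r by (simp add: N_def powr_realpow)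
            then have "y powr (1 - a) = (r powr - N) powr (2 / N)"
              using a by (simp add: y_def powr_minus_divide)
            also have "\<dots> = r powr - 2" using N by (simp add: powr_powr)
            finally show "y powr (1 - a) = 1 / r\<^sup>2" using r by (simp add: powr_minus_divide)
          qed (use r in \<open>simp add: y_def\<close>)
          have "C * (u x powr b * CE (x \<bullet> x)) \<le> C * (u x powr b * (C3 / r\<^sup>2 * T (x \<bullet> x) powr (2 * a)))"
            using CEout[of "x \<bullet> x"] False c by (intro mult_left_mono) auto
          also have "\<dots> = C * C3 * ((u x powr b * T (x \<bullet> x) powr (2 * a)) * (1 / r\<^sup>2))" by simp
          also have "u x powr b * T (x \<bullet> x) powr (2 * a) = X x powr a"
          proof -
            have "(T (x \<bullet> x))\<^sup>2 powr a = T (x \<bullet> x) powr (2 * a)"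
              using T01[of "x \<bullet> x"] a by (cases "T (x \<bullet> x) = 0") (auto simp: powr_powr[symmetric])
            moreover have "(u x powr Q) powr a = u x powr b" using a by (simp add: powr_powr mult.commute)
            ultimately show ?thesis by (simp add: X_def powr_mult)
          qed
          also have "C * C3 * (X x powr a * (1 / r\<^sup>2)) \<le> C * C3 * (c / (2 * C * C3) * X x + C4 * y)"
            unfolding y(2)[symmetric] using young[OF X0 y(1)] c C3 by (intro mult_left_mono) auto
          also have "\<dots> = c / 2 * X x + D2 * y" using c C3 by (simp add: D2_def field_simps)
          finally show ?thesis using nx by (simp add: y_def)
        next
          case gt: False
          then have "CE (x \<bullet> x) \<le> 0"
            using CEout[of "x \<bullet> x"] False T2out[of "x \<bullet> x"] by (simp add: T_def)
          then have "C * (u x powr b * CE (x \<bullet> x)) \<le> 0"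
            using c by (intro mult_nonneg_nonpos) auto
          moreover have "0 \<le> c / 2 * X x + D2 / r ^ DIM('a) * indicator (cball 0 (sqrt 2 * r)) x"
            using c X0 D12 r by simp
          ultimately show ?thesis by linarith
        qed
        moreover have "0 \<le> D1 * indicator (cball 0 (sqrt (2 * R1))) x" using D12 by simp
        ultimately show ?thesis by linarith
      qed
    qed (use est(2) iX ind in auto)
    also have "\<dots> = D1 * m1 + (c / 2 * I + D2 / r ^ DIM('a) * measure lborel (cball (0::'a) (sqrt 2 * r)))"
      using iX ind by (simp add: I_def m1_def)
    also have "D2 / r ^ DIM('a) * measure lborel (cball (0::'a) (sqrt 2 * r)) = D2 * V"
      using r content_cball[of "sqrt 2 * r" "0::'a"]
      by (simp add: V_def N_def power_mult_distrib)
    finally have "c / 2 * I \<le> D1 * m1 + D2 * V" by simp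
    then have "I \<le> A" using c by (simp add: A_def field_simps)
    moreover have "(\<integral>x. indicator {x. 2 * R1 \<le> x \<bullet> x \<and> norm x \<le> r} x * u x powr Q \<partial>lborel) \<le> I"
      unfolding I_def
    proof (rule integral_mono')
      fix x :: 'a
      show "indicator {x. 2 * R1 \<le> x \<bullet> x \<and> norm x \<le> r} x * u x powr Q \<le> X x"
      proof (cases "2 * R1 \<le> x \<bullet> x \<and> norm x \<le> r")
        case True
        then have "(norm x)\<^sup>2 \<le> r\<^sup>2" by (intro power_mono) auto
        then have "x \<bullet> x \<le> r\<^sup>2" by (simp add: power2_norm_eq_inner)
        then show ?thesis using True T1eq T2eq by (simp add: X_def T_def)
      qed (use X0 in auto)
    qed (use iX X0 in auto)
    ultimately show ?thesis by linarith
  qed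
  then show ?thesis by blast
qed

text \<open>The energies of growing annuli with fixed inner radius have a finite supremum; past a
  radius \<rho> whose energy is within \<epsilon> of it, every further annulus carries less than
  \<epsilon>.\<close>

lemma tail_small:
  assumes Q: "Q > 0" and R1: "R1 > 0"
    and bd: "\<forall>r>0. r\<^sup>2 > 2 * R1 \<longrightarrow>
    (\<integral>x. indicator {x. 2 * R1 \<le> x \<bullet> x \<and> norm x \<le> r} x * u x powr Q \<partial>lborel) \<le> A"
    and \<epsilon>: "\<epsilon> > 0"
  shows "\<exists>\<rho>>0. \<forall>s. (\<integral>x. indicator {x. \<rho> < norm x \<and> norm x \<le> s} x * u x powr Q \<partial>lborel) < \<epsilon>"
proof -
  define r0 where "r0 = sqrt (2 * R1) + 1"
  have r0: "r0 > 0" using R1 by (simp add: r0_def add_pos_pos)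
  have r02: "r\<^sup>2 > 2 * R1" if "r \<ge> r0" for r
  proof -
    have "sqrt (2 * R1) < r" using that by (simp add: r0_def)
    then have "(sqrt (2 * R1))\<^sup>2 < r\<^sup>2" using R1 by (intro power_strict_mono) auto
    then show ?thesis using R1 by simp
  qed
  define J where "J r = (\<integral>x. indicator {x. 2 * R1 \<le> x \<bullet> x \<and> norm x \<le> r} x * u x powr Q \<partial>lborel)" for r
  have cpow: "continuous_on S (\<lambda>x. u x powr Q)" for S
    by (rule u_powr_continuous[OF Q])
  have int: "integrable lborel (\<lambda>x. indicator S x * u x powr Q)" if "S \<in> sets borel" "S \<subseteq> cball 0 s" for S s
  proof -
    have "integrable lborel (\<lambda>x. indicator (cball 0 s) x *\<^sub>R u x powr Q)"
      by (rule borel_integrable_compact) (use cpow in auto)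
    from integrable_mult_indicator[OF _ this, of S] that
    have "integrable lborel (\<lambda>x. indicator S x *\<^sub>R (indicator (cball 0 s) x *\<^sub>R u x powr Q))" by simp
    moreover have "(\<lambda>x. indicator S x *\<^sub>R (indicator (cball 0 s) x *\<^sub>R u x powr Q)) = (\<lambda>x. indicator S x * u x powr Q)"
      using that(2) by (auto simp: fun_eq_iff indicator_def)
    ultimately show ?thesis by simp
  qed
  have m1: "{x::'a. 2 * R1 \<le> x \<bullet> x \<and> norm x \<le> r} \<in> sets borel" for r by measurable
  have m2: "{x::'a. r < norm x \<and> norm x \<le> s} \<in> sets borel" for r s by measurable
  have "bdd_above (J ` {r0..})"
    using bd r02 r0 unfolding J_def by (intro bdd_aboveI2[of _ _ A]) (auto intro: less_le_trans)
  define A0 where "A0 = (SUP r\<in>{r0..}. J r)"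
  have "A0 - \<epsilon> < A0" using \<epsilon> by simp
  then obtain \<rho> where \<rho>: "\<rho> \<ge> r0" "J \<rho> > A0 - \<epsilon>"
    unfolding A0_def using less_cSUP_iff[OF _ \<open>bdd_above (J ` {r0..})\<close>] by auto
  have "(\<integral>x. indicator {x. \<rho> < norm x \<and> norm x \<le> s} x * u x powr Q \<partial>lborel) < \<epsilon>" for s
  proof (cases "s \<ge> \<rho>")
    case True
    have "J s \<le> A0"
      unfolding A0_def by (rule cSUP_upper[OF _ \<open>bdd_above (J ` {r0..})\<close>]) (use True \<rho> in auto)
    moreover have "J s = J \<rho> + (\<integral>x. indicator {x. \<rho> < norm x \<and> norm x \<le> s} x * u x powr Q \<partial>lborel)"
    proof -
      have "J \<rho> + (\<integral>x. indicator {x. \<rho> < norm x \<and> norm x \<le> s} x * u x powr Q \<partial>lborel)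
        = (\<integral>x. indicator {x. 2 * R1 \<le> x \<bullet> x \<and> norm x \<le> \<rho>} x * u x powr Q
          + indicator {x. \<rho> < norm x \<and> norm x \<le> s} x * u x powr Q \<partial>lborel)"
        unfolding J_def
        by (rule Bochner_Integration.integral_add[symmetric]; rule int[of _ "max \<rho> s"]) (use m1 m2 in auto)
      also have "\<dots> = J s"
        unfolding J_def
      proof (rule Bochner_Integration.integral_cong[OF refl])
        fix x :: 'a
        have "2 * R1 \<le> x \<bullet> x" if "\<rho> < norm x"
          using r02[of "norm x"] that \<rho> by (simp add: power2_norm_eq_inner)
        then show "indicator {x. 2 * R1 \<le> x \<bullet> x \<and> norm x \<le> \<rho>} x * u x powr Q
          + indicator {x. \<rho> < norm x \<and> norm x \<le> s} x * u x powr Q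
          = indicator {x. 2 * R1 \<le> x \<bullet> x \<and> norm x \<le> s} x * u x powr Q"
          using True by (cases "norm x \<le> \<rho>") (auto simp: indicator_def)
      qed
      finally show ?thesis by simp
    qed
    ultimately show ?thesis using \<rho> by linarith
  next
    case False
    then have "{x::'a. \<rho> < norm x \<and> norm x \<le> s} = {}" by auto
    then show ?thesis using \<epsilon> by simp
  qed
  then show ?thesis using \<rho> r0 by (intro exI[of _ \<rho>]) auto
qed

section \<open>Decay at infinity\<close>

text \<open>
  The point \<open>x1\<close> maximises \<open>dist(x, boundary)\<^sup>2 u(x)\<^bsup>p-1\<^esup>\<close> over a ball of radius \<open>|x0| / 2\<close>
  about \<open>x0\<close>. At the scale \<open>r\<close> proportional to \<open>u(x1)\<^bsup>-(p-1)/2\<^esup>\<close> the nonlinear term of the mean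
  value inequality is absorbed, and \<open>\<integral> u\<^sup>Q\<close> over the ball of radius \<open>r\<close> is bounded below since
  \<open>Q = N (p - 1) / 2\<close> is the scaling-invariant exponent.
\<close>
lemma decay_of_small_tail:
  assumes p: "p > 1" and Cf: "Cf > 0" and fb: "\<And>s. 0 \<le> s \<Longrightarrow> s \<le> M \<Longrightarrow> f s \<le> Cf * s powr p"
    and Q: "Q = real DIM('a) * (p - 1) / 2" "Q > 1"
    and tail: "\<And>\<epsilon>. \<epsilon> > 0 \<Longrightarrow>
      \<exists>\<rho>>0. \<forall>s. (\<integral>x. indicator {x. \<rho> < norm x \<and> norm x \<le> s} x * u x powr Q \<partial>lborel) < \<epsilon>"
    and \<epsilon>: "\<epsilon> > 0"
  shows "\<exists>\<rho>>0. \<forall>x. norm x \<ge> \<rho> \<longrightarrow> (norm x)\<^sup>2 * u x powr (p - 1) \<le> \<epsilon>"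
proof -
  define q where "q = p - 1"
  have q: "q > 0" using p by (simp add: q_def)
  define E where "E = (\<integral>y. bump_density (y::'a) \<partial>lborel)"
  define W where "W = (\<integral>y. bump (y::'a) \<partial>lborel)"
  have E: "E > 0" unfolding E_def by (rule bump_density_integral_pos)
  have W: "W \<ge> 0" unfolding W_def by (intro Bochner_Integration.integral_nonneg bump_nonneg)
  define k where "k = 4 powr (1 / q)"
  define C' where "C' = Cf * k powr p"
  have C': "C' > 0" using Cf by (simp add: C'_def k_def)
  \<comment> \<open>The first bound yields r < d / 2; the second absorbs the nonlinear term into
    half of the left side of the mean value inequality. The added 1 keeps the denominator positive
    from W \<ge> 0 alone.\<close>
  define c2 where "c2 = min (\<epsilon> / 16) (E / (C' * W + 1))"
  have c2: "c2 > 0" "c2 \<le> \<epsilon> / 16" "c2 * (C' * W) \<le> E"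
  proof -
    have 1: "C' * W + 1 > 0" using C' W by (simp add: add_nonneg_pos)
    show "c2 > 0" using \<epsilon> E 1 by (simp add: c2_def)
    show "c2 \<le> \<epsilon> / 16" unfolding c2_def by (rule min.cobounded1)
    have "c2 * (C' * W + 1) \<le> E / (C' * W + 1) * (C' * W + 1)"
      using 1 by (intro mult_right_mono) (auto simp: c2_def)
    also have "\<dots> = E" using 1 by simp
    finally show "c2 * (C' * W) \<le> E" using \<open>c2 > 0\<close> by (simp add: distrib_left)
  qed
  define c where "c = sqrt c2"
  have c: "c > 0" "c\<^sup>2 = c2" using c2 by (auto simp: c_def)
  \<comment> \<open>Fixed by the final chain: as \<open>r ^ DIM('a)\<close> is
    \<open>c ^ DIM('a) * m powr - Q\<close>, all powers of m but one cancel and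
    \<open>4 * (a * (\<eta> / r ^ DIM('a)))\<close> is exactly m E.\<close>
  define \<eta> where "\<eta> = E * c ^ DIM('a) / (24 * 4 powr (Q - 1))"
  have \<eta>: "\<eta> > 0" using E c by (simp add: \<eta>_def)
  obtain \<rho> where \<rho>: "\<rho> > 0"
    "\<And>s. (\<integral>x. indicator {x. \<rho> < norm x \<and> norm x \<le> s} x * u x powr Q \<partial>lborel) < \<eta>"
    using tail[OF \<eta>] by auto
  have "(norm x0)\<^sup>2 * u x0 powr q \<le> \<epsilon>" if x0: "norm x0 \<ge> 2 * \<rho>" for x0
  proof (rule ccontr)
    assume neg: "\<not> (norm x0)\<^sup>2 * u x0 powr q \<le> \<epsilon>"
    define R where "R = norm x0 / 2"
    have R: "R \<ge> \<rho>" "R > 0" using x0 \<rho> by (auto simp: R_def)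
    define h where "h x = (R - dist x0 x)\<^sup>2 * u x powr q" for x
    have "continuous_on (cball x0 R) h"
      unfolding h_def by (intro continuous_intros u_powr_continuous q)
    then obtain x1 where x1: "x1 \<in> cball x0 R" "\<And>x. x \<in> cball x0 R \<Longrightarrow> h x \<le> h x1"
      using continuous_attains_sup[of "cball x0 R" h] R by auto
    define d where "d = R - dist x0 x1"
    define m where "m = u x1"
    have "\<epsilon> / 4 < h x0" using neg by (simp add: h_def R_def power_divide)
    also have "h x0 \<le> h x1" using x1(2)[of x0] R by simp
    finally have hx1: "\<epsilon> / 4 < d\<^sup>2 * m powr q" by (simp add: h_def d_def m_def)
    then have "d \<noteq> 0" "m \<noteq> 0" using \<epsilon> by auto
    then have dm: "d > 0" "m > 0" using x1(1) u_nonneg[of x1] by (auto simp: d_def m_def less_le)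
    define r where "r = c * m powr (- q / 2)"
    have r: "r > 0" using c dm by (simp add: r_def)
    have r2: "r\<^sup>2 = c2 * m powr - q"
      using dm c by (simp add: r_def power_mult_distrib powr_power)
    have "r\<^sup>2 < (d / 2)\<^sup>2"
    proof -
      have "r\<^sup>2 \<le> \<epsilon> / 16 * m powr - q" unfolding r2 using c2 by (intro mult_right_mono) auto
      also have "\<dots> < (d\<^sup>2 * m powr q) / 4 * m powr - q"
        using hx1 dm by (intro mult_strict_right_mono) auto
      also have "\<dots> = (d / 2)\<^sup>2" using dm by (simp add: powr_minus power_divide)
      finally show ?thesis .
    qed
    then have rd: "r < d / 2" by (rule power2_less_imp_less) (use dm in simp)
    \<comment> \<open>Here the distance to the boundary of the large ball is still at least d / 2,
      so maximality of x1 gives \<open>u y powr q \<le> 4 * m powr q\<close>; this is the origin of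
      k.\<close>
    have near: "u y \<le> k * m" "norm y > \<rho>" "norm y \<le> 3 * R" if y: "dist x1 y < r" for y
    proof -
      have dy: "R - dist x0 y > d / 2"
        using dist_triangle[of x0 y x1] y rd by (simp add: d_def)
      have "dist x0 y < R" using dy dm by linarith
      then show "norm y > \<rho>" "norm y \<le> 3 * R"
        using norm_triangle_ineq2[of x0 y] norm_triangle_ineq2[of y x0] R
        by (auto simp: dist_norm R_def norm_minus_commute)
      have "h y \<le> h x1" using \<open>dist x0 y < R\<close> by (intro x1(2)) auto
      then have "(R - dist x0 y)\<^sup>2 * u y powr q \<le> d\<^sup>2 * m powr q" by (simp add: h_def d_def m_def)
      moreover have "(d / 2)\<^sup>2 * u y powr q \<le> (R - dist x0 y)\<^sup>2 * u y powr q"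
        using dy dm by (intro mult_right_mono power_mono) auto
      ultimately have "d\<^sup>2 * u y powr q \<le> d\<^sup>2 * (4 * m powr q)" by (simp add: power_divide)
      then have "u y powr q \<le> 4 * m powr q" using dm by simp
      then have "(u y powr q) powr (1 / q) \<le> (4 * m powr q) powr (1 / q)"
        using q by (intro powr_mono2) auto
      then show "u y \<le> k * m"
        using q u_nonneg[of y] dm by (simp add: powr_powr powr_mult k_def)
    qed
    have lap: "- (C' * m powr p) \<le> (\<Sum>b\<in>Basis. DG y b \<bullet> b)" if "dist x1 y < r" for y
    proof -
      have "f (u y) \<le> Cf * u y powr p" by (intro fb u_nonneg u_le)
      also have "\<dots> \<le> Cf * (k * m) powr p"
        using near(1)[OF that] Cf p u_nonneg by (intro mult_left_mono powr_mono2) auto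
      also have "\<dots> = C' * m powr p" using dm by (simp add: C'_def powr_mult k_def)
      finally show ?thesis using equation[of y] by simp
    qed
    define I where "I = (\<integral>y. u (x1 + r *\<^sub>R y) * bump_density y \<partial>lborel)"
    have "m * E \<le> I + C' * m powr p * r\<^sup>2 / 2 * W"
      using weighted_mean_value_inequality[OF du dG DG_continuous less_imp_le[OF r] lap]
      by (simp add: m_def I_def E_def W_def)
    also have "C' * m powr p * r\<^sup>2 / 2 * W = c2 * (C' * W) * m / 2"
    proof -
      have "m powr p * m powr - q = m" using dm by (simp add: powr_add[symmetric] q_def)
      then show ?thesis unfolding r2 by simp
    qed
    also have "\<dots> \<le> E * m / 2" using c2(3) dm by (intro divide_right_mono mult_right_mono) auto
    finally have mE: "m * E \<le> 2 * I" by (simp add: field_simps)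
    define w where "w y = indicator {x. \<rho> < norm x \<and> norm x \<le> 3 * R} y * u y powr Q" for y
    have meas: "{x::'a. \<rho> < norm x \<and> norm x \<le> 3 * R} \<in> sets borel" by measurable
    have cQ: "continuous_on UNIV (\<lambda>x. u x powr Q)" by (rule u_powr_continuous) (use Q in simp)
    then have mQ: "(\<lambda>x. u x powr Q) \<in> borel_measurable borel" by (rule borel_measurable_continuous_onI)
    have wm: "w \<in> borel_measurable borel"
      unfolding w_def using meas mQ by (intro borel_measurable_times borel_measurable_indicator)
    have w0: "w y \<ge> 0" for y by (simp add: w_def)
    have wr: "integrable lborel (\<lambda>y. w (x1 + r *\<^sub>R y))"
    proof (rule Bochner_Integration.integrable_bound)
      define s where "s = (3 * R + norm x1) / r"
      show "integrable lborel (\<lambda>y. indicator (cball 0 s) y *\<^sub>R u (x1 + r *\<^sub>R y) powr Q)"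
        by (rule borel_integrable_compact)
          (auto intro!: continuous_on_compose2[OF cQ] continuous_intros)
      show "(\<lambda>y. w (x1 + r *\<^sub>R y)) \<in> borel_measurable lborel"
        using wm by measurable
      have "norm (w (x1 + r *\<^sub>R y)) \<le> norm (indicator (cball 0 s) y *\<^sub>R u (x1 + r *\<^sub>R y) powr Q)" for y
      proof (cases "norm (x1 + r *\<^sub>R y) \<le> 3 * R")
        case True
        have "norm (r *\<^sub>R y) \<le> norm (x1 + r *\<^sub>R y) + norm x1"
          using norm_triangle_ineq4[of "x1 + r *\<^sub>R y" x1] by simp
        then have "norm y \<le> s" using True r by (simp add: s_def field_simps)
        then show ?thesis by (simp add: w_def indicator_def)
      qed (simp add: w_def)
      then show "AE y in lborel. norm (w (x1 + r *\<^sub>R y)) \<le> norm (indicator (cball 0 s) y *\<^sub>R u (x1 + r *\<^sub>R y) powr Q)"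
        by simp
    qed
    define J where "J = (\<integral>y. w (x1 + r *\<^sub>R y) \<partial>lborel)"
    have "r ^ DIM('a) * J < \<eta>"
      using lborel_integral_affine[OF r wm, of x1] \<rho>(2)[of "3 * R"] unfolding w_def J_def by simp
    have ibd: "integrable lborel (bump_density :: 'a \<Rightarrow> real)"
      by (rule continuous_compact_support_integrable[OF bump_cont(2) bump_zero(2)])
    define a where "a = 6 * (m / 4) powr (1 - Q)"
    have "I \<le> (\<integral>y. m / 4 * bump_density y + a * w (x1 + r *\<^sub>R y) \<partial>lborel)"
      unfolding I_def
    proof (rule Bochner_Integration.integral_mono)
      show "integrable lborel (\<lambda>y. u (x1 + r *\<^sub>R y) * bump_density y)"
        by (rule continuous_compact_support_integrable[of _ 1])
          (auto intro!: continuous_intros continuous_on_compose2[OF u_continuous[of UNIV]] bump_cont simp: bump_zero)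
      fix y :: 'a
      show "u (x1 + r *\<^sub>R y) * bump_density y \<le> m / 4 * bump_density y + a * w (x1 + r *\<^sub>R y)"
      proof (cases "norm y < 1")
        case False
        then show ?thesis using w0[of "x1 + r *\<^sub>R y"] bump_zero(2)[of y] by (simp add: a_def)
      next
        case True
        define t where "t = u (x1 + r *\<^sub>R y)"
        have t: "t \<ge> 0" by (simp add: t_def u_nonneg)
        have "r * norm y < r * 1" using True r by (intro mult_strict_left_mono) auto
        then have "dist x1 (x1 + r *\<^sub>R y) < r" using r by (simp add: dist_norm)
        from near(2,3)[OF this] have w: "w (x1 + r *\<^sub>R y) = t powr Q" by (simp add: w_def t_def)
        \<comment> \<open>Splitting at the level m / 4 passes from u to its Q-th power: above the
          level, Q > 1 lets the power dominate. The part below contributes m E / 4 to I, which is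
          absorbed as well.\<close>
        have "t \<le> m / 4 + (m / 4) powr (1 - Q) * t powr Q"
        proof (cases "t \<le> m / 4")
          case False
          then have "1 \<le> (t / (m / 4)) powr (Q - 1)" using Q dm by (intro ge_one_powr_ge_zero) auto
          then have "t * 1 \<le> t * (t / (m / 4)) powr (Q - 1)" using t by (intro mult_left_mono) auto
          also have "\<dots> = (m / 4) powr (1 - Q) * t powr Q"
            using False dm t by (simp add: powr_divide powr_diff powr_mult ac_simps)
          finally show ?thesis using dm by simp
        qed (use dm in \<open>simp add: add_increasing2\<close>)
        then have "t * bump_density y \<le> (m / 4 + (m / 4) powr (1 - Q) * t powr Q) * bump_density y"
          by (intro mult_right_mono bump_nonneg)
        also have "\<dots> \<le> m / 4 * bump_density y + a * t powr Q"
        proof -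
          have "(m / 4) powr (1 - Q) * t powr Q * bump_density y \<le> (m / 4) powr (1 - Q) * t powr Q * 6"
            by (intro mult_left_mono bump_nonneg) auto
          then show ?thesis by (simp add: a_def algebra_simps)
        qed
        finally show ?thesis by (simp add: w t_def)
      qed
    qed (use ibd wr in auto)
    also have "\<dots> = m / 4 * E + a * J" using ibd wr by (simp add: E_def J_def)
    finally have "m * E \<le> 4 * (a * J)" using mE by simp
    also have "\<dots> < 4 * (a * (\<eta> / r ^ DIM('a)))"
      using \<open>r ^ DIM('a) * J < \<eta>\<close> r dm by (simp add: a_def field_simps)
    also have "\<dots> = m * E"
    proof -
      have "(m powr (- q / 2)) ^ DIM('a) = (m powr (- q / 2)) powr real DIM('a)"
        using dm by (simp add: powr_realpow)
      also have "\<dots> = m powr (- q / 2 * real DIM('a))" by (simp only: powr_powr)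
      also have "- q / 2 * real DIM('a) = - Q" by (simp add: Q(1) q_def) (simp add: algebra_simps)
      finally have "r ^ DIM('a) = c ^ DIM('a) * m powr - Q"
        by (simp add: r_def power_mult_distrib)
      moreover have "(m / 4) powr (1 - Q) = m * m powr - Q * 4 powr (Q - 1)"
      proof -
        have "m powr (1 - Q) = m * m powr - Q" using dm powr_add[of m 1 "- Q"] by simp
        moreover have "4 powr (Q - 1) = 1 / 4 powr (1 - Q)" using powr_minus_divide[of 4 "1 - Q"] by simp
        ultimately show ?thesis using dm by (simp add: powr_divide)
      qed
      moreover have "m powr - Q > 0" using dm by simp
      ultimately show ?thesis
        using c unfolding a_def \<eta>_def by simp
    qed
    finally show False by simp
  qed
  then show ?thesis using \<rho> by (intro exI[of _ "2 * \<rho>"]) (auto simp: q_def)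
qed

text \<open>For 0 < s < N - 2 the function |x|^-s satisfies -\<Delta>|x|^-s = s (N - 2 - s) |x|^-2
  |x|^-s with a positive coefficient, whereas far out f(u) is at most \<mu> / 2 times |x|^-2 u. So C
  |x|^-a + \<delta> |x|^-b is a barrier: the first term dominates u on the inner sphere, the second
  at infinity because u = o(|x|^-b), and \<delta> tends to 0 at the end. In the variable t = |x|^2
  the exponents are halved.\<close>

lemma fast_decay:
  assumes p: "p > 1" and Cf: "Cf > 0" and fb: "\<And>s. 0 \<le> s \<Longrightarrow> s \<le> M \<Longrightarrow> f s \<le> Cf * s powr p"
    and decay: "\<And>\<epsilon>. \<epsilon> > 0 \<Longrightarrow> \<exists>\<rho>>0. \<forall>x. norm x \<ge> \<rho> \<longrightarrow> (norm x)\<^sup>2 * u x powr (p - 1) \<le> \<epsilon>"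
    and b: "b = 2 / (p - 1)" "b < real DIM('a) - 2" and a: "0 < a" "a < real DIM('a) - 2"
  shows "\<exists>C>0. \<exists>\<rho>>0. \<forall>x. norm x \<ge> \<rho> \<longrightarrow> u x \<le> C * (x \<bullet> x) powr (- a / 2)"
proof -
  define N where "N = real DIM('a)"
  define \<mu> where "\<mu> = min (a * (N - 2 - a)) (b * (N - 2 - b))"
  have b0: "b > 0" using b p by simp
  have \<mu>: "\<mu> > 0" "\<mu> \<le> a * (N - 2 - a)" "\<mu> \<le> b * (N - 2 - b)"
    using a b b0 by (auto simp: \<mu>_def N_def)
  have "\<mu> / (2 * Cf) > 0" using \<mu> Cf by simp
  then obtain \<rho> where \<rho>: "\<rho> > 0"
    "\<And>x. norm x \<ge> \<rho> \<Longrightarrow> (norm x)\<^sup>2 * u x powr (p - 1) \<le> \<mu> / (2 * Cf)"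
    using decay by blast
  have xx: "x \<bullet> x > 0" if "norm x \<ge> \<rho>" for x :: 'a using that \<rho> by auto
  have fsmall: "(x \<bullet> x) * f (u x) \<le> \<mu> / 2 * u x" if "norm x \<ge> \<rho>" for x
  proof -
    have "(x \<bullet> x) * f (u x) \<le> (x \<bullet> x) * (Cf * u x powr p)"
      by (intro mult_left_mono fb u_nonneg u_le) auto
    also have "u x powr p = u x * u x powr (p - 1)"
      using u_nonneg[of x] p by (cases "u x = 0") (auto simp: powr_diff)
    also have "(x \<bullet> x) * (Cf * (u x * u x powr (p - 1))) = Cf * u x * ((norm x)\<^sup>2 * u x powr (p - 1))"
      by (simp add: power2_norm_eq_inner)
    also have "\<dots> \<le> Cf * u x * (\<mu> / (2 * Cf))"
      using \<rho>(2)[OF that] Cf u_nonneg by (intro mult_left_mono) auto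
    also have "\<dots> = \<mu> / 2 * u x" using Cf by simp
    finally show ?thesis .
  qed
  \<comment> \<open>Makes C |x|^-a equal to M, the bound of u, on the sphere of radius
    \<rho>.\<close>
  define C where "C = M * \<rho> powr a"
  have C: "C > 0" using M_pos \<rho> by (simp add: C_def)
  have main: "u x \<le> C * (x \<bullet> x) powr (- a / 2) + \<delta> * (x \<bullet> x) powr (- b / 2)"
    if \<delta>: "\<delta> > 0" and x2: "norm x \<ge> \<rho>" for \<delta> x
  proof (rule ccontr)
    assume neg: "\<not> u x \<le> C * (x \<bullet> x) powr (- a / 2) + \<delta> * (x \<bullet> x) powr (- b / 2)"
    define T where "T t = C * t powr (- a / 2) + \<delta> * t powr (- b / 2)" for t
    define T' where "T' t = C * (- a / 2 * t powr (- a / 2 - 1)) + \<delta> * (- b / 2 * t powr (- b / 2 - 1))" for t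
    define T'' where "T'' t = C * (- a / 2 * ((- a / 2 - 1) * t powr (- a / 2 - 1 - 1)))
      + \<delta> * (- b / 2 * ((- b / 2 - 1) * t powr (- b / 2 - 1 - 1)))" for t
    have dT: "(T has_real_derivative T' t) (at t)" "(T' has_real_derivative T'' t) (at t)" if "t > 0" for t
      unfolding T_def T'_def T''_def
      by (intro DERIV_add DERIV_cmult has_real_derivative_powr that)+
    have Tpos: "T t > 0" if "t > 0" for t
      using that C \<delta> by (simp add: T_def add_pos_pos)
    have lapT: "t * (4 * T'' t * t + 2 * T' t * N) \<le> - \<mu> * T t" if t: "t > 0" for t
    proof -
      have e: "t powr (s - 1) = t powr s / t" "t powr (s - 1 - 1) = t powr s / t / t" for s
        using t by (simp_all add: powr_diff power2_eq_square)
      have "t * (4 * T'' t * t + 2 * T' t * N)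
        = - (a * (N - 2 - a)) * (C * t powr (- a / 2)) - (b * (N - 2 - b)) * (\<delta> * t powr (- b / 2))"
        unfolding T'_def T''_def e using t by (simp add: field_simps)
      also have "\<dots> \<le> - \<mu> * (C * t powr (- a / 2)) - \<mu> * (\<delta> * t powr (- b / 2))"
        using \<mu> C \<delta> by (intro diff_mono mult_right_mono) auto
      also have "\<dots> = - \<mu> * T t" by (simp add: T_def algebra_simps)
      finally show ?thesis .
    qed
    have "(\<delta> / 2) powr (p - 1) > 0" using \<delta> by simp
    then obtain \<rho>1 where \<rho>1: "\<rho>1 > 0"
      "\<And>x. norm x \<ge> \<rho>1 \<Longrightarrow> (norm x)\<^sup>2 * u x powr (p - 1) \<le> (\<delta> / 2) powr (p - 1)"
      using decay by blast
    have far: "u y < T (y \<bullet> y)" if y: "norm y \<ge> \<rho>1" for y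
    proof -
      have yp: "y \<bullet> y > 0" using y \<rho>1 by auto
      have "u y powr (p - 1) \<le> (\<delta> / 2) powr (p - 1) / (y \<bullet> y)"
        using \<rho>1(2)[OF y] yp by (simp add: field_simps power2_norm_eq_inner)
      then have "(u y powr (p - 1)) powr (1 / (p - 1)) \<le> ((\<delta> / 2) powr (p - 1) / (y \<bullet> y)) powr (1 / (p - 1))"
        using p by (intro powr_mono2) auto
      also have "(u y powr (p - 1)) powr (1 / (p - 1)) = u y"
        using p u_nonneg[of y] by (simp add: powr_powr)
      also have "((\<delta> / 2) powr (p - 1) / (y \<bullet> y)) powr (1 / (p - 1)) = \<delta> / 2 * (y \<bullet> y) powr (- b / 2)"
      proof -
        have "((\<delta> / 2) powr (p - 1) / (y \<bullet> y)) powr (1 / (p - 1))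
            = ((\<delta> / 2) powr (p - 1)) powr (1 / (p - 1)) / (y \<bullet> y) powr (1 / (p - 1))"
          by (rule powr_divide)
        moreover have "((\<delta> / 2) powr (p - 1)) powr (1 / (p - 1)) = \<delta> / 2"
          unfolding powr_powr using p \<delta> by simp
        moreover have "- b / 2 = - (1 / (p - 1))" using b(1) p by (simp add: field_simps)
        then have "(y \<bullet> y) powr (- b / 2) = 1 / (y \<bullet> y) powr (1 / (p - 1))"
          by (simp only: powr_minus_divide)
        ultimately show ?thesis by (simp only: times_divide_eq_right mult_1_right)
      qed
      finally have "u y \<le> \<delta> / 2 * (y \<bullet> y) powr (- b / 2)" .
      also have "\<dots> < \<delta> * (y \<bullet> y) powr (- b / 2)" using \<delta> yp by simp
      also have "\<dots> \<le> T (y \<bullet> y)" using C by (simp add: T_def)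
      finally show ?thesis .
    qed
    have bdry: "u y \<le> T (y \<bullet> y)" if "norm y = \<rho>" for y
    proof -
      have yy: "y \<bullet> y = \<rho> powr 2" using that \<rho> by (simp add: power2_norm_eq_inner[symmetric])
      have "(y \<bullet> y) powr (- a / 2) = \<rho> powr (- a)" unfolding yy powr_powr by simp
      then have "C * (y \<bullet> y) powr (- a / 2) = M"
        using \<rho>(1) by (simp add: C_def powr_minus)
      then show ?thesis using u_le[of y] \<delta> by (simp add: T_def add_increasing2)
    qed
    have x_far: "norm x < \<rho>1"
    proof (rule ccontr)
      assume "\<not> norm x < \<rho>1"
      with far[of x] neg show False by (simp add: T_def)
    qed
    define A where "A = {y::'a. \<rho> \<le> norm y \<and> norm y \<le> \<rho>1}"
    have "A = cball 0 \<rho>1 - ball 0 \<rho>" by (auto simp: A_def)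
    then have Ac: "compact A" by (simp add: compact_diff)
    have xA: "x \<in> A" using x2 x_far by (simp add: A_def)
    have cT: "continuous_on A (\<lambda>y. T (y \<bullet> y))"
      unfolding T_def by (intro continuous_intros) (use xx in \<open>auto simp: A_def\<close>)
    have "continuous_on A (\<lambda>y. u y / T (y \<bullet> y))"
      by (intro continuous_intros cT u_continuous) (use Tpos[OF xx] in \<open>auto simp: A_def less_imp_neq[THEN not_sym]\<close>)
    \<comment> \<open>A maximum of u - T would only give \<mu> T \<le> \<mu> u / 2, which is no
      contradiction. Maximising the quotient makes u = Z T at x3, so both sides are expressed by u
      there, and u - Z T still has a local maximum.\<close>
    then obtain x3 where x3: "x3 \<in> A" "\<And>y. y \<in> A \<Longrightarrow> u y / T (y \<bullet> y) \<le> u x3 / T (x3 \<bullet> x3)"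
      using continuous_attains_sup[OF Ac] xA by blast
    define Z where "Z = u x3 / T (x3 \<bullet> x3)"
    have x3r: "norm x3 \<ge> \<rho>" "norm x3 \<le> \<rho>1" using x3 by (auto simp: A_def)
    have Tp3: "T (x3 \<bullet> x3) > 0" using Tpos xx x3r by blast
    have "1 < u x / T (x \<bullet> x)"
      using neg Tpos[OF xx[OF x2]] by (simp add: T_def)
    then have Z1: "Z > 1" using x3(2)[OF xA] by (simp add: Z_def)
    then have uT: "u x3 > T (x3 \<bullet> x3)" using Tp3 by (simp add: Z_def)
    have "norm x3 \<noteq> \<rho>" using bdry[of x3] uT by linarith
    moreover have "norm x3 < \<rho>1" using far[of x3] uT by linarith
    ultimately have x3s: "\<rho> < norm x3" "norm x3 < \<rho>1" using x3r by auto
    define e where "e = min (norm x3 - \<rho>) (\<rho>1 - norm x3)"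
    have e: "e > 0" using x3s by (simp add: e_def)
    have inA: "y \<in> A" if "y \<in> ball x3 e" for y
      using that norm_triangle_ineq2[of x3 y] norm_triangle_ineq2[of y x3]
      by (auto simp: A_def e_def dist_norm norm_minus_commute)
    have pos: "y \<bullet> y > 0" if "y \<in> A" for y using that xx by (auto simp: A_def)
    have lap: "(\<Sum>b\<in>Basis. (DG x3 b - Z *\<^sub>R ((4 * T'' (x3 \<bullet> x3) * (x3 \<bullet> b)) *\<^sub>R x3
        + (2 * T' (x3 \<bullet> x3)) *\<^sub>R b)) \<bullet> b) \<le> 0"
    proof (rule laplacian_nonpos_at_local_max[where v = "\<lambda>y. u y - Z * T (y \<bullet> y)"
        and G = "\<lambda>y. G y - Z *\<^sub>R ((2 * T' (y \<bullet> y)) *\<^sub>R y)" and x = x3, OF e])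
      fix y assume y: "y \<in> ball x3 e"
      have "((\<lambda>y. Z * T (y \<bullet> y)) has_derivative (\<lambda>h. Z * (((2 * T' (y \<bullet> y)) *\<^sub>R y) \<bullet> h))) (at y)"
        by (rule has_derivative_mult_right[OF radial_has_derivative[where T = T and T' = T',
            OF dT(1)[OF pos[OF inA[OF y]]]]])
      from has_derivative_diff[OF du this]
      show "((\<lambda>y. u y - Z * T (y \<bullet> y)) has_derivative
          (\<lambda>h. (G y - Z *\<^sub>R ((2 * T' (y \<bullet> y)) *\<^sub>R y)) \<bullet> h)) (at y)"
        by (simp add: inner_diff_left mult.assoc)
      have "u y \<le> Z * T (y \<bullet> y)"
        using x3(2)[OF inA[OF y]] Tpos[OF pos[OF inA[OF y]]] by (simp add: Z_def pos_divide_le_eq)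
      then show "u y - Z * T (y \<bullet> y) \<le> u x3 - Z * T (x3 \<bullet> x3)"
        using Tp3 by (simp add: Z_def)
    next
      show "((\<lambda>y. G y - Z *\<^sub>R ((2 * T' (y \<bullet> y)) *\<^sub>R y)) has_derivative
        (\<lambda>h. DG x3 h - Z *\<^sub>R ((4 * T'' (x3 \<bullet> x3) * (x3 \<bullet> h)) *\<^sub>R x3 + (2 * T' (x3 \<bullet> x3)) *\<^sub>R h))) (at x3)"
        by (rule has_derivative_diff[OF dG has_derivative_scaleR_right[OF
          radial_gradient_has_derivative[where T' = T' and T'' = T'', OF dT(2)[OF pos[OF x3(1)]]]]])
    qed
    have "(\<Sum>b\<in>Basis. DG x3 b \<bullet> b) - Z * (\<Sum>b\<in>Basis. ((4 * T'' (x3 \<bullet> x3) * (x3 \<bullet> b)) *\<^sub>R x3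
        + (2 * T' (x3 \<bullet> x3)) *\<^sub>R b) \<bullet> b) \<le> 0"
      using lap by (simp only: inner_diff_left inner_scaleR_left sum_subtractf sum_distrib_left)
    then have "- f (u x3) \<le> Z * (4 * T'' (x3 \<bullet> x3) * (x3 \<bullet> x3) + 2 * T' (x3 \<bullet> x3) * N)"
      unfolding equation radial_laplacian N_def by simp
    then have "(x3 \<bullet> x3) * - f (u x3) \<le>
        (x3 \<bullet> x3) * (Z * (4 * T'' (x3 \<bullet> x3) * (x3 \<bullet> x3) + 2 * T' (x3 \<bullet> x3) * N))"
      by (intro mult_left_mono) auto
    also have "\<dots> = Z * ((x3 \<bullet> x3) * (4 * T'' (x3 \<bullet> x3) * (x3 \<bullet> x3) + 2 * T' (x3 \<bullet> x3) * N))" by simp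
    also have "\<dots> \<le> Z * (- \<mu> * T (x3 \<bullet> x3))"
      using Z1 lapT[OF pos[OF x3(1)]] by (intro mult_left_mono) auto
    also have "\<dots> = - \<mu> * u x3" using Tp3 by (simp add: Z_def)
    finally have "\<mu> * u x3 \<le> (x3 \<bullet> x3) * f (u x3)" by simp
    also have "\<dots> \<le> \<mu> / 2 * u x3" by (rule fsmall[OF x3r(1)])
    finally show False using \<mu>(1) uT Tp3 by simp
  qed
  have "u x \<le> C * (x \<bullet> x) powr (- a / 2)" if x: "norm x \<ge> \<rho>" for x
  proof (rule field_le_epsilon)
    fix e :: real assume e: "e > 0"
    \<comment> \<open>With \<delta> = e / w the second barrier term equals e at this x.\<close>
    define w where "w = (x \<bullet> x) powr (- b / 2)"
    have "w > 0" using xx[OF x] by (simp add: w_def)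
    then show "u x \<le> C * (x \<bullet> x) powr (- a / 2) + e"
      using main[of "e / w" x] x e by (simp add: w_def)
  qed
  then show ?thesis using C \<rho> by blast
qed

section \<open>The Pohozaev identity\<close>

text \<open>The equation is tested with \<open>T\<^sup>2 u\<close> and the mixed term is removed by
  completing a square. This bounds the energy of the gradient on annuli by u alone.\<close>

lemma caccioppoli_inequality:
  fixes T T' :: "real \<Rightarrow> real"
  assumes dT: "\<And>t. (T has_real_derivative T' t) (at t)" and cT': "continuous_on UNIV T'"
    and T0: "\<And>t. t \<ge> R2 \<Longrightarrow> T t = 0" "\<And>t. t \<ge> R2 \<Longrightarrow> T' t = 0"
  shows "(\<integral>x. (T (x \<bullet> x))\<^sup>2 * (G x \<bullet> G x) \<partial>lborel) \<le>
    (\<integral>x. 16 * (x \<bullet> x) * (T' (x \<bullet> x))\<^sup>2 * (u x)\<^sup>2 + 2 * (T (x \<bullet> x))\<^sup>2 * (u x * f (u x)) \<partial>lborel)"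
    and "integrable lborel (\<lambda>x. (T (x \<bullet> x))\<^sup>2 * (G x \<bullet> G x))"
proof -
  have cTx: "continuous_on S (\<lambda>x::'a. T (x \<bullet> x))" "continuous_on S (\<lambda>x::'a. T' (x \<bullet> x))" for S
    by (intro continuous_on_radial continuous_on_of_DERIV[OF dT] cT')+
  define \<rho> where "\<rho> = max 1 \<bar>R2\<bar>"
  have far: "T (x \<bullet> x) = 0" "T' (x \<bullet> x) = 0" if "norm x \<ge> \<rho>" for x :: 'a
    using norm_ge_imp_inner_ge[of R2 x] that T0 by (auto simp: \<rho>_def)
  define P where "P x = (T (x \<bullet> x))\<^sup>2 * (G x \<bullet> G x)" for x
  define Y where "Y x = 16 * (x \<bullet> x) * (T' (x \<bullet> x))\<^sup>2 * (u x)\<^sup>2 + 2 * (T (x \<bullet> x))\<^sup>2 * (u x * f (u x))" for x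
  define Z where "Z x = P x + 4 * (T (x \<bullet> x) * T' (x \<bullet> x)) * u x * (x \<bullet> G x)
     - (T (x \<bullet> x))\<^sup>2 * (u x * f (u x))" for x
  have iP: "integrable lborel P"
    unfolding P_def
    by (rule continuous_compact_support_integrable[of _ \<rho>], intro continuous_intros cTx G_continuous) (simp add: far)
  have iY: "integrable lborel Y"
    unfolding Y_def
    by (rule continuous_compact_support_integrable[of _ \<rho>], intro continuous_intros cTx u_continuous fu_continuous) (simp add: far)
  have dT2: "((\<lambda>t. (T t)\<^sup>2) has_real_derivative 2 * (T t * T' t)) (at t)" for t
    by (auto intro!: derivative_eq_intros dT simp: power2_eq_square)
  note radT2 = radial_has_derivative[where T = "\<lambda>t. (T t)\<^sup>2" and T' = "\<lambda>t. 2 * (T t * T' t)", OF dT2]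
  have Z: "(\<integral>x. Z x \<partial>lborel) = 0" "integrable lborel Z"
  proof -
    define D where "D x h = (T (x \<bullet> x))\<^sup>2 * (G x \<bullet> h)
      + ((2 * (2 * (T (x \<bullet> x) * T' (x \<bullet> x)))) *\<^sub>R x \<bullet> h) * u x" for x h
    have dD: "((\<lambda>x. (T (x \<bullet> x))\<^sup>2 * u x) has_derivative D x) (at x)" for x
      unfolding D_def by (rule has_derivative_mult[OF radT2 du])
    have cD: "continuous_on UNIV (\<lambda>x. D x b)" for b
      unfolding D_def by (intro continuous_intros cTx u_continuous G_continuous)
    have "D x (G x) + (T (x \<bullet> x))\<^sup>2 * u x * (\<Sum>b\<in>Basis. DG x b \<bullet> b) = Z x" for x
      unfolding equation D_def Z_def P_def by (simp add: algebra_simps)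
    then show "(\<integral>x. Z x \<partial>lborel) = 0" "integrable lborel Z"
      using integral_divergence_eq_0[OF dD dG cD DG_continuous, of \<rho>] far by auto
  qed
  have "(\<integral>x. P x \<partial>lborel) = (\<integral>x. 2 * P x - 2 * Z x \<partial>lborel) - (\<integral>x. P x \<partial>lborel)"
    using Z iP by simp
  also have "\<dots> = (\<integral>x. (2 * P x - 2 * Z x) - P x \<partial>lborel)"
    using Z iP by simp
  also have "\<dots> \<le> (\<integral>x. Y x \<partial>lborel)"
  proof (rule Bochner_Integration.integral_mono)
    fix x :: 'a
    define t t' where "t = T (x \<bullet> x)" and "t' = T' (x \<bullet> x)"
    \<comment> \<open>Y minus the integrand P - 2 Z is exactly \<open>V \<bullet> V\<close>.\<close>
    define V where "V = t *\<^sub>R G x + (4 * t' * u x) *\<^sub>R x"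
    have "0 \<le> V \<bullet> V" by simp
    also have "V \<bullet> V = t\<^sup>2 * (G x \<bullet> G x) + 8 * (t * t') * u x * (x \<bullet> G x) + 16 * (x \<bullet> x) * t'\<^sup>2 * (u x)\<^sup>2"
      by (simp add: V_def inner_add_left inner_add_right inner_commute power2_eq_square algebra_simps)
    finally show "2 * P x - 2 * Z x - P x \<le> Y x"
      unfolding P_def Y_def Z_def t_def[symmetric] t'_def[symmetric] by (simp add: algebra_simps)
  qed (use Z iP iY in auto)
  finally show "(\<integral>x. (T (x \<bullet> x))\<^sup>2 * (G x \<bullet> G x) \<partial>lborel) \<le>
    (\<integral>x. 16 * (x \<bullet> x) * (T' (x \<bullet> x))\<^sup>2 * (u x)\<^sup>2 + 2 * (T (x \<bullet> x))\<^sup>2 * (u x * f (u x)) \<partial>lborel)"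
    by (simp add: P_def Y_def)
  show "integrable lborel (\<lambda>x. (T (x \<bullet> x))\<^sup>2 * (G x \<bullet> G x))" using iP by (simp add: P_def[abs_def])
qed

text \<open>The sum of the divergences of \<open>T (x \<bullet> G) G\<close>,
  \<open>T (F(u) - |G|\<^sup>2 / 2) x\<close> and (N - 2) / 2 times \<open>T u G\<close>. The
  Hessian terms cancel by symmetry, and the third coefficient is the one with 1 - N / 2 + (N - 2) /
  2 = 0, which removes \<open>T |G|\<^sup>2\<close>. X collects the terms with T' and so lives only
  where T varies.\<close>

lemma pohozaev_identity:
  fixes T T' F :: "real \<Rightarrow> real"
  assumes dT: "\<And>t. (T has_real_derivative T' t) (at t)" and cT': "continuous_on UNIV T'"
    and T0: "\<And>t. t \<ge> R2 \<Longrightarrow> T t = 0" "\<And>t. t \<ge> R2 \<Longrightarrow> T' t = 0"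
    and dF: "\<And>s. s \<ge> 0 \<Longrightarrow> (F has_real_derivative f s) (at s)"
  defines "N \<equiv> real DIM('a)"
  defines "X \<equiv> \<lambda>x. 2 * T' (x \<bullet> x) * ((x \<bullet> G x)\<^sup>2 + (x \<bullet> x) * (F (u x) - (G x \<bullet> G x) / 2)
      + (N - 2) / 2 * u x * (x \<bullet> G x))"
  shows "(\<integral>x. T (x \<bullet> x) * ((N - 2) / 2 * (u x * f (u x)) - N * F (u x)) \<partial>lborel) = (\<integral>x. X x \<partial>lborel)"
    and "integrable lborel X"
    and "integrable lborel (\<lambda>x. T (x \<bullet> x) * ((N - 2) / 2 * (u x * f (u x)) - N * F (u x)))"
proof -
  have cTx: "continuous_on S (\<lambda>x::'a. T (x \<bullet> x))" "continuous_on S (\<lambda>x::'a. T' (x \<bullet> x))" for S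
    by (intro continuous_on_radial continuous_on_of_DERIV[OF dT] cT')+
  define \<rho> where "\<rho> = max 1 \<bar>R2\<bar>"
  have far: "T (x \<bullet> x) = 0" "T' (x \<bullet> x) = 0" if "norm x \<ge> \<rho>" for x :: 'a
    using norm_ge_imp_inner_ge[of R2 x] that T0 by (auto simp: \<rho>_def)
  note radT = radial_has_derivative[where T = T and T' = T', OF dT]
  note dFu = has_derivative_comp_u[OF dF[OF u_nonneg]]
  have cFu: "continuous_on S (\<lambda>x. F (u x))" for S by (rule continuous_on_of_has_derivative[OF dFu])
  have sym: "DG x h \<bullet> k = DG x k \<bullet> h" for x h k
    by (rule second_derivative_symmetric[OF du dG DG_continuous DG_continuous])
  define B where "B x = T (x \<bullet> x) * (N * F (u x) - (N - 2) / 2 * (u x * f (u x))) + X x" for x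
  define B1 where "B1 x = T (x \<bullet> x) * (G x \<bullet> G x + x \<bullet> DG x (G x)) + 2 * T' (x \<bullet> x) * (x \<bullet> G x)\<^sup>2
     - T (x \<bullet> x) * (x \<bullet> G x) * f (u x)" for x
  define B2 where "B2 x = T (x \<bullet> x) * (f (u x) * (G x \<bullet> x) - G x \<bullet> DG x x)
     + 2 * T' (x \<bullet> x) * (x \<bullet> x) * (F (u x) - (G x \<bullet> G x) / 2)
     + N * T (x \<bullet> x) * (F (u x) - (G x \<bullet> G x) / 2)" for x
  define B3 where "B3 x = T (x \<bullet> x) * (G x \<bullet> G x) + 2 * T' (x \<bullet> x) * (x \<bullet> G x) * u x
     - T (x \<bullet> x) * u x * f (u x)" for x
  have B1: "(\<integral>x. B1 x \<partial>lborel) = 0" "integrable lborel B1"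
  proof -
    define D where "D x h = T (x \<bullet> x) * (x \<bullet> DG x h + h \<bullet> G x)
      + ((2 * T' (x \<bullet> x)) *\<^sub>R x \<bullet> h) * (x \<bullet> G x)" for x h
    have dD: "((\<lambda>x. T (x \<bullet> x) * (x \<bullet> G x)) has_derivative D x) (at x)" for x
      unfolding D_def by (rule has_derivative_mult[OF radT has_derivative_inner[OF has_derivative_ident dG]])
    have cD: "continuous_on UNIV (\<lambda>x. D x b)" for b
      unfolding D_def by (intro continuous_intros cTx DG_continuous G_continuous)
    have "D x (G x) + T (x \<bullet> x) * (x \<bullet> G x) * (\<Sum>b\<in>Basis. DG x b \<bullet> b) = B1 x" for x
      unfolding equation D_def B1_def by (simp add: power2_eq_square algebra_simps)
    then show "(\<integral>x. B1 x \<partial>lborel) = 0" "integrable lborel B1"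
      using integral_divergence_eq_0[OF dD dG cD DG_continuous, of \<rho>] far by auto
  qed
  have B2: "(\<integral>x. B2 x \<partial>lborel) = 0" "integrable lborel B2"
  proof -
    define D where "D x h = T (x \<bullet> x) * (f (u x) * (G x \<bullet> h) - (G x \<bullet> DG x h + DG x h \<bullet> G x) / 2)
      + ((2 * T' (x \<bullet> x)) *\<^sub>R x \<bullet> h) * (F (u x) - (G x \<bullet> G x) / 2)" for x h
    have "((\<lambda>x. (G x \<bullet> G x) / 2) has_derivative (\<lambda>h. (G x \<bullet> DG x h + DG x h \<bullet> G x) / 2)) (at x)" for x
      using has_derivative_mult_right[OF has_derivative_inner[OF dG dG], of "1 / 2" x] by simp
    then have dD: "((\<lambda>x. T (x \<bullet> x) * (F (u x) - (G x \<bullet> G x) / 2)) has_derivative D x) (at x)" for x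
      unfolding D_def by (rule has_derivative_mult[OF radT has_derivative_diff[OF dFu]])
    have cD: "continuous_on UNIV (\<lambda>x. D x b)" for b
      unfolding D_def by (intro continuous_intros cTx DG_continuous G_continuous fu_continuous cFu) auto
    have N: "(\<Sum>b\<in>(Basis::'a set). b \<bullet> b) = N" by (simp add: N_def inner_Basis)
    have "D x x + T (x \<bullet> x) * (F (u x) - (G x \<bullet> G x) / 2) * (\<Sum>b\<in>(Basis::'a set). b \<bullet> b) = B2 x" for x
      unfolding N D_def B2_def by (simp add: inner_commute algebra_simps)
    then show "(\<integral>x. B2 x \<partial>lborel) = 0" "integrable lborel B2"
      using integral_divergence_eq_0[OF dD has_derivative_ident cD continuous_on_const, of \<rho>] far by auto
  qed
  have B3: "(\<integral>x. B3 x \<partial>lborel) = 0" "integrable lborel B3"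
  proof -
    define D where "D x h = T (x \<bullet> x) * (G x \<bullet> h) + ((2 * T' (x \<bullet> x)) *\<^sub>R x \<bullet> h) * u x" for x h
    have dD: "((\<lambda>x. T (x \<bullet> x) * u x) has_derivative D x) (at x)" for x
      unfolding D_def by (rule has_derivative_mult[OF radT du])
    have cD: "continuous_on UNIV (\<lambda>x. D x b)" for b
      unfolding D_def by (intro continuous_intros cTx u_continuous G_continuous)
    have "D x (G x) + T (x \<bullet> x) * u x * (\<Sum>b\<in>Basis. DG x b \<bullet> b) = B3 x" for x
      unfolding equation D_def B3_def by (simp add: algebra_simps)
    then show "(\<integral>x. B3 x \<partial>lborel) = 0" "integrable lborel B3"
      using integral_divergence_eq_0[OF dD dG cD DG_continuous, of \<rho>] far by auto
  qed
  have "B x = B1 x + B2 x + (N - 2) / 2 * B3 x" for x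
    using sym[of x "G x" x]
    by (simp add: B_def B1_def B2_def B3_def X_def inner_commute field_simps)
  then have Beq: "B = (\<lambda>x. B1 x + B2 x + (N - 2) / 2 * B3 x)" by blast
  have B: "(\<integral>x. B x \<partial>lborel) = 0" "integrable lborel B"
    unfolding Beq using B1 B2 B3 by simp_all
  show iX: "integrable lborel X"
    unfolding X_def
    by (rule continuous_compact_support_integrable[of _ \<rho>], intro continuous_intros cTx u_continuous fu_continuous cFu G_continuous)
      (simp_all add: far)
  show "integrable lborel (\<lambda>x. T (x \<bullet> x) * ((N - 2) / 2 * (u x * f (u x)) - N * F (u x)))"
    by (rule continuous_compact_support_integrable[of _ \<rho>], intro continuous_intros cTx u_continuous fu_continuous cFu)
      (simp_all add: far)
  have "(\<integral>x. T (x \<bullet> x) * ((N - 2) / 2 * (u x * f (u x)) - N * F (u x)) \<partial>lborel)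
      = (\<integral>x. X x - B x \<partial>lborel)"
    by (rule Bochner_Integration.integral_cong) (auto simp: B_def algebra_simps)
  also have "\<dots> = (\<integral>x. X x \<partial>lborel)" using iX B by simp
  finally show "(\<integral>x. T (x \<bullet> x) * ((N - 2) / 2 * (u x * f (u x)) - N * F (u x)) \<partial>lborel) = (\<integral>x. X x \<partial>lborel)" .
qed

text \<open>For supercritical p the number \<kappa> = (N - 2) / 2 - N / (p + 1) is positive, and the
  left side of the Pohozaev identity dominates \<kappa> times the integral of u f(u) over large
  balls. The right side lives where r^2 \<le> |x|^2 \<le> 2 r^2; with u^2 = O(r^(-2a)) and the
  gradient bounded by the Caccioppoli inequality it is O(r^(N-2-2a)).\<close>

lemma vanishing_of_fast_decay:
  fixes F :: "real \<Rightarrow> real" and p a C0 \<rho> :: real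
  assumes p: "p > 1" and Cf: "Cf > 0" and fb: "\<And>s. 0 \<le> s \<Longrightarrow> s \<le> M \<Longrightarrow> f s \<le> Cf * s powr p"
    and f0: "\<And>s. s \<ge> 0 \<Longrightarrow> f s \<ge> 0"
    and dF: "\<And>s. s \<ge> 0 \<Longrightarrow> (F has_real_derivative f s) (at s)"
    and F0: "\<And>s. s \<ge> 0 \<Longrightarrow> F s \<ge> 0" and Fle: "\<And>s. s \<ge> 0 \<Longrightarrow> (p + 1) * F s \<le> s * f s"
    and N: "real DIM('a) > 2" "p > (real DIM('a) + 2) / (real DIM('a) - 2)"
    and C0: "C0 > 0" and \<rho>: "\<rho> > 0"
    and dec: "\<And>x. norm x \<ge> \<rho> \<Longrightarrow> u x \<le> C0 * (x \<bullet> x) powr (- a / 2)"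
      "\<And>x. norm x \<ge> \<rho> \<Longrightarrow> (norm x)\<^sup>2 * u x powr (p - 1) \<le> 1"
    and a: "2 * a > real DIM('a) - 2"
  shows "u x * f (u x) = 0"
proof (rule ccontr)
  assume x0: "u x * f (u x) \<noteq> 0"
  define N where "N = real DIM('a)"
  have N2: "N > 2" and a0: "a > 0" using N a by (auto simp: N_def)
  define \<kappa> where "\<kappa> = (N - 2) / 2 - N / (p + 1)"
  have \<kappa>: "\<kappa> > 0"
  proof -
    have "N + 2 < p * (N - 2)" using N by (simp add: N_def field_simps)
    then have "2 * N < (N - 2) * (p + 1)" by (simp add: algebra_simps)
    then show ?thesis using p by (simp add: \<kappa>_def field_simps)
  qed
  define w where "w y = u y * f (u y)" for y
  have w0: "w y \<ge> 0" for y unfolding w_def by (intro mult_nonneg_nonneg u_nonneg f0)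
  have wx: "w x > 0" using x0 w0[of x] unfolding w_def by linarith
  have cw: "continuous_on UNIV w" unfolding w_def by (intro continuous_intros u_continuous fu_continuous)
  have Fw: "F (u y) \<le> w y / (p + 1)" for y
    using Fle[OF u_nonneg[of y]] p by (simp add: w_def field_simps)
  have Fw1: "F (u y) \<le> w y" for y
  proof -
    have "w y / (p + 1) \<le> w y" using w0[of y] p by (simp add: divide_le_eq mult_le_cancel_left1)
    then show ?thesis using Fw[of y] by linarith
  qed
  have lowerw: "\<kappa> * w y \<le> (N - 2) / 2 * w y - N * F (u y)" for y
  proof -
    have "N * F (u y) \<le> N * (w y / (p + 1))" using Fw[of y] N2 by (intro mult_left_mono) auto
    moreover have "\<kappa> * w y = (N - 2) / 2 * w y - N * (w y / (p + 1))"
      by (simp add: \<kappa>_def left_diff_distrib)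
    ultimately show ?thesis by linarith
  qed
  obtain S S' S'' :: "real \<Rightarrow> real" where
    dS: "\<And>t. (S has_real_derivative S' t) (at t)" "\<And>t. (S' has_real_derivative S'' t) (at t)"
    and S1: "\<And>t. t \<le> 1 \<Longrightarrow> S t = 1" and S0: "\<And>t. t \<ge> 2 \<Longrightarrow> S t = 0"
    and S01: "\<And>t. 0 \<le> S t" "\<And>t. S t \<le> 1"
    by (rule power_cutoff_exists[of 1 0]) (simp, simp, simp, blast)
  have cS: "continuous_on A S" "continuous_on A S'" for A
    using continuous_on_of_DERIV[OF dS(1)] continuous_on_of_DERIV[OF dS(2)] by blast+
  have S'1: "S' t = 0" if "t < 1" for t
    by (rule DERIV_zero_of_locally_constant[OF dS(1), of "{..<1}"]) (use that S1 in auto)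
  have S'2: "S' t = 0" if "t > 2" for t
    by (rule DERIV_zero_of_locally_constant[OF dS(1), of "{2<..}"]) (use that S0 in auto)
  \<comment> \<open>Annular cutoff for the Caccioppoli inequality: 1 on [1/2, 2], which contains the
    layer [1, 2] outside which S' vanishes, and 0 outside [1/4, 4].\<close>
  define \<Phi> where "\<Phi> t = S (t / 2) * (1 - S (4 * t))" for t
  define \<Phi>' where "\<Phi>' t = S' (t / 2) / 2 * (1 - S (4 * t)) - 4 * S' (4 * t) * S (t / 2)" for t
  have d\<Phi>: "(\<Phi> has_real_derivative \<Phi>' t) (at t)" for t
  proof -
    have h1: "((\<lambda>t. S (t / 2)) has_real_derivative S' (t / 2) * (1 / 2)) (at t)"
      by (rule DERIV_chain2[OF dS(1)]) (auto intro!: derivative_eq_intros)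
    have "((\<lambda>t. S (4 * t)) has_real_derivative S' (4 * t) * 4) (at t)"
      by (rule DERIV_chain2[OF dS(1)]) (auto intro!: derivative_eq_intros)
    then have h2: "((\<lambda>t. 1 - S (4 * t)) has_real_derivative 0 - S' (4 * t) * 4) (at t)"
      by (intro DERIV_diff DERIV_const)
    have "S' (t / 2) * (1 / 2) * (1 - S (4 * t)) + (0 - S' (4 * t) * 4) * S (t / 2) = \<Phi>' t"
      by (simp add: \<Phi>'_def)
    with DERIV_mult[OF h1 h2] show ?thesis unfolding \<Phi>_def by simp
  qed
  have c\<Phi>': "continuous_on A \<Phi>'" for A
    unfolding \<Phi>'_def
    by (intro continuous_intros continuous_on_compose2[OF cS(1)[of UNIV]] continuous_on_compose2[OF cS(2)[of UNIV]]) auto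
  have \<Phi>1: "\<Phi> t = 1" if "1 / 2 \<le> t" "t \<le> 2" for t
    using S1[of "t / 2"] S0[of "4 * t"] that by (simp add: \<Phi>_def)
  have \<Phi>0: "\<Phi> t = 0" "\<Phi>' t = 0" if "t < 1 / 4 \<or> t > 4" for t
    using S1[of "4 * t"] S'1[of "4 * t"] S0[of "t / 2"] S'2[of "t / 2"] that by (auto simp: \<Phi>_def \<Phi>'_def)
  have \<Phi>01: "0 \<le> \<Phi> t" "\<Phi> t \<le> 1" for t
    using S01 by (auto simp: \<Phi>_def intro: mult_le_one)
  have "bounded (S' ` {1..2})" "bounded (\<Phi>' ` {1 / 4..4})"
    by (intro compact_imp_bounded compact_continuous_image cS c\<Phi>' compact_Icc)+
  then obtain b1 b2 where b1: "\<forall>t\<in>{1..2}. \<bar>S' t\<bar> \<le> b1" and b2: "\<forall>t\<in>{1 / 4..4}. \<bar>\<Phi>' t\<bar> \<le> b2"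
    unfolding bounded_iff by auto
  have b10: "b1 \<ge> 0" using b1[rule_format, of 1] by auto
  define K1 where "K1 = 64 * b2\<^sup>2 + 8 * Cf"
  define K2 where "K2 = 2 * b1 * (3 + (N - 2) / 2)"
  define K3 where "K3 = 2 * b1 * (8 * Cf + (N - 2) / 4)"
  \<comment> \<open>Bound for u^2 at |y| \<ge> r / 2, the inner radius of the annular
    cutoff.\<close>
  define U where "U r = C0\<^sup>2 * (r\<^sup>2 / 4) powr (- a)" for r :: real
  have K0: "K1 \<ge> 0" "K2 \<ge> 0" "K3 \<ge> 0" using Cf b10 N2 by (auto simp: K1_def K2_def K3_def)
  have U0: "U r \<ge> 0" for r by (simp add: U_def)
  define vol where "vol r = measure lborel (cball (0::'a) (2 * r))" for r
  have ind: "integrable lborel (\<lambda>x. indicator (cball (0::'a) s) x :: real)" for s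
    by (intro integrable_indicator_bounded) auto
  have key: "(\<integral>y. S ((y \<bullet> y) / r\<^sup>2) * (\<kappa> * w y) \<partial>lborel) \<le> (K2 * K1 + K3) * (U r / r\<^sup>2) * vol r"
    if r: "r \<ge> 2 * \<rho>" for r
  proof -
    have r0: "r > 0" using r \<rho> by simp
    have uU: "(u y)\<^sup>2 \<le> U r" and wU: "w y \<le> 4 * Cf * U r / r\<^sup>2" if y: "y \<bullet> y \<ge> r\<^sup>2 / 4" for y
    proof -
      have "(r / 2)\<^sup>2 \<le> (norm y)\<^sup>2" using y by (simp add: power2_norm_eq_inner power_divide)
      then have "r / 2 \<le> norm y" by (rule power2_le_imp_le) simp
      then have ny: "norm y \<ge> \<rho>" using r by simp
      have yp: "y \<bullet> y > 0" using ny \<rho> by auto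
      have "(u y)\<^sup>2 \<le> (C0 * (y \<bullet> y) powr (- a / 2))\<^sup>2"
        by (intro power_mono dec ny u_nonneg)
      also have "\<dots> = C0\<^sup>2 * (y \<bullet> y) powr (- a)"
        using yp by (simp add: power_mult_distrib powr_power)
      also have "\<dots> \<le> U r"
        unfolding U_def using y r0 a0 by (intro mult_left_mono powr_mono2') auto
      finally show uU: "(u y)\<^sup>2 \<le> U r" .
      \<comment> \<open>The slower decay makes this power of u O(r^-2), so u f(u) is of the same
        order as U / r^2, to which the gradient terms are compared.\<close>
      have "u y powr (p - 1) \<le> 1 / (y \<bullet> y)"
        using dec(2)[OF ny] yp by (simp add: field_simps power2_norm_eq_inner)
      also have "\<dots> \<le> 1 / (r\<^sup>2 / 4)" using y r0 yp by (intro divide_left_mono) auto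
      finally have up: "u y powr (p - 1) \<le> 4 / r\<^sup>2" by simp
      have "w y \<le> u y * (Cf * u y powr p)"
        unfolding w_def by (intro mult_left_mono fb u_nonneg u_le)
      also have "\<dots> = Cf * ((u y)\<^sup>2 * u y powr (p - 1))"
        using u_nonneg[of y] p by (cases "u y = 0") (auto simp: powr_diff power2_eq_square)
      also have "\<dots> \<le> Cf * (U r * (4 / r\<^sup>2))"
        using Cf up uU U0 by (intro mult_left_mono mult_mono) auto
      finally show "w y \<le> 4 * Cf * U r / r\<^sup>2" by (simp add: ac_simps)
    qed
    have nb: "norm y \<le> 2 * r" if "y \<bullet> y \<le> 4 * r\<^sup>2" for y :: 'a
    proof -
      have "(norm y)\<^sup>2 \<le> (2 * r)\<^sup>2" using that by (simp add: power2_norm_eq_inner power_mult_distrib)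
      then show ?thesis by (rule power2_le_imp_le) (use r0 in simp)
    qed
    define Ta where "Ta t = \<Phi> (t / r\<^sup>2)" for t
    define Ta' where "Ta' t = \<Phi>' (t / r\<^sup>2) / r\<^sup>2" for t
    have lin: "((\<lambda>t. t / r\<^sup>2) has_real_derivative 1 / r\<^sup>2) (at t)" for t
      by (rule DERIV_cdivide[OF DERIV_ident])
    have dTa: "(Ta has_real_derivative Ta' t) (at t)" for t
      using DERIV_chain2[OF d\<Phi> lin] unfolding Ta_def Ta'_def by simp
    have cTa': "continuous_on UNIV Ta'"
      unfolding Ta'_def using r0 by (intro continuous_intros continuous_on_compose2[OF c\<Phi>'[of UNIV]]) auto
    have r2: "0 < r\<^sup>2" using r0 by simp
    have Ta0: "Ta t = 0" "Ta' t = 0" if "t \<ge> 5 * r\<^sup>2" for t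
    proof -
      have "4 * r\<^sup>2 < t" using that r2 by linarith
      then have "t / r\<^sup>2 > 4" using r2 by (simp add: pos_less_divide_eq)
      then show "Ta t = 0" "Ta' t = 0" using \<Phi>0[of "t / r\<^sup>2"] by (auto simp: Ta_def Ta'_def)
    qed
    define P where "P = (\<integral>x. (Ta (x \<bullet> x))\<^sup>2 * (G x \<bullet> G x) \<partial>lborel)"
    note cacc = caccioppoli_inequality[OF dTa cTa' Ta0]
    have Pb: "P \<le> K1 * (U r / r\<^sup>2) * vol r"
    proof -
      note cacc(1)
      also have "(\<integral>x. 16 * (x \<bullet> x) * (Ta' (x \<bullet> x))\<^sup>2 * (u x)\<^sup>2
          + 2 * (Ta (x \<bullet> x))\<^sup>2 * (u x * f (u x)) \<partial>lborel)
        \<le> (\<integral>y. K1 * (U r / r\<^sup>2) * indicator (cball 0 (2 * r)) (y::'a) \<partial>lborel)"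
      proof (rule integral_mono')
        fix y :: 'a
        define t where "t = y \<bullet> y"
        have t0: "t \<ge> 0" by (simp add: t_def)
        show "16 * (y \<bullet> y) * (Ta' (y \<bullet> y))\<^sup>2 * (u y)\<^sup>2 + 2 * (Ta (y \<bullet> y))\<^sup>2 * (u y * f (u y))
          \<le> K1 * (U r / r\<^sup>2) * indicator (cball 0 (2 * r)) y"
          unfolding t_def[symmetric]
        proof (cases "r\<^sup>2 / 4 \<le> t \<and> t \<le> 4 * r\<^sup>2")
          case True
          then have tr: "1 / 4 \<le> t / r\<^sup>2" "t / r\<^sup>2 \<le> 4" using r0 by (simp_all add: field_simps)
          have "(\<Phi>' (t / r\<^sup>2))\<^sup>2 \<le> b2\<^sup>2"
            using b2 tr by (metis abs_ge_zero atLeastAtMost_iff power2_abs power_mono)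
          then have "(t / r\<^sup>2) * (\<Phi>' (t / r\<^sup>2))\<^sup>2 \<le> 4 * b2\<^sup>2"
            using tr t0 by (intro mult_mono) auto
          then have "16 * ((t / r\<^sup>2) * (\<Phi>' (t / r\<^sup>2))\<^sup>2) \<le> 16 * (4 * b2\<^sup>2)"
            by (rule mult_left_mono) simp
          then have "16 * ((t / r\<^sup>2) * (\<Phi>' (t / r\<^sup>2))\<^sup>2) * (u y)\<^sup>2 \<le> 16 * (4 * b2\<^sup>2) * U r"
            by (rule mult_mono) (use uU[of y] True in \<open>auto simp: t_def\<close>)
          then have "16 * ((t / r\<^sup>2) * (\<Phi>' (t / r\<^sup>2))\<^sup>2) * (u y)\<^sup>2 / r\<^sup>2 \<le> 16 * (4 * b2\<^sup>2) * U r / r\<^sup>2"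
            by (rule divide_right_mono) simp
          moreover have "16 * t * (Ta' t)\<^sup>2 * (u y)\<^sup>2 = 16 * ((t / r\<^sup>2) * (\<Phi>' (t / r\<^sup>2))\<^sup>2) * (u y)\<^sup>2 / r\<^sup>2"
            using r0 by (simp add: Ta'_def power2_eq_square)
          moreover have "2 * (Ta t)\<^sup>2 * (u y * f (u y)) \<le> 2 * 1 * (4 * Cf * U r / r\<^sup>2)"
            using wU[of y] True \<Phi>01 w0[of y]
            by (intro mult_mono) (auto simp: t_def Ta_def w_def power_le_one)
          ultimately show "16 * t * (Ta' t)\<^sup>2 * (u y)\<^sup>2 + 2 * (Ta t)\<^sup>2 * (u y * f (u y))
            \<le> K1 * (U r / r\<^sup>2) * indicator (cball 0 (2 * r)) y"
            using nb[of y] True by (simp add: t_def K1_def algebra_simps)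
        next
          case False
          then have "t / r\<^sup>2 < 1 / 4 \<or> t / r\<^sup>2 > 4" using r0 by (auto simp: field_simps)
          then have "Ta t = 0" "Ta' t = 0" using \<Phi>0[of "t / r\<^sup>2"] by (auto simp: Ta_def Ta'_def)
          then show "16 * t * (Ta' t)\<^sup>2 * (u y)\<^sup>2 + 2 * (Ta t)\<^sup>2 * (u y * f (u y))
            \<le> K1 * (U r / r\<^sup>2) * indicator (cball 0 (2 * r)) y"
            using K0 U0 by simp
        qed
      qed (use ind K0 U0 in auto)
      finally show ?thesis by (simp add: vol_def P_def)
    qed
    define T where "T t = S (t / r\<^sup>2)" for t
    define T' where "T' t = S' (t / r\<^sup>2) / r\<^sup>2" for t
    have dT: "(T has_real_derivative T' t) (at t)" for t
      using DERIV_chain2[OF dS(1) lin] unfolding T_def T'_def by simp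
    have cT': "continuous_on UNIV T'"
      unfolding T'_def using r0 by (intro continuous_intros continuous_on_compose2[OF cS(2)[of UNIV]]) auto
    have T0: "T t = 0" "T' t = 0" if "t \<ge> 3 * r\<^sup>2" for t
    proof -
      have "2 * r\<^sup>2 < t" using that r2 by linarith
      then have "t / r\<^sup>2 > 2" using r2 by (simp add: pos_less_divide_eq)
      then show "T t = 0" "T' t = 0" using S0[of "t / r\<^sup>2"] S'2[of "t / r\<^sup>2"] by (auto simp: T_def T'_def)
    qed
    note poh = pohozaev_identity[OF dT cT' T0 dF, folded N_def]
    have "(\<integral>y. S ((y \<bullet> y) / r\<^sup>2) * (\<kappa> * w y) \<partial>lborel)
      \<le> (\<integral>y. T (y \<bullet> y) * ((N - 2) / 2 * (u y * f (u y)) - N * F (u y)) \<partial>lborel)"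
    proof (rule integral_mono'[OF poh(3)])
      fix y :: 'a
      show "S ((y \<bullet> y) / r\<^sup>2) * (\<kappa> * w y) \<le> T (y \<bullet> y) * ((N - 2) / 2 * (u y * f (u y)) - N * F (u y))"
        using lowerw[of y] S01 unfolding T_def w_def by (intro mult_left_mono) auto
      have "0 \<le> \<kappa> * w y" using \<kappa> w0 by simp
      also note lowerw[of y]
      finally show "0 \<le> T (y \<bullet> y) * ((N - 2) / 2 * (u y * f (u y)) - N * F (u y))"
        using S01 unfolding T_def w_def by simp
    qed
    also note poh(1)
    also have "(\<integral>x. 2 * T' (x \<bullet> x) * ((x \<bullet> G x)\<^sup>2 + (x \<bullet> x) * (F (u x) - (G x \<bullet> G x) / 2)
        + (N - 2) / 2 * u x * (x \<bullet> G x)) \<partial>lborel)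
      \<le> (\<integral>y. K2 * ((Ta (y \<bullet> y))\<^sup>2 * (G y \<bullet> G y)) + K3 * (U r / r\<^sup>2) * indicator (cball 0 (2 * r)) y \<partial>lborel)"
    proof (rule Bochner_Integration.integral_mono[OF poh(2)])
      fix y :: 'a
      define t where "t = y \<bullet> y"
      define g where "g = G y \<bullet> G y"
      have t0: "t \<ge> 0" "g \<ge> 0" by (simp_all add: t_def g_def)
      define Z where "Z = (y \<bullet> G y)\<^sup>2 + t * (F (u y) - g / 2) + (N - 2) / 2 * u y * (y \<bullet> G y)"
      show "2 * T' (y \<bullet> y) * ((y \<bullet> G y)\<^sup>2 + (y \<bullet> y) * (F (u y) - (G y \<bullet> G y) / 2)
        + (N - 2) / 2 * u y * (y \<bullet> G y))
        \<le> K2 * ((Ta (y \<bullet> y))\<^sup>2 * (G y \<bullet> G y)) + K3 * (U r / r\<^sup>2) * indicator (cball 0 (2 * r)) y"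
        unfolding t_def[symmetric] g_def[symmetric] unfolding Z_def[symmetric]
      proof (cases "r\<^sup>2 \<le> t \<and> t \<le> 2 * r\<^sup>2")
        case False
        then have "t / r\<^sup>2 < 1 \<or> t / r\<^sup>2 > 2" using r0 by (auto simp: field_simps)
        then have "T' t = 0" using S'1 S'2 by (auto simp: T'_def)
        then show "2 * T' t * Z \<le> K2 * ((Ta t)\<^sup>2 * g) + K3 * (U r / r\<^sup>2) * indicator (cball 0 (2 * r)) y"
          using K0 U0 t0 by simp
      next
        case True
        then have tr: "1 \<le> t / r\<^sup>2" "t / r\<^sup>2 \<le> 2" using r0 by (simp_all add: field_simps)
        have Ta1: "Ta t = 1" unfolding Ta_def by (rule \<Phi>1) (use tr in linarith)+
        have t4: "y \<bullet> y \<ge> r\<^sup>2 / 4" using True zero_le_power2[of r] unfolding t_def by linarith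
        have iny: "y \<in> cball 0 (2 * r)"
          using nb[of y] True zero_le_power2[of r] unfolding t_def by simp
        have T'b: "\<bar>T' t\<bar> \<le> b1 / r\<^sup>2" using b1 tr r0 by (simp add: T'_def divide_right_mono)
        have cs: "(y \<bullet> G y)\<^sup>2 \<le> t * g" unfolding t_def g_def by (rule Cauchy_Schwarz_ineq)
        have am: "\<bar>u y * (y \<bullet> G y)\<bar> \<le> ((u y)\<^sup>2 + t * g) / 2"
        proof -
          have "2 * \<bar>u y * (y \<bullet> G y)\<bar> \<le> (u y)\<^sup>2 + (y \<bullet> G y)\<^sup>2"
            using sum_squares_bound[of "\<bar>u y\<bar>" "\<bar>y \<bullet> G y\<bar>"] by (simp add: abs_mult)
          then show ?thesis using cs by simp
        qed
        have am': "\<bar>(N - 2) / 2 * u y * (y \<bullet> G y)\<bar> \<le> (N - 2) / 2 * (((u y)\<^sup>2 + t * g) / 2)"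
        proof -
          have "\<bar>(N - 2) / 2 * u y * (y \<bullet> G y)\<bar> = (N - 2) / 2 * \<bar>u y * (y \<bullet> G y)\<bar>"
            using N2 by (simp add: abs_mult)
          also have "\<dots> \<le> (N - 2) / 2 * (((u y)\<^sup>2 + t * g) / 2)"
            using am N2 by (intro mult_left_mono) auto
          finally show ?thesis .
        qed
        have FU: "0 \<le> F (u y)" "F (u y) \<le> 4 * Cf * U r / r\<^sup>2"
          using F0[OF u_nonneg] Fw1[of y] wU[OF t4] by auto
        have tg: "t * g \<le> 2 * r\<^sup>2 * g" using True t0 by (intro mult_right_mono) auto
        have tF: "t * F (u y) \<le> 2 * r\<^sup>2 * (4 * Cf * U r / r\<^sup>2)"
          using True t0 FU by (intro mult_mono) auto
        then have tF: "t * F (u y) \<le> 8 * Cf * U r" using r0 by simp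
        have tF0: "0 \<le> t * F (u y)" "0 \<le> t * g" using t0 FU by auto
        have "\<bar>Z\<bar> \<le> \<bar>(y \<bullet> G y)\<^sup>2\<bar> + \<bar>t * F (u y)\<bar> + \<bar>t * g / 2\<bar> + \<bar>(N - 2) / 2 * u y * (y \<bullet> G y)\<bar>"
        proof -
          have "t * (F (u y) - g / 2) = t * F (u y) - t * g / 2" by (simp add: right_diff_distrib)
          then show ?thesis unfolding Z_def by linarith
        qed
        also have "\<dots> \<le> t * g + 8 * Cf * U r + t * g / 2 + (N - 2) / 2 * (((u y)\<^sup>2 + t * g) / 2)"
          using cs am' tF tF0 zero_le_power2[of "y \<bullet> G y"] by linarith
        also have "\<dots> \<le> t * g + 8 * Cf * U r + t * g / 2 + (N - 2) / 2 * ((U r + t * g) / 2)"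
          using uU[OF t4] N2 by (intro add_left_mono mult_left_mono) auto
        also have "\<dots> = (3 / 2 + (N - 2) / 4) * (t * g) + (8 * Cf + (N - 2) / 4) * U r"
          by (simp add: field_simps)
        also have "\<dots> \<le> (3 / 2 + (N - 2) / 4) * (2 * r\<^sup>2 * g) + (8 * Cf + (N - 2) / 4) * U r"
          using tg N2 by (intro add_right_mono mult_left_mono) auto
        also have "(3 / 2 + (N - 2) / 4) * (2 * r\<^sup>2 * g) = (3 + (N - 2) / 2) * r\<^sup>2 * g"
          by (simp add: field_simps)
        finally have Zb: "\<bar>Z\<bar> \<le> (3 + (N - 2) / 2) * r\<^sup>2 * g + (8 * Cf + (N - 2) / 4) * U r" .
        have "2 * T' t * Z \<le> 2 * \<bar>T' t\<bar> * \<bar>Z\<bar>"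
          by (metis abs_ge_self abs_mult abs_numeral)
        also have "\<dots> \<le> 2 * (b1 / r\<^sup>2) * ((3 + (N - 2) / 2) * r\<^sup>2 * g + (8 * Cf + (N - 2) / 4) * U r)"
          using T'b Zb b10 by (intro mult_mono) auto
        also have "\<dots> = K2 * g + K3 * (U r / r\<^sup>2)"
          using r0 by (simp add: K2_def K3_def field_simps)
        finally show "2 * T' t * Z \<le> K2 * ((Ta t)\<^sup>2 * g) + K3 * (U r / r\<^sup>2) * indicator (cball 0 (2 * r)) y"
          using iny Ta1 by simp
      qed
    qed (use cacc(2) ind in auto)
    also have "\<dots> = K2 * P + K3 * (U r / r\<^sup>2) * vol r"
      using cacc(2) ind by (simp add: P_def vol_def)
    also have "\<dots> \<le> K2 * (K1 * (U r / r\<^sup>2) * vol r) + K3 * (U r / r\<^sup>2) * vol r"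
      using Pb K0 by (intro add_right_mono mult_left_mono)
    also have "\<dots> = (K2 * K1 + K3) * (U r / r\<^sup>2) * vol r"
      by (simp only: distrib_right mult.assoc)
    finally show ?thesis .
  qed
  \<comment> \<open>Net exponent: r^(-2a) from u^2, r^-2 from the cutoff and r^N from the
    volume.\<close>
  define d where "d = 2 * a - (N - 2)"
  have d: "d > 0" using a by (simp add: d_def N_def)
  define K where "K = (K2 * K1 + K3) * (C0\<^sup>2 * 4 powr a) * (unit_ball_vol N * 2 ^ DIM('a))"
  have rate: "(K2 * K1 + K3) * (U r / r\<^sup>2) * vol r = K * r powr - d" if r: "r > 0" for r
  proof -
    have U: "U r = C0\<^sup>2 * 4 powr a * r powr (- 2 * a)"
    proof -
      have "(r\<^sup>2 / 4) powr - a = r\<^sup>2 powr - a / 4 powr - a" using r by (simp add: powr_divide)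
      also have "r\<^sup>2 powr - a = r powr (- 2 * a)"
        using r powr_powr[of r 2 "- a"] by simp
      also have "\<dots> / 4 powr - a = 4 powr a * r powr (- 2 * a)"
        by (simp add: powr_minus divide_inverse)
      finally show ?thesis by (simp add: U_def)
    qed
    have vol: "vol r = unit_ball_vol N * 2 ^ DIM('a) * r powr N"
      using r content_cball[of "2 * r" "0::'a"]
      by (simp add: vol_def N_def power_mult_distrib powr_realpow)
    have exps: "r powr (- 2 * a) / r\<^sup>2 * r powr N = r powr - d"
    proof -
      have "r\<^sup>2 = r powr 2" using r by simp
      then have "r powr (- 2 * a) / r\<^sup>2 * r powr N = r powr (- 2 * a - 2 + N)"
        by (simp only: powr_diff powr_add)
      also have "- 2 * a - 2 + N = - d" by (simp add: d_def)
      finally show ?thesis .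
    qed
    have "(K2 * K1 + K3) * (U r / r\<^sup>2) * vol r = K * (r powr (- 2 * a) / r\<^sup>2 * r powr N)"
      unfolding U vol K_def by simp
    then show ?thesis unfolding exps .
  qed
  have lim: "((\<lambda>r. K * r powr - d) \<longlongrightarrow> 0) at_top"
    using tendsto_mult_left[OF tendsto_neg_powr[OF _ filterlim_ident, of "- d"], of K] d by simp
  obtain e where e: "e > 0" "\<And>y. dist y x < e \<Longrightarrow> w y > w x / 2"
  proof -
    have "open {y. w y > w x / 2}"
      by (intro open_Collect_less continuous_intros cw)
    moreover have "x \<in> {y. w y > w x / 2}" using wx by simp
    ultimately obtain e where "e > 0" "ball x e \<subseteq> {y. w y > w x / 2}"
      by (meson open_contains_ball)
    then show ?thesis by (intro that[of e]) (auto simp: subset_iff dist_commute)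
  qed
  \<comment> \<open>A lower bound that does not depend on r: w exceeds w x / 2 on this ball, and the
    cutoff is 1 there once r is large.\<close>
  define c where "c = \<kappa> * (w x / 2) * measure lborel (ball x e)"
  have c: "c > 0" using \<kappa> wx content_ball_pos[OF e(1), of x] by (simp add: c_def)
  have ge: "c \<le> K * r powr - d" if r: "r \<ge> 2 * \<rho>" "r \<ge> norm x + e" for r
  proof -
    have r0: "r > 0" using r \<rho> by simp
    have "c = (\<integral>y. \<kappa> * (w x / 2) * indicator (ball x e) y \<partial>lborel)" by (simp add: c_def)
    also have "\<dots> \<le> (\<integral>y. S ((y \<bullet> y) / r\<^sup>2) * (\<kappa> * w y) \<partial>lborel)"
    proof (rule integral_mono')
      define \<rho>' where "\<rho>' = max 1 \<bar>2 * r\<^sup>2\<bar>"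
      have "S ((y \<bullet> y) / r\<^sup>2) = 0" if "norm y \<ge> \<rho>'" for y :: 'a
        using norm_ge_imp_inner_ge[of "2 * r\<^sup>2" y] that r0
        by (intro S0) (simp add: \<rho>'_def field_simps)
      then show "integrable lborel (\<lambda>y. S ((y \<bullet> y) / r\<^sup>2) * (\<kappa> * w y))"
        using r0 by (intro continuous_compact_support_integrable[of _ \<rho>'] continuous_intros cw
          continuous_on_compose2[OF cS(1)[of UNIV]]) auto
      fix y :: 'a
      show "0 \<le> S ((y \<bullet> y) / r\<^sup>2) * (\<kappa> * w y)" using S01 \<kappa> w0 by simp
      show "\<kappa> * (w x / 2) * indicator (ball x e) y \<le> S ((y \<bullet> y) / r\<^sup>2) * (\<kappa> * w y)"
      proof (cases "y \<in> ball x e")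
        case True
        then have "norm y \<le> r" using norm_triangle_ineq2[of y x] r by (simp add: dist_norm norm_minus_commute)
        then have "(norm y)\<^sup>2 \<le> r\<^sup>2" by (intro power_mono) auto
        then have "S ((y \<bullet> y) / r\<^sup>2) = 1" using r0 by (intro S1) (simp add: power2_norm_eq_inner)
        moreover have "w x / 2 \<le> w y" using e(2)[of y] True by (simp add: dist_commute)
        ultimately show ?thesis using True \<kappa> by simp
      qed (use S01 \<kappa> w0 in simp)
    qed
    also have "\<dots> \<le> K * r powr - d" using key[OF r(1)] rate[OF r0] by simp
    finally show ?thesis .
  qed
  have "eventually (\<lambda>r. c \<le> K * r powr - d) at_top"
    using eventually_ge_at_top[of "2 * \<rho>"] eventually_ge_at_top[of "norm x + e"]
    by eventually_elim (rule ge)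
  then have "c \<le> 0" by (rule tendsto_lowerbound[OF lim]) simp
  then show False using c by simp
qed

end

section \<open>Convex nonlinearities of power type\<close>

text \<open>The last inequality is the admissibility condition
  \<open>(\<beta> - p)\<^sup>2 < p * (p - 1)\<close> at \<beta> = (N - 2) (p - 1) / 4. After
  factoring, the lower bound on p makes one factor positive; the other is negative by p < p_crit N
  for N \<ge> 11, and because t \<le> 3 for N \<le> 10. That p0 is finite and greater than 1
  excludes the special branches of the conjugate exponent.\<close>

lemma supercritical_conjugate_exponentE:
  fixes p0 q0 :: ereal
  assumes N: "N \<ge> 3" and s: "supercritical N p0" and p0: "p0 = conjugate_exponent q0"
  obtains p where "p0 = ereal p" "q0 = ereal (p / (p - 1))" "p > (real N + 2) / (real N - 2)" "p > 1"
    "((real N - 2) * (p - 1) / 4 - p)\<^sup>2 < p * (p - 1)"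
proof -
  have "p0 \<noteq> \<infinity>" using s unfolding supercritical_def by (cases "N \<le> 10") auto
  moreover have "p0 > ereal ((real N + 2) / (real N - 2))" using s by (simp add: supercritical_def)
  ultimately obtain p where p: "p0 = ereal p" "p > (real N + 2) / (real N - 2)"
    by (cases p0) auto
  have n: "real N - 2 \<ge> 1" using N by linarith
  then have "(real N + 2) / (real N - 2) > 1" by (simp add: field_simps)
  with p have p1: "p > 1" by linarith
  have q1: "q0 \<noteq> 1" and "\<bar>q0\<bar> \<noteq> \<infinity>"
    using p(1) p1 p0 unfolding conjugate_exponent_def by (auto split: if_splits)
  then obtain q where q: "q0 = ereal q" by (cases q0) auto
  have "q \<noteq> 1" using q q1 by (simp add: one_ereal_def)
  moreover have "ereal p = ereal q / (ereal q - 1)"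
    using p0 p(1) q q1 by (simp add: conjugate_exponent_def)
  ultimately have pq: "p = q / (q - 1)" by (simp add: one_ereal_def)
  then have "q = p / (p - 1)" using \<open>q \<noteq> 1\<close> p1 by (simp add: field_simps)
  \<comment> \<open>In terms of \<open>t\<close> the critical exponent is \<open>p_crit N = 1 + 4 / ((t + 1) (t - 3))\<close> and the quadratic
    inequality factorises.\<close>
  define t where "t = sqrt (real N - 1)"
  have t2: "real N = t\<^sup>2 + 1" and t1: "t > 1" using N by (auto simp: t_def)
  have x: "(t\<^sup>2 - 1) * (p - 1) > 4"
  proof -
    have "(t\<^sup>2 - 1) * p > t\<^sup>2 + 3"
      using p(2) n t2 by (simp add: field_simps)
    then show ?thesis by (simp add: algebra_simps)
  qed
  have lower: "(t - 1) * (t + 3) * (p - 1) > 4"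
  proof -
    have "(t\<^sup>2 - 1) * (p - 1) \<le> (t - 1) * (t + 3) * (p - 1)"
      using t1 p1 by (intro mult_right_mono) (auto simp: power2_eq_square algebra_simps)
    with x show ?thesis by linarith
  qed
  have upper: "(t + 1) * (t - 3) * (p - 1) < 4"
  proof (cases "N \<le> 10")
    case True
    then have "t \<le> 3" by (auto simp: t_def real_sqrt_le_iff' intro!: real_le_lsqrt)
    then have "(t + 1) * (t - 3) * (p - 1) \<le> 0"
      using t1 p1 by (intro mult_nonpos_nonneg mult_nonneg_nonpos) auto
    then show ?thesis by simp
  next
    case False
    then have t3: "t > 3" by (auto simp: t_def intro!: real_less_rsqrt)
    have pc: "p < p_crit N" using s p(1) False by (simp add: supercritical_def)
    have "p_crit N - 1 = 4 / ((t + 1) * (t - 3))"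
    proof -
      have e1: "(real N - 2) * (real N - 10) = (t + 1) * (t - 3) * ((t - 1) * (t + 3))"
        unfolding t2 by (simp add: power2_eq_square algebra_simps)
      have e2: "(real N - 2)\<^sup>2 - 4 * real N + 8 * sqrt (real N - 1) =
          ((t + 1) * (t - 3) + 4) * ((t - 1) * (t + 3))"
        unfolding t_def[symmetric] unfolding t2 by (simp add: power2_eq_square algebra_simps)
      have "(t - 1) * (t + 3) \<noteq> 0" "(t + 1) * (t - 3) \<noteq> 0" using t3 by auto
      then show ?thesis unfolding p_crit_def e1 e2
        by (simp add: nonzero_mult_divide_mult_cancel_right add_divide_distrib)
    qed
    with pc have "p - 1 < 4 / ((t + 1) * (t - 3))" by linarith
    moreover have "0 < (t + 1) * (t - 3)" using t3 by simp
    ultimately show ?thesis by (simp add: pos_less_divide_eq mult.commute)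
  qed
  have "16 * (((real N - 2) * (p - 1) / 4 - p)\<^sup>2 - p * (p - 1)) =
     ((t + 1) * (t - 3) * (p - 1) - 4) * ((t - 1) * (t + 3) * (p - 1) - 4)"
    unfolding t2 by (simp add: power2_eq_square field_simps)
  also have "\<dots> < 0" using lower upper by (intro mult_neg_pos) auto
  finally have "((real N - 2) * (p - 1) / 4 - p)\<^sup>2 < p * (p - 1)" by simp
  then show ?thesis using that p p1 q \<open>q = p / (p - 1)\<close> by blast
qed

section \<open>The nonlinearity: convexity, behaviour at 0, power bounds on (0, M]\<close>

locale convex_nonlinearity =
  fixes f :: "real \<Rightarrow> real" and p :: real
  assumes f_C2: "C2_half f" and f_mono: "mono_on {0..} f" and f_convex: "convex_on {0..} f"
    and f_pos: "\<And>s. s > 0 \<Longrightarrow> f s > 0" and p1: "p > 1"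
    and primitive: "\<And>s. s \<ge> 0 \<Longrightarrow> (p + 1) * integral {0..s} f \<le> s * f s"
begin

lemma half_deriv_within:
  assumes "s \<ge> 0"
  shows "(f has_real_derivative half_deriv f s) (at s within {0..})"
    and "(half_deriv f has_real_derivative half_deriv (half_deriv f) s) (at s within {0..})"
proof -
  have "f differentiable at s within {0..}" "half_deriv f differentiable at s within {0..}"
    using f_C2 assms by (auto simp: C2_half_def differentiable_on_def)
  then show "(f has_real_derivative half_deriv f s) (at s within {0..})"
    "(half_deriv f has_real_derivative half_deriv (half_deriv f) s) (at s within {0..})"
    by (simp_all add: vector_derivative_works has_real_derivative_iff_has_vector_derivative half_deriv_def[abs_def])
qed

lemma at_half_line: "s > 0 \<Longrightarrow> at s within {0..} = at (s::real)"
  by (rule at_within_interior) auto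

lemma half_deriv_at:
  assumes "s > 0"
  shows "(f has_real_derivative half_deriv f s) (at s)"
    and "(half_deriv f has_real_derivative half_deriv (half_deriv f) s) (at s)"
  using half_deriv_within[of s] assms by (auto simp: at_half_line)

lemma tangent_below:
  assumes "s > 0" "t \<ge> 0"
  shows "f t - f s \<ge> half_deriv f s * (t - s)"
  by (rule convex_on_imp_above_tangent[OF f_convex])
    (use assms half_deriv_within in auto)

lemma half_deriv_mono:
  assumes "0 < s" "s \<le> t"
  shows "half_deriv f s \<le> half_deriv f t"
proof (cases "s = t")
  case False
  have "half_deriv f s * (t - s) \<le> half_deriv f t * (t - s)"
    using tangent_below[of s t] tangent_below[of t s] assms by (simp add: algebra_simps)
  then show ?thesis using False assms by simp
qed simp

lemma second_half_deriv_nonneg: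
  assumes "s > 0"
  shows "half_deriv (half_deriv f) s \<ge> 0"
proof (rule ccontr)
  assume "\<not> 0 \<le> half_deriv (half_deriv f) s"
  then obtain d where d: "d > 0" "\<And>h. 0 < h \<Longrightarrow> h < d \<Longrightarrow> half_deriv f (s + h) < half_deriv f s"
    using DERIV_neg_dec_right[OF half_deriv_at(2)[OF assms]] by auto
  from d(2)[of "d / 2"] d(1) half_deriv_mono[of s "s + d / 2"] assms show False by simp
qed

lemma f_cont: "continuous_on {0..} f"
  using half_deriv_within(1) by (meson DERIV_continuous_on atLeast_iff)

lemma half_deriv_cont: "continuous_on {0..} (half_deriv f)"
  using half_deriv_within(2) by (meson DERIV_continuous_on atLeast_iff)

text \<open>By monotonicity the primitive at s is at least s f(0), so (p + 1) f(0) \<le> f(s);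
  letting s tend to 0 gives p f(0) \<le> 0.\<close>

lemma f_zero: "f 0 = 0"
proof (rule antisym)
  have lim: "(f \<longlongrightarrow> f 0) (at_right 0)"
    by (rule tendsto_within_subset[of f _ 0 "{0..}"]) (use f_cont in \<open>auto simp: continuous_on_def\<close>)
  show "0 \<le> f 0"
    by (rule tendsto_lowerbound[OF lim])
      (auto simp: eventually_at_filter intro!: always_eventually less_imp_le[OF f_pos])
  have "(p + 1) * f 0 \<le> f s" if "s > 0" for s
  proof -
    have "integral {0..s} (\<lambda>_. f 0) \<le> integral {0..s} f"
      by (rule integral_le) (use f_mono that f_cont in
        \<open>auto intro!: integrable_continuous_interval intro: continuous_on_subset mono_onD\<close>)
    then have "(p + 1) * (s * f 0) \<le> (p + 1) * integral {0..s} f"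
      using that p1 by (intro mult_left_mono) auto
    also have "\<dots> \<le> s * f s" using primitive that by simp
    finally have "s * ((p + 1) * f 0) \<le> s * f s" by (simp add: algebra_simps)
    then show ?thesis using that by simp
  qed
  then have "(p + 1) * f 0 \<le> f 0"
    by (intro tendsto_lowerbound[OF lim]) (auto simp: eventually_at_filter intro!: always_eventually)
  then have "p * f 0 \<le> 0" by (simp add: algebra_simps)
  then show "f 0 \<le> 0" using p1 by (simp add: mult_le_0_iff)
qed

lemma f_le_half_deriv: "s > 0 \<Longrightarrow> f s \<le> s * half_deriv f s"
  using tangent_below[of s 0] f_zero by (simp add: algebra_simps)

lemma half_deriv_pos: "s > 0 \<Longrightarrow> half_deriv f s > 0"
  using f_le_half_deriv[of s] f_pos[of s] by (smt (verit) zero_less_mult_pos)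

text \<open>The assumption says that f f'' / f'^2 tends to (p - 1) / p. Then the derivative of f /
  f' tends to 1 / p, so by l'Hopital s f' / f tends to p, and s^2 f'' / f is the product of f f'' /
  f'^2 and (s f' / f)^2.\<close>

lemma second_log_derivative_limit:
  assumes q: "(q_fun f \<longlongrightarrow> ereal (p / (p - 1))) (at_right 0)"
  shows "((\<lambda>s. s\<^sup>2 * half_deriv (half_deriv f) s / f s) \<longlongrightarrow> p * (p - 1)) (at_right 0)"
proof -
  define f' f'' where "f' = half_deriv f" and "f'' = half_deriv (half_deriv f)"
  have pos: "f s > 0" "f' s > 0" if "s > 0" for s
    using that f_pos half_deriv_pos by (auto simp: f'_def)
  have ev0: "eventually (\<lambda>s::real. s > 0) (at_right 0)" by (simp add: eventually_at_filter)
  \<comment> \<open>A finite limit excludes the default value \<infinity> near 0, so there f'' is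
    nonzero and the quotient formula applies.\<close>
  have "eventually (\<lambda>s. q_fun f s < \<infinity>) (at_right 0)"
    using order_tendstoD(2)[OF q, of "\<infinity>"] by simp
  then have ev: "eventually (\<lambda>s. q_fun f s = ereal ((f' s)\<^sup>2 / (f s * f'' s)) \<and> f'' s \<noteq> 0) (at_right 0)"
    by eventually_elim (auto simp: q_fun_def f'_def f''_def split: if_splits)
  have "((\<lambda>s. ereal ((f' s)\<^sup>2 / (f s * f'' s))) \<longlongrightarrow> ereal (p / (p - 1))) (at_right 0)"
    by (rule Lim_transform_eventually[OF q]) (use ev in \<open>auto elim: eventually_mono\<close>)
  then have "((\<lambda>s. (f' s)\<^sup>2 / (f s * f'' s)) \<longlongrightarrow> p / (p - 1)) (at_right 0)"
    by (simp add: lim_ereal)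
  then have "((\<lambda>s. inverse ((f' s)\<^sup>2 / (f s * f'' s))) \<longlongrightarrow> inverse (p / (p - 1))) (at_right 0)"
    using p1 by (intro tendsto_inverse) auto
  then have L1: "((\<lambda>s. f s * f'' s / (f' s)\<^sup>2) \<longlongrightarrow> (p - 1) / p) (at_right 0)" by simp
  have L2: "((\<lambda>s. (f s / f' s) / s) \<longlongrightarrow> 1 / p) (at_right 0)"
  proof (rule lhopital_right_0)
    show "((\<lambda>s. f s / f' s) \<longlongrightarrow> 0) (at_right 0)"
    proof (rule tendsto_sandwich[OF _ _ tendsto_const])
      show "((\<lambda>s. s) \<longlongrightarrow> 0) (at_right (0::real))" by (rule tendsto_ident_at)
      show "eventually (\<lambda>s. 0 \<le> f s / f' s) (at_right 0)"
        using ev0 by eventually_elim (simp add: pos less_imp_le)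
      show "eventually (\<lambda>s. f s / f' s \<le> s) (at_right 0)"
        using ev0
      proof eventually_elim
        case (elim s)
        then show ?case using pos[of s] f_le_half_deriv[of s] by (simp add: field_simps f'_def)
      qed
    qed
    show "eventually (\<lambda>s. ((\<lambda>s. f s / f' s) has_real_derivative 1 - f s * f'' s / (f' s)\<^sup>2) (at s)) (at_right 0)"
      using ev0
    proof eventually_elim
      case (elim s)
      have "((\<lambda>s. f s / f' s) has_real_derivative (f' s * f' s - f s * f'' s) / (f' s * f' s)) (at s)"
        using half_deriv_at[OF elim] pos[OF elim] by (intro DERIV_divide) (auto simp: f'_def f''_def)
      moreover have "(f' s * f' s - f s * f'' s) / (f' s * f' s) = 1 - f s * f'' s / (f' s)\<^sup>2"
        using pos[OF elim] by (simp add: diff_divide_distrib power2_eq_square)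
      ultimately show ?case by simp
    qed
    show "eventually (\<lambda>s. ((\<lambda>s. s) has_real_derivative 1) (at s)) (at_right (0::real))" by simp
    have "((\<lambda>s. 1 - f s * f'' s / (f' s)\<^sup>2) \<longlongrightarrow> 1 - (p - 1) / p) (at_right 0)"
      by (intro tendsto_intros L1)
    moreover have "1 - (p - 1) / p = 1 / p" using p1 by (simp add: field_simps)
    ultimately show "((\<lambda>s. (1 - f s * f'' s / (f' s)\<^sup>2) / 1) \<longlongrightarrow> 1 / p) (at_right 0)" by simp
  qed (use ev0 in \<open>auto elim: eventually_mono\<close>)
  have "((\<lambda>s. (f s * f'' s / (f' s)\<^sup>2) / ((f s / f' s) / s)^2) \<longlongrightarrow> ((p - 1) / p) / (1 / p)^2) (at_right 0)"
    by (rule tendsto_divide[OF L1 tendsto_power[OF L2]]) (use p1 in auto)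
  moreover have "((p - 1) / p) / (1 / p)^2 = p * (p - 1)"
    using p1 by (simp add: power2_eq_square)
  moreover have "eventually (\<lambda>s. (f s * f'' s / (f' s)\<^sup>2) / ((f s / f' s) / s)^2 = s\<^sup>2 * f'' s / f s) (at_right 0)"
    using ev0
  proof eventually_elim
    case (elim s)
    then show ?case using pos[of s] by (simp add: field_simps power2_eq_square)
  qed
  ultimately show ?thesis unfolding f''_def[symmetric] using Lim_transform_eventually by fastforce
qed

text \<open>Monotonicity of f and f' carries the bounds from a neighbourhood of 0 to (0, M], since
  there s^p is bounded above and s^(p-1) is bounded below away from 0. The upper bound on f comes
  from f \<le> s f', which is convexity together with f(0) = 0.\<close>

lemma power_bounds:
  assumes growth: "\<exists>\<epsilon>>0. \<exists>c1>0. \<exists>c2>0. \<forall>s\<in>{0<..<\<epsilon>}. f s \<ge> c1 * s powr p \<and>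
      half_deriv f s \<le> c2 * s powr (p - 1)" and M: "M > 0"
  obtains c C where "c > 0" "C > 0" "\<And>s. 0 < s \<Longrightarrow> s \<le> M \<Longrightarrow> c * s powr p \<le> f s"
    "\<And>s. 0 < s \<Longrightarrow> s \<le> M \<Longrightarrow> f s \<le> C * s powr p"
    "\<And>s. 0 < s \<Longrightarrow> s \<le> M \<Longrightarrow> half_deriv f s \<le> C * s powr (p - 1)"
proof -
  obtain \<epsilon> c1 c2 where e: "\<epsilon> > 0" "c1 > 0" "c2 > 0"
    and lo: "\<And>s. 0 < s \<Longrightarrow> s < \<epsilon> \<Longrightarrow> f s \<ge> c1 * s powr p"
    and up: "\<And>s. 0 < s \<Longrightarrow> s < \<epsilon> \<Longrightarrow> half_deriv f s \<le> c2 * s powr (p - 1)"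
    using growth by auto
  define d where "d = \<epsilon> / 2"
  have d: "0 < d" "d < \<epsilon>" using e by (auto simp: d_def)
  define c where "c = min c1 (f d / M powr p)"
  define C where "C = max c2 (half_deriv f M / d powr (p - 1))"
  have up': "half_deriv f s \<le> C * s powr (p - 1)" if s: "0 < s" "s \<le> M" for s
  proof (cases "s < \<epsilon>")
    case True
    have "half_deriv f s \<le> c2 * s powr (p - 1)" using up s True by simp
    also have "\<dots> \<le> C * s powr (p - 1)" by (intro mult_right_mono) (auto simp: C_def)
    finally show ?thesis .
  next
    case False
    have "half_deriv f s \<le> half_deriv f M" using half_deriv_mono s by simp
    also have "\<dots> = half_deriv f M / d powr (p - 1) * d powr (p - 1)" using d by simp
    also have "\<dots> \<le> C * s powr (p - 1)"
      using d False p1 e by (intro mult_mono powr_mono2) (auto simp: C_def)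
    finally show ?thesis .
  qed
  show ?thesis
  proof (rule that[of c C])
    show "c > 0" using e d M f_pos[of d] by (simp add: c_def)
    show "C > 0" using e by (simp add: C_def)
    fix s assume s: "0 < s" "s \<le> M"
    show "half_deriv f s \<le> C * s powr (p - 1)" using up' s .
    have "f s \<le> s * (C * s powr (p - 1))"
      using f_le_half_deriv[of s] up'[OF s] s by (smt (verit) mult_left_mono)
    also have "\<dots> = C * s powr p" using s by (simp add: powr_diff)
    finally show "f s \<le> C * s powr p" .
    show "c * s powr p \<le> f s"
    proof (cases "s < \<epsilon>")
      case True
      have "c * s powr p \<le> c1 * s powr p" by (intro mult_right_mono) (auto simp: c_def)
      also have "\<dots> \<le> f s" using lo s True by simp
      finally show ?thesis .
    next
      case False
      have "c * s powr p \<le> f d / M powr p * M powr p"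
        using s p1 f_pos[of d] d M by (intro mult_mono powr_mono2) (auto simp: c_def less_imp_le)
      also have "\<dots> = f d" using M by simp
      also have "\<dots> \<le> f s" using f_mono d False by (auto intro: mono_onD)
      finally show ?thesis .
    qed
  qed
qed

end

section \<open>The Liouville theorem\<close>

theorem theorem1p25:
  fixes f :: "real \<Rightarrow> real" and q0 p0 :: ereal and u :: "real ^ 'n \<Rightarrow> real"
  assumes dim: "CARD('n) \<ge> 3"
    and f_C2: "C2_half f"
    and f_mono: "mono_on {0..} f"
    and f_convex: "convex_on {0..} f"
    and f_pos: "\<And>s. s > 0 \<Longrightarrow> f s > 0"
    and q0: "(q_fun f \<longlongrightarrow> q0) (at_right 0)"
    and p0: "p0 = conjugate_exponent q0"
    and u_C2: "C2 u"
    and u_bounded: "bounded (range u)"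
    and u_nonneg: "\<And>x. u x \<ge> 0"
    and u_solution: "\<And>x. - laplacian u x = f (u x)"
    and u_stable: "stable_outside_compact f u"
    and p0_range: "supercritical CARD('n) p0"
    and growth: "\<exists>\<epsilon>>0. \<exists>c1>0. \<exists>c2>0. \<forall>s\<in>{0<..<\<epsilon>}.
        f s \<ge> c1 * s powr real_of_ereal p0 \<and>
        half_deriv f s \<le> c2 * s powr (real_of_ereal p0 - 1)"
    and primitive: "\<And>s. s \<ge> 0 \<Longrightarrow> (real_of_ereal p0 + 1) * integral {0..s} f \<le> s * f s"
  shows "\<forall>x. u x = 0"
proof -
  define N where "N = real CARD('n)"
  have DIM: "real DIM(real ^ 'n) = N" by (simp add: N_def)
  have N: "N \<ge> 3" using dim by (simp add: N_def)
  obtain p where p: "p0 = ereal p" "q0 = ereal (p / (p - 1))" "p > (N + 2) / (N - 2)" "p > 1"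
    and \<kappa>: "((N - 2) * (p - 1) / 4 - p)\<^sup>2 < p * (p - 1)"
    using supercritical_conjugate_exponentE[OF dim p0_range p0] unfolding N_def by blast
  interpret convex_nonlinearity f p
    using f_C2 f_mono f_convex f_pos p(4) primitive by unfold_locales (auto simp: p(1))
  obtain M where M: "M > 0" "\<And>x. u x \<le> M"
  proof -
    obtain B where "\<And>x. \<bar>u x\<bar> \<le> B" using u_bounded by (auto simp: bounded_iff)
    then have "u x \<le> max 1 B" for x by (meson abs_le_D1 max.coboundedI2)
    then show ?thesis by (intro that[of "max 1 B"]) auto
  qed
  obtain c C where cC: "c > 0" "C > 0"
    and fl: "\<And>s. 0 < s \<Longrightarrow> s \<le> M \<Longrightarrow> c * s powr p \<le> f s"
    and fu: "\<And>s. 0 < s \<Longrightarrow> s \<le> M \<Longrightarrow> f s \<le> C * s powr p"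
    and f'u: "\<And>s. 0 < s \<Longrightarrow> s \<le> M \<Longrightarrow> half_deriv f s \<le> C * s powr (p - 1)"
    using power_bounds[OF growth[unfolded p(1) real_of_ereal.simps] M(1)] by blast
  have fb: "f s \<le> C * s powr p" if "0 \<le> s" "s \<le> M" for s
    using fu[of s] that f_zero by (cases "s = 0") auto
  obtain DG where DG: "\<And>x. (u has_derivative (\<lambda>h. grad u x \<bullet> h)) (at x)"
    "\<And>x. (grad u has_derivative DG x) (at x)" "\<And>b. continuous_on UNIV (\<lambda>x. DG x b)"
    "\<And>x. laplacian u x = (\<Sum>b\<in>Basis. DG x b \<bullet> b)"
    using C2_D[OF u_C2] by blast
  have eq: "(\<Sum>b\<in>Basis. DG x b \<bullet> b) = - f (u x)" for x using u_solution[of x] DG(4)[of x] by simp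
  interpret semilinear_solution u "grad u" DG f M
    by unfold_locales (fact DG eq u_nonneg M f_cont)+
  \<comment> \<open>Solves 2 \<beta> + p - 1 = N (p - 1) / 2; the lower bound on p says exactly that
    \<beta> > 1.\<close>
  define \<beta> where "\<beta> = (N - 2) * (p - 1) / 4"
  define Q where "Q = 2 * \<beta> + p - 1"
  have pN: "(N - 2) * (p - 1) > 4" using p(3) N by (simp add: field_simps)
  have \<beta>: "\<beta> > 1" "\<beta> = p + ((N - 2) * (p - 1) / 4 - p)" using pN by (auto simp: \<beta>_def)
  have QN: "Q = N * (p - 1) / 2" by (simp add: Q_def \<beta>_def field_simps)
  have Qb: "Q > 2 * \<beta>" "Q > 1" using p(4) \<beta>(1) by (auto simp: Q_def)
  obtain \<psi> \<psi>' K L c' C' where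
    d\<psi>: "\<And>s. (\<psi> has_real_derivative \<psi>' s) (at s)" and c\<psi>': "continuous_on UNIV \<psi>'"
    and dK: "\<And>s. (K has_real_derivative (\<psi>' s)\<^sup>2) (at s)"
    and dL: "\<And>s. (L has_real_derivative \<psi> s * \<psi>' s - K s) (at s)"
    and c': "c' > 0" "C' > 0"
    and lower: "\<And>s. 0 \<le> s \<Longrightarrow> s \<le> M \<Longrightarrow>
      c' * s powr (2 * \<beta> + p - 1) \<le> half_deriv f s * (\<psi> s)\<^sup>2 - f s * K s"
    and \<psi>b: "\<And>s. 0 \<le> s \<Longrightarrow> s \<le> M \<Longrightarrow> (\<psi> s)\<^sup>2 \<le> C' * s powr (2 * \<beta>)"
    and Lb: "\<And>s. 0 \<le> s \<Longrightarrow> s \<le> M \<Longrightarrow> \<bar>L s\<bar> \<le> C' * s powr (2 * \<beta>)"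
  proof (rule test_weights_exist[OF p(4) M(1) half_deriv_at f_zero f_pos less_imp_le[OF half_deriv_pos]
        second_half_deriv_nonneg cC(1) fl fu f'u second_log_derivative_limit[OF q0[unfolded p(2)]]
        \<kappa> \<beta>(2) \<beta>(1)])
    fix \<psi> \<psi>' K L :: "real \<Rightarrow> real" and c C
    assume w: "\<And>s. (\<psi> has_real_derivative \<psi>' s) (at s)" "continuous_on UNIV \<psi>'"
      "\<And>s. (K has_real_derivative (\<psi>' s)\<^sup>2) (at s)"
      "\<And>s. (L has_real_derivative \<psi> s * \<psi>' s - K s) (at s)" "c > 0" "C > 0"
      "\<And>s. 0 \<le> s \<Longrightarrow> s \<le> M \<Longrightarrow>
        c * s powr (2 * \<beta> + p - 1) \<le> half_deriv f s * (\<psi> s)\<^sup>2 - f s * K s"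
      "\<And>s. 0 \<le> s \<Longrightarrow> s \<le> M \<Longrightarrow> (\<psi> s)\<^sup>2 \<le> C * s powr (2 * \<beta>)"
      "\<And>s. 0 \<le> s \<Longrightarrow> s \<le> M \<Longrightarrow> \<bar>L s\<bar> \<le> C * s powr (2 * \<beta>)"
    show thesis by (rule that[of \<psi> \<psi>' K L c C]) (fact w)+
  qed
  obtain K0 where K0: "compact K0" and stab: "\<And>\<phi>. C1_compact_support (- K0) \<phi> \<Longrightarrow>
      (\<integral>x. half_deriv f (u x) * (\<phi> x)\<^sup>2 \<partial>lborel) \<le> (\<integral>x. (norm (grad \<phi> x))\<^sup>2 \<partial>lborel)"
    using u_stable unfolding stable_outside_compact_def by blast
  obtain B where B: "\<And>x. x \<in> K0 \<Longrightarrow> norm x \<le> B"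
    using compact_imp_bounded[OF K0] by (auto simp: bounded_iff)
  define R1 where "R1 = B\<^sup>2 + 1"
  have R1: "R1 > 0" by (simp add: R1_def add_nonneg_pos)
  have out: "{x. x \<bullet> x \<ge> R1} \<subseteq> - K0"
  proof
    fix x :: "real ^ 'n" assume x: "x \<in> {x. x \<bullet> x \<ge> R1}"
    show "x \<in> - K0"
    proof
      assume "x \<in> K0"
      then have "(norm x)\<^sup>2 \<le> B\<^sup>2" using B by (intro power_mono) auto
      then show False using x by (simp add: R1_def power2_norm_eq_inner)
    qed
  qed
  have stable: "(\<integral>x. half_deriv f (u x) * (\<phi> x)\<^sup>2 \<partial>lborel) \<le> (\<integral>x. (norm (grad \<phi> x))\<^sup>2 \<partial>lborel)"
    if "C1_compact_support {x. x \<bullet> x \<ge> R1} \<phi>" for \<phi>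
    using that out by (intro stab) (auto simp: C1_compact_support_def)
  have ratio: "1 - 2 * \<beta> / Q = 2 / real DIM(real ^ 'n)"
  proof -
    have "1 - 2 * \<beta> / Q = (p - 1) / Q" using Qb by (simp add: Q_def field_simps)
    also have "\<dots> = 2 / N" unfolding QN using p(4) N by (simp add: field_simps)
    finally show ?thesis unfolding DIM .
  qed
  have "\<exists>A. \<forall>r>0. r\<^sup>2 > 2 * R1 \<longrightarrow>
    (\<integral>x. indicator {x. 2 * R1 \<le> x \<bullet> x \<and> norm x \<le> r} x * u x powr Q \<partial>lborel) \<le> A"
    by (rule exterior_energy_bound[OF R1 half_deriv_cont stable d\<psi> c\<psi>' dK dL _ c' lower[folded Q_def] \<psi>b Lb
        Qb(1) ratio]) (use \<beta>(1) in simp_all)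
  then obtain A where A: "\<forall>r>0. r\<^sup>2 > 2 * R1 \<longrightarrow>
    (\<integral>x. indicator {x. 2 * R1 \<le> x \<bullet> x \<and> norm x \<le> r} x * u x powr Q \<partial>lborel) \<le> A"
    by blast
  have tail: "\<exists>\<rho>>0. \<forall>s. (\<integral>x. indicator {x. \<rho> < norm x \<and> norm x \<le> s} x * u x powr Q \<partial>lborel) < \<epsilon>"
    if "\<epsilon> > 0" for \<epsilon> by (rule tail_small[OF _ R1 A that]) (use Qb in simp)
  have decay: "\<exists>\<rho>>0. \<forall>x. norm x \<ge> \<rho> \<longrightarrow> (norm x)\<^sup>2 * u x powr (p - 1) \<le> \<epsilon>" if "\<epsilon> > 0" for \<epsilon>
    by (rule decay_of_small_tail[OF p(4) cC(2) fb _ Qb(2) tail that]) (simp_all add: QN N_def)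
  \<comment> \<open>The midpoint between (N - 2) / 2, which the Pohozaev argument has to exceed, and
    N - 2, the limit for the barrier.\<close>
  define a where "a = 3 * (N - 2) / 4"
  have "2 / (p - 1) < N - 2" using pN p(4) N by (simp add: field_simps)
  then have "\<exists>C>0. \<exists>\<rho>>0. \<forall>x. norm x \<ge> \<rho> \<longrightarrow> u x \<le> C * (x \<bullet> x) powr (- a / 2)"
    by (intro fast_decay[OF p(4) cC(2) fb decay refl]) (use N in \<open>simp_all add: a_def N_def\<close>)
  then obtain C0 \<rho>0 where C0: "C0 > 0" "\<rho>0 > 0"
    and dec0: "\<And>x. norm x \<ge> \<rho>0 \<Longrightarrow> u x \<le> C0 * (x \<bullet> x) powr (- a / 2)"
    by blast
  obtain \<rho>1 where \<rho>1: "\<rho>1 > 0" "\<And>x. norm x \<ge> \<rho>1 \<Longrightarrow> (norm x)\<^sup>2 * u x powr (p - 1) \<le> 1"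
    using decay[of 1] by auto
  \<comment> \<open>Extends f by f(0) = 0 to negative arguments, so that the primitive has a
    two-sided derivative at 0, a value that u may take.\<close>
  define k where "k s = f (max 0 s)" for s
  define F where "F s = integral {0..s} k" for s
  have ck: "continuous_on UNIV k"
    unfolding k_def by (rule continuous_on_compose2[OF f_cont]) (auto intro!: continuous_intros)
  have f_nonneg: "f s \<ge> 0" if "s \<ge> 0" for s
    using that f_pos[of s] f_zero by (cases "s = 0") (auto intro: less_imp_le)
  have dF: "(F has_real_derivative f s) (at s)" if "s \<ge> 0" for s
    unfolding F_def using has_real_derivative_integral_zero_left[OF ck, of s] that f_zero by (simp add: k_def)
  have F_nonneg: "F s \<ge> 0" if "s \<ge> 0" for s
    unfolding F_def
    by (rule Henstock_Kurzweil_Integration.integral_nonneg)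
      (use f_nonneg ck in \<open>auto simp: k_def intro!: integrable_continuous_interval intro: continuous_on_subset\<close>)
  have F_le: "(p + 1) * F s \<le> s * f s" if "s \<ge> 0" for s
  proof -
    have "F s = integral {0..s} f" unfolding F_def by (rule integral_cong) (simp add: k_def)
    then show ?thesis using primitive[OF that] by (simp add: p(1))
  qed
  have "u x * f (u x) = 0" for x
    by (rule vanishing_of_fast_decay[where a = a and \<rho> = "max \<rho>0 \<rho>1", OF p(4) cC(2) fb f_nonneg dF F_nonneg F_le _ _ C0(1)])
      (use N p(3) \<rho>1 C0 dec0 in \<open>auto simp: a_def N_def\<close>)
  then show ?thesis using f_pos u_nonneg by (metis less_le mult_eq_0_iff)
qed

end
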